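(* Let $n\ge 2$, $T>0$, $G=(0,1)^n$, let $G_0\subset G$ be an arbitrary non-empty open set, let $c_0>0$ and let $\gamma_1,\dots,\gamma_n$ be positive coefficients with $\mathrm{reg}(\gamma)<c_0$. Let $n^{\ast}$ satisfy $n^\ast>2$ if $n=2$ and $n^\ast\ge n$ if $n\ge 3$. Let $a_{1i}\in L^\infty_{\mathcal F}(0,T;L^\infty_h(\mathcal M))$ for $i=1,\dots,n$ and $a_2\in L^\infty_{\mathcal F}(0,T;L_h^{n^\ast}(\mathcal M))$, with norms bounded by a number $R$ not depending on $h$. Let $C_0>0$. Then there exist a constant $C>0$, independent of $h$, and $N_0\in\mathbb N$ such that for every $N\ge N_0$, with $h=1/(N+1)$, the following holds. Let $g_1,g_2\in L^2_{\mathcal F}(0,T;H^1_h(\mathcal M))$ satisfy, for every $i=1,\dots,n$, $$|D_i(g_1-g_2)|\le C_0\,|A_i(g_1-g_2)|\quad\text{in } \mathcal M_i^\ast\times(0,T),\ \mathbb P\text{-a.s.}$$ For $k=1,2$ let $w_k$ be the solution of $$\begin{cases} dw-\sum_{i=1}^n D_i(\gamma_iD_iw)\,dt=\Big(\sum_{i=1}^n a_{1i}A_iD_iw+a_2w\Big)dt+g_k\,dB(t) & \text{in }\mathcal M\times(0,T),\\ w=0\ \text{ on }\partial\mathcal M\times(0,T),\qquad w|_{t=0}=w_0\ \text{ in }\mathcal M,\end{cases}$$ with the same initial datum $w_0$ for $k=1,2$. Let $$\Lambda_1(g_k):=\big(w_k|_{(G_0\cap\mathcal M)\times(0,T)},\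 w_k|_{t=T}\big).$$ Then $$\|g_1-g_2\|_{L^2_{\mathcal F}(0,T;L^2_h(\mathcal M))}\le C\,\|\Lambda_1(g_1)-\Lambda_1(g_2)\|_{X_1},$$ where $\|(f_1,f_2)\|_{X_1}=\|f_1\|_{L^2_{\mathcal F}(0,T;L^2_h(G_0\cap\mathcal M))}+\|f_2\|_{L^2_{\mathcal F_T}(\Omega;L^2_h(\mathcal M))}$.
   Context: Probability. $(\Omega,\mathcal F,\{\mathcal F_t\}_{t\ge0},\mathbb P)$ is a complete filtered probability space carrying a one-dimensional standard Brownian motion $B$; $\{\mathcal F_t\}$ is the natural filtration of $B$ augmented by the $\mathbb P$-null sets. For a Banach space $\mathcal X$: $L^2_{\mathcal F}(0,T;\mathcal X)$ is the space of $\mathcal X$-valued $\{\mathcal F_t\}$-adapted processes with $\mathbb E\int_0^T\|X\|_{\mathcal X}^2dt<\infty$ (with the corresponding norm); $L^\infty_{\mathcal F}(0,T;\mathcal X)$ is the space of $\mathcal X$-valued adapted bounded processes; $L^2_{\mathcal F_T}(\Omega;\mathcal X)$ is the space of $\mathcal F_T$-measurable square-integrable $\mathcal X$-valued random variables. Mesh. $N\in\mathbb N$ is sufficiently large, $h=1/(N+1)$, $\mathcal M=G\cap h\mathbb Z^n$, $\{e_k\}$ is the standard basis of $\mathbb R^n$. For a finite set $W$ of points, $W_k^\ast=\{x\pm\frac h2e_k: x\in W\}$. $\partial_k\mathcal M=(\mathcal M_k^\ast)_k^\ast\setminus\mathcal M$ and $\partial\mathcal M=\bigcup_k\partial_k\mathcal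 M$. Mesh functions are regarded as having values also at the boundary grid points whenever the operators below require them. Operators: $D_ku(x)=\frac{u(x+\frac h2e_k)-u(x-\frac h2e_k)}h$, $A_ku(x)=\frac{u(x+\frac h2e_k)+u(x-\frac h2e_k)}2$; they map functions on the primal mesh to functions on $\mathcal M_k^\ast$, and functions on $\mathcal M_k^\ast$ to functions on $\mathcal M$. Norms. For a set $W$ of mesh (primal or dual) points, $\int_Wu=h^n\sum_{x\in W}u(x)$. $\|u\|_{L^p_h(\mathcal M)}^p=\int_{\mathcal M}|u|^p$, $\|u\|_{L^\infty_h(\mathcal M)}=\max_{\mathcal M}|u|$, $\|u\|^2_{H^1_h(\mathcal M)}=\|u\|^2_{L^2_h(\mathcal M)}+\sum_i\int_{\mathcal M_i^\ast}|D_iu|^2$, and $\|u\|^2_{L^2_h(G_0\cap\mathcal M)}=\int_{G_0\cap\mathcal M}|u|^2$. Coefficients. $\gamma_i$ is the sampling on the primal and dual meshes of a function on $G$ (still denoted $\gamma_i$) with $\gamma_i>0$ and $\mathrm{reg}(\gamma):=\operatorname{ess\,sup}_{x\in G,\ i=1,\dots,n}\big(\gamma_i+\frac1{\gamma_i}+\sum_{j=1}^n|\partial_j\gamma_i|^2\big)<c_0$. The constants $C,N_0$ may depend on $n,T,G_0,c_0,n^\ast,R,C_0$ but not on $h,g_1,g_2,w_0$. *)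

theory Defs
  imports "HOL-Probability.Probability"
begin

section \<open>Mesh, difference operators and discrete norms\<close>

definition unit_cube :: "(real ^ 'n) set" where
  "unit_cube = {x. \<forall>i. 0 < x $ i \<and> x $ i < 1}"

definition primal_mesh :: "real \<Rightarrow> (real ^ 'n) set" where
  "primal_mesh h = unit_cube \<inter> {x. \<forall>i. \<exists>k::int. x $ i = h * of_int k}"

definition dual :: "real \<Rightarrow> 'n \<Rightarrow> (real ^ 'n) set \<Rightarrow> (real ^ 'n) set" where
  "dual h k W = (\<lambda>x. x + (h / 2) *\<^sub>R axis k 1) ` W \<union> (\<lambda>x. x - (h / 2) *\<^sub>R axis k 1) ` W"

definition mesh_boundary :: "real \<Rightarrow> (real ^ 'n) set" where
  "mesh_boundary h = (\<Union>k. dual h k (dual h k (primal_mesh h)) - primal_mesh h)"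

definition Dh :: "real \<Rightarrow> 'n \<Rightarrow> (real ^ 'n \<Rightarrow> real) \<Rightarrow> real ^ 'n \<Rightarrow> real" where
  "Dh h k u x = (u (x + (h / 2) *\<^sub>R axis k 1) - u (x - (h / 2) *\<^sub>R axis k 1)) / h"

definition Ah :: "real \<Rightarrow> 'n \<Rightarrow> (real ^ 'n \<Rightarrow> real) \<Rightarrow> real ^ 'n \<Rightarrow> real" where
  "Ah h k u x = (u (x + (h / 2) *\<^sub>R axis k 1) + u (x - (h / 2) *\<^sub>R axis k 1)) / 2"

definition mesh_integral :: "real \<Rightarrow> (real ^ 'n) set \<Rightarrow> (real ^ 'n \<Rightarrow> real) \<Rightarrow> real" where
  "mesh_integral h W u = h ^ CARD('n) * (\<Sum>x\<in>W. u x)"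

definition Lp_norm :: "real \<Rightarrow> real \<Rightarrow> (real ^ 'n) set \<Rightarrow> (real ^ 'n \<Rightarrow> real) \<Rightarrow> real" where
  "Lp_norm p h W u = mesh_integral h W (\<lambda>x. \<bar>u x\<bar> powr p) powr (1 / p)"

definition L2_norm :: "real \<Rightarrow> (real ^ 'n) set \<Rightarrow> (real ^ 'n \<Rightarrow> real) \<Rightarrow> real" where
  "L2_norm h W u = sqrt (mesh_integral h W (\<lambda>x. \<bar>u x\<bar>\<^sup>2))"

definition Linf_norm :: "(real ^ 'n) set \<Rightarrow> (real ^ 'n \<Rightarrow> real) \<Rightarrow> real" where
  "Linf_norm W u = Max ((\<lambda>x. \<bar>u x\<bar>) ` W)"

definition H1_norm :: "real \<Rightarrow> (real ^ 'n \<Rightarrow> real) \<Rightarrow> real" where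
  "H1_norm h u =
     sqrt ((L2_norm h (primal_mesh h) u)\<^sup>2
       + (\<Sum>i\<in>UNIV. mesh_integral h (dual h i (primal_mesh h)) (\<lambda>x. \<bar>Dh h i u x\<bar>\<^sup>2)))"

section \<open>Regularity of the diffusion coefficients\<close>

definition C1_compact_support :: "(real ^ 'n) set \<Rightarrow> (real ^ 'n \<Rightarrow> real) set" where
  "C1_compact_support S =
     {\<phi>. (\<forall>x. \<phi> differentiable (at x)) \<and>
          (\<forall>v. continuous_on UNIV (\<lambda>x. frechet_derivative \<phi> (at x) v)) \<and>
          (\<exists>K. compact K \<and> K \<subseteq> S \<and> (\<forall>x. x \<notin> K \<longrightarrow> \<phi> x = 0))}"

definition has_weak_partial ::
    "(real ^ 'n) set \<Rightarrow> 'n \<Rightarrow> (real ^ 'n \<Rightarrow> real) \<Rightarrow> (real ^ 'n \<Rightarrow> real) \<Rightarrow> bool" where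
  "has_weak_partial S j f g \<longleftrightarrow>
     (\<forall>K. compact K \<and> K \<subseteq> S \<longrightarrow> integrable (lebesgue_on K) f \<and> integrable (lebesgue_on K) g) \<and>
     (\<forall>\<phi>\<in>C1_compact_support S.
        integral\<^sup>L (lebesgue_on S) (\<lambda>x. f x * frechet_derivative \<phi> (at x) (axis j 1))
          = - integral\<^sup>L (lebesgue_on S) (\<lambda>x. g x * \<phi> x))"

definition weak_partial :: "(real ^ 'n) set \<Rightarrow> 'n \<Rightarrow> (real ^ 'n \<Rightarrow> real) \<Rightarrow> real ^ 'n \<Rightarrow> real" where
  "weak_partial S j f = (SOME g. has_weak_partial S j f g)"

text \<open>The coefficients are sampled at points, so the continuous representative is meant.
  All primal and dual mesh points lie in the open cube.\<close>

definition diffusion_coeffs :: "('n \<Rightarrow> real ^ 'n \<Rightarrow> real) \<Rightarrow> bool" where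
  "diffusion_coeffs \<gamma> \<longleftrightarrow>
     (\<forall>i. continuous_on unit_cube (\<gamma> i) \<and> (\<forall>x\<in>unit_cube. \<gamma> i x > 0) \<and>
          (\<forall>j. \<exists>g. has_weak_partial unit_cube j (\<gamma> i) g))"

definition reg :: "('n::finite \<Rightarrow> real ^ 'n \<Rightarrow> real) \<Rightarrow> ereal" where
  "reg \<gamma> = (SUP i. esssup (lebesgue_on unit_cube)
     (\<lambda>x. ereal (\<gamma> i x + 1 / \<gamma> i x + (\<Sum>j\<in>UNIV. \<bar>weak_partial unit_cube j (\<gamma> i) x\<bar>\<^sup>2))))"

section \<open>Brownian motion and its augmented filtration\<close>

definition brownian_motion :: "'w measure \<Rightarrow> (real \<Rightarrow> 'w \<Rightarrow> real) \<Rightarrow> bool" where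
  "brownian_motion M B \<longleftrightarrow>
     (\<forall>t\<ge>0. B t \<in> borel_measurable M) \<and>
     (AE \<omega> in M. B 0 \<omega> = 0) \<and>
     (AE \<omega> in M. continuous_on {0..} (\<lambda>t. B t \<omega>)) \<and>
     (\<forall>s t. 0 \<le> s \<and> s < t \<longrightarrow>
        distributed M lborel (\<lambda>\<omega>. B t \<omega> - B s \<omega>)
          (\<lambda>x. ennreal (normal_density 0 (sqrt (t - s)) x))) \<and>
     (\<forall>(m::nat) \<tau>. 0 \<le> \<tau> 0 \<and> (\<forall>j<m. \<tau> j < \<tau> (Suc j)) \<longrightarrow>
        prob_space.indep_vars M (\<lambda>_. borel) (\<lambda>j \<omega>. B (\<tau> (Suc j)) \<omega> - B (\<tau> j) \<omega>) {..<m})"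

definition aug_filtration :: "'w measure \<Rightarrow> (real \<Rightarrow> 'w \<Rightarrow> real) \<Rightarrow> real \<Rightarrow> 'w measure" where
  "aug_filtration M B t =
     sigma (space M)
       ({B s -` A \<inter> space M |s A. 0 \<le> s \<and> s \<le> t \<and> A \<in> sets borel} \<union> null_sets M)"

definition brownian_basis :: "'w measure \<Rightarrow> (real \<Rightarrow> 'w \<Rightarrow> real) \<Rightarrow> bool" where
  "brownian_basis M B \<longleftrightarrow> prob_space M \<and> complete_measure M \<and> brownian_motion M B"

section \<open>Spaces of adapted mesh-function-valued processes\<close>

text \<open>A process with values in the functions on a finite set \<open>P\<close> of grid points is a function
  \<open>u t \<omega> x\<close>, of which only the values at \<open>x \<in> P\<close> matter.\<close>

definition adapted_process ::
    "'w measure \<Rightarrow> (real \<Rightarrow> 'w measure) \<Rightarrow> real \<Rightarrow> (real ^ 'n) set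
      \<Rightarrow> (real \<Rightarrow> 'w \<Rightarrow> real ^ 'n \<Rightarrow> real) \<Rightarrow> bool" where
  "adapted_process M F T P u \<longleftrightarrow>
     (\<forall>x\<in>P. (\<lambda>(t, \<omega>). u t \<omega> x) \<in> borel_measurable (restrict_space lborel {0..T} \<Otimes>\<^sub>M M) \<and>
            (\<forall>t\<in>{0..T}. (\<lambda>\<omega>. u t \<omega> x) \<in> borel_measurable (F t)))"

definition L2F_sq ::
    "'w measure \<Rightarrow> real \<Rightarrow> ('v \<Rightarrow> real) \<Rightarrow> (real \<Rightarrow> 'w \<Rightarrow> 'v) \<Rightarrow> ennreal" where
  "L2F_sq M T nrm u = (\<integral>\<^sup>+\<omega>. (\<integral>\<^sup>+t\<in>{0..T}. ennreal ((nrm (u t \<omega>))\<^sup>2) \<partial>lborel) \<partial>M)"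

definition L2F_norm ::
    "'w measure \<Rightarrow> real \<Rightarrow> ('v \<Rightarrow> real) \<Rightarrow> (real \<Rightarrow> 'w \<Rightarrow> 'v) \<Rightarrow> real" where
  "L2F_norm M T nrm u = sqrt (enn2real (L2F_sq M T nrm u))"

definition L2F ::
    "'w measure \<Rightarrow> (real \<Rightarrow> 'w measure) \<Rightarrow> real \<Rightarrow> (real ^ 'n) set
      \<Rightarrow> ((real ^ 'n \<Rightarrow> real) \<Rightarrow> real) \<Rightarrow> (real \<Rightarrow> 'w \<Rightarrow> real ^ 'n \<Rightarrow> real) set" where
  "L2F M F T P nrm = {u. adapted_process M F T P u \<and> L2F_sq M T nrm u < \<infinity>}"

definition LinfF_norm ::
    "'w measure \<Rightarrow> real \<Rightarrow> ('v \<Rightarrow> real) \<Rightarrow> (real \<Rightarrow> 'w \<Rightarrow> 'v) \<Rightarrow> ereal" where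
  "LinfF_norm M T nrm u =
     esssup (restrict_space lborel {0..T} \<Otimes>\<^sub>M M) (\<lambda>(t, \<omega>). ereal (nrm (u t \<omega>)))"

definition LinfF ::
    "'w measure \<Rightarrow> (real \<Rightarrow> 'w measure) \<Rightarrow> real \<Rightarrow> (real ^ 'n) set
      \<Rightarrow> ((real ^ 'n \<Rightarrow> real) \<Rightarrow> real) \<Rightarrow> (real \<Rightarrow> 'w \<Rightarrow> real ^ 'n \<Rightarrow> real) set" where
  "LinfF M F T P nrm = {u. adapted_process M F T P u \<and> LinfF_norm M T nrm u < \<infinity>}"

definition L2Omega_sq :: "'w measure \<Rightarrow> ('v \<Rightarrow> real) \<Rightarrow> ('w \<Rightarrow> 'v) \<Rightarrow> ennreal" where
  "L2Omega_sq M nrm u = (\<integral>\<^sup>+\<omega>. ennreal ((nrm (u \<omega>))\<^sup>2) \<partial>M)"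

definition L2Omega_norm :: "'w measure \<Rightarrow> ('v \<Rightarrow> real) \<Rightarrow> ('w \<Rightarrow> 'v) \<Rightarrow> real" where
  "L2Omega_norm M nrm u = sqrt (enn2real (L2Omega_sq M nrm u))"

definition L2Omega ::
    "'w measure \<Rightarrow> 'w measure \<Rightarrow> (real ^ 'n) set
      \<Rightarrow> ((real ^ 'n \<Rightarrow> real) \<Rightarrow> real) \<Rightarrow> ('w \<Rightarrow> real ^ 'n \<Rightarrow> real) set" where
  "L2Omega M Ft P nrm =
     {u. (\<forall>x\<in>P. (\<lambda>\<omega>. u \<omega> x) \<in> borel_measurable Ft) \<and> L2Omega_sq M nrm u < \<infinity>}"

section \<open>The Ito integral\<close>

definition simple_integrand ::
    "'w measure \<Rightarrow> (real \<Rightarrow> 'w measure) \<Rightarrow> real \<Rightarrow> nat \<Rightarrow> (nat \<Rightarrow> real) \<Rightarrow> (nat \<Rightarrow> 'w \<Rightarrow> real) \<Rightarrow> bool"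
  where
  "simple_integrand M F t m \<tau> \<xi> \<longleftrightarrow>
     \<tau> 0 = 0 \<and> \<tau> m = t \<and>
     (\<forall>j<m. \<tau> j \<le> \<tau> (Suc j) \<and> \<xi> j \<in> borel_measurable (F (\<tau> j)) \<and>
            (\<exists>b. \<forall>\<omega>\<in>space M. \<bar>\<xi> j \<omega>\<bar> \<le> b))"

definition simple_process ::
    "nat \<Rightarrow> (nat \<Rightarrow> real) \<Rightarrow> (nat \<Rightarrow> 'w \<Rightarrow> real) \<Rightarrow> real \<Rightarrow> 'w \<Rightarrow> real" where
  "simple_process m \<tau> \<xi> s \<omega> = (\<Sum>j<m. \<xi> j \<omega> * indicator {\<tau> j<..\<tau> (Suc j)} s)"

definition simple_ito ::
    "(real \<Rightarrow> 'w \<Rightarrow> real) \<Rightarrow> nat \<Rightarrow> (nat \<Rightarrow> real) \<Rightarrow> (nat \<Rightarrow> 'w \<Rightarrow> real) \<Rightarrow> 'w \<Rightarrow> real" where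
  "simple_ito B m \<tau> \<xi> \<omega> = (\<Sum>j<m. \<xi> j \<omega> * (B (\<tau> (Suc j)) \<omega> - B (\<tau> j) \<omega>))"

text \<open>\<open>Y\<close> is (a version of) the integral of \<open>f\<close> with respect to \<open>B\<close> over \<open>[0,t]\<close>, the
  \<open>L\<^sup>2(\<Omega>)\<close>-limit of the integrals of simple processes approximating \<open>f\<close>.\<close>

definition has_ito_integral ::
    "'w measure \<Rightarrow> (real \<Rightarrow> 'w measure) \<Rightarrow> (real \<Rightarrow> 'w \<Rightarrow> real) \<Rightarrow> real
      \<Rightarrow> (real \<Rightarrow> 'w \<Rightarrow> real) \<Rightarrow> ('w \<Rightarrow> real) \<Rightarrow> bool" where
  "has_ito_integral M F B t f Y \<longleftrightarrow>
     Y \<in> borel_measurable M \<and>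
     (\<exists>m \<tau> \<xi>.
        (\<forall>k::nat. simple_integrand M F t (m k) (\<tau> k) (\<xi> k)) \<and>
        (\<lambda>k. \<integral>\<^sup>+\<omega>. (\<integral>\<^sup>+s\<in>{0..t}. ennreal ((simple_process (m k) (\<tau> k) (\<xi> k) s \<omega> - f s \<omega>)\<^sup>2) \<partial>lborel) \<partial>M)
          \<longlonglongrightarrow> 0 \<and>
        (\<lambda>k. \<integral>\<^sup>+\<omega>. ennreal ((simple_ito B (m k) (\<tau> k) (\<xi> k) \<omega> - Y \<omega>)\<^sup>2) \<partial>M) \<longlonglongrightarrow> 0)"

section \<open>The semi-discrete stochastic parabolic equation\<close>

definition drift ::
    "real \<Rightarrow> ('n::finite \<Rightarrow> real ^ 'n \<Rightarrow> real) \<Rightarrow> ('n \<Rightarrow> real ^ 'n \<Rightarrow> real) \<Rightarrow> (real ^ 'n \<Rightarrow> real)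
      \<Rightarrow> (real ^ 'n \<Rightarrow> real) \<Rightarrow> real ^ 'n \<Rightarrow> real" where
  "drift h \<gamma> b1 b2 v x =
     (\<Sum>i\<in>UNIV. Dh h i (\<lambda>y. \<gamma> i y * Dh h i v y) x)
     + (\<Sum>i\<in>UNIV. b1 i x * Ah h i (Dh h i v) x) + b2 x * v x"

definition is_solution ::
    "'w measure \<Rightarrow> (real \<Rightarrow> 'w \<Rightarrow> real) \<Rightarrow> real \<Rightarrow> real
      \<Rightarrow> ('n::finite \<Rightarrow> real ^ 'n \<Rightarrow> real)
      \<Rightarrow> ('n \<Rightarrow> real \<Rightarrow> 'w \<Rightarrow> real ^ 'n \<Rightarrow> real) \<Rightarrow> (real \<Rightarrow> 'w \<Rightarrow> real ^ 'n \<Rightarrow> real)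
      \<Rightarrow> (real \<Rightarrow> 'w \<Rightarrow> real ^ 'n \<Rightarrow> real) \<Rightarrow> ('w \<Rightarrow> real ^ 'n \<Rightarrow> real)
      \<Rightarrow> (real \<Rightarrow> 'w \<Rightarrow> real ^ 'n \<Rightarrow> real) \<Rightarrow> bool" where
  "is_solution M B T h \<gamma> a1 a2 g w0 w \<longleftrightarrow>
     w \<in> L2F M (aug_filtration M B) T (primal_mesh h) (L2_norm h (primal_mesh h)) \<and>
     (AE \<omega> in M. \<forall>x\<in>primal_mesh h. continuous_on {0..T} (\<lambda>t. w t \<omega> x)) \<and>
     (AE \<omega> in M. \<forall>t\<in>{0<..<T}. \<forall>x\<in>mesh_boundary h. w t \<omega> x = 0) \<and>
     (AE \<omega> in M. \<forall>x\<in>primal_mesh h. w 0 \<omega> x = w0 \<omega> x) \<and>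
     (\<forall>t\<in>{0..T}. \<forall>x\<in>primal_mesh h. \<exists>Y.
        has_ito_integral M (aug_filtration M B) B t (\<lambda>s \<omega>. g s \<omega> x) Y \<and>
        (AE \<omega> in M. w t \<omega> x = w 0 \<omega> x
            + (LINT s:{0..t}|lborel. drift h \<gamma> (\<lambda>i. a1 i s \<omega>) (a2 s \<omega>) (w s \<omega>) x) + Y \<omega>))"

text \<open>The norm of a pair (interior observation on \<open>G0\<close>, terminal observation).\<close>

definition X1_norm ::
    "'w measure \<Rightarrow> real \<Rightarrow> real \<Rightarrow> (real ^ 'n) set
      \<Rightarrow> (real \<Rightarrow> 'w \<Rightarrow> real ^ 'n \<Rightarrow> real) \<times> ('w \<Rightarrow> real ^ 'n \<Rightarrow> real) \<Rightarrow> real" where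
  "X1_norm M T h G0 f =
     L2F_norm M T (L2_norm h (G0 \<inter> primal_mesh h)) (fst f)
     + L2Omega_norm M (L2_norm h (primal_mesh h)) (snd f)"

text \<open>The restriction of \<open>w\<close> to \<open>(G0 \<inter> mesh) \<times> (0,T)\<close> is represented by its extension by zero.\<close>

definition Lambda1 ::
    "real \<Rightarrow> real \<Rightarrow> (real ^ 'n) set \<Rightarrow> (real \<Rightarrow> 'w \<Rightarrow> real ^ 'n \<Rightarrow> real)
      \<Rightarrow> (real \<Rightarrow> 'w \<Rightarrow> real ^ 'n \<Rightarrow> real) \<times> ('w \<Rightarrow> real ^ 'n \<Rightarrow> real)" where
  "Lambda1 T h G0 w =
     ((\<lambda>t \<omega> x. if x \<in> G0 \<inter> primal_mesh h \<and> t \<in> {0<..<T} then w t \<omega> x else 0), w T)"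

end

theory Submission
  imports Defs
begin

text \<open>
  Write \<open>u\<close> for the difference of the two solutions and \<open>g\<close> for the difference of the two
  sources. The hypothesis on \<open>g\<close> bounds its discrete logarithmic gradient, so \<open>g\<close> has constant
  sign and its values at any two mesh points are comparable: the size of \<open>g\<close> is already visible
  inside \<open>G0\<close>, and no Carleman estimate is needed.

  Fix a cutoff \<open>\<phi>\<close>, the square of a Lipschitz bump supported in \<open>G0\<close>, and subtract \<open>\<theta>\<close> times the
  Ito identity for \<open>E \<integral> \<phi> u\<^sup>2\<close> from the one for \<open>E (\<integral> \<phi> u)\<^sup>2\<close>. For small \<open>\<theta>\<close> the quadratic variation
  \<open>(\<integral> \<phi> g)\<^sup>2 - \<theta> \<integral> \<phi> g\<^sup>2\<close> dominates a multiple of \<open>\<integral> g\<^sup>2\<close>. In the drift, the localized gradient energy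
  produced by the first identity is absorbed by the dissipation in the second, whatever \<open>\<theta>\<close>; the
  potential in \<open>L\<^sup>n\<close> is handled by a discrete Gagliardo inequality of Loomis-Whitney type. What
  remains is \<open>\<integral> u\<^sup>2\<close> over \<open>G0\<close> and the terminal value.
\<close>

section \<open>Square-integrable functions\<close>

definition square_integrable :: "'a measure \<Rightarrow> ('a \<Rightarrow> real) \<Rightarrow> bool" where
  "square_integrable M f \<longleftrightarrow> f \<in> borel_measurable M \<and> integrable M (\<lambda>x. (f x)\<^sup>2)"

lemma square_integrable_measurable [measurable_dest]:
  "square_integrable M f \<Longrightarrow> f \<in> borel_measurable M"
  by (simp add: square_integrable_def)

lemma square_integrable_iff_nn_integral:
  "square_integrable M f \<longleftrightarrow>
     f \<in> borel_measurable M \<and> (\<integral>\<^sup>+x. ennreal ((f x)\<^sup>2) \<partial>M) < \<infinity>"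
  by (auto simp: square_integrable_def integrable_iff_bounded)

lemma nn_integral_power2_eq_integral:
  "square_integrable M f \<Longrightarrow> (\<integral>\<^sup>+x. ennreal ((f x)\<^sup>2) \<partial>M) = ennreal (\<integral>x. (f x)\<^sup>2 \<partial>M)"
  unfolding square_integrable_def by (intro nn_integral_eq_integral) auto

lemma integrable_mult_square_integrable:
  assumes "square_integrable M f" "square_integrable M g"
  shows "integrable M (\<lambda>x. f x * g x)"
proof (rule Bochner_Integration.integrable_bound)
  show "integrable M (\<lambda>x. (f x)\<^sup>2 + (g x)\<^sup>2)"
    using assms by (auto simp: square_integrable_def)
  have "\<bar>a * b\<bar> \<le> a\<^sup>2 + b\<^sup>2" for a b :: real
    using sum_squares_bound[of "\<bar>a\<bar>" "\<bar>b\<bar>"] mult_nonneg_nonneg[of "\<bar>a\<bar>" "\<bar>b\<bar>"]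
    unfolding abs_mult power2_abs by linarith
  then show "AE x in M. norm (f x * g x) \<le> norm ((f x)\<^sup>2 + (g x)\<^sup>2)" by auto
qed (use assms in \<open>auto simp: square_integrable_def\<close>)

lemma square_integrable_add:
  assumes "square_integrable M f" "square_integrable M g"
  shows "square_integrable M (\<lambda>x. f x + g x)"
  using assms integrable_mult_square_integrable[OF assms]
  by (auto simp: square_integrable_def power2_sum mult.assoc)

lemma square_integrable_cmult:
  assumes "square_integrable M f"
  shows "square_integrable M (\<lambda>x. c * f x)"
  using assms by (auto simp: square_integrable_def power_mult_distrib)

lemma square_integrable_diff:
  assumes "square_integrable M f" "square_integrable M g"
  shows "square_integrable M (\<lambda>x. f x - g x)"
  using square_integrable_add[OF assms(1) square_integrable_cmult[OF assms(2), of "-1"]] by simp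

lemma square_integrable_zero: "square_integrable M (\<lambda>_. 0)"
  by (simp add: square_integrable_def)

lemma square_integrable_sum:
  assumes "\<And>i. i \<in> I \<Longrightarrow> square_integrable M (f i)"
  shows "square_integrable M (\<lambda>x. \<Sum>i\<in>I. f i x)"
  using assms by (induction I rule: infinite_finite_induct)
    (auto intro: square_integrable_add square_integrable_zero)

lemma square_integrable_diff_case_prod:
  assumes "square_integrable N (\<lambda>(s, \<omega>). f s \<omega>)" "square_integrable N (\<lambda>(s, \<omega>). g s \<omega>)"
  shows "square_integrable N (\<lambda>(s, \<omega>). f s \<omega> - g s \<omega>)"
  using square_integrable_diff[OF assms] by (simp add: case_prod_unfold)

lemma integrable_mult_case_prod:
  assumes "square_integrable N (\<lambda>(s, \<omega>). f s \<omega>)" "square_integrable N (\<lambda>(s, \<omega>). g s \<omega>)"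
  shows "integrable N (\<lambda>(s, \<omega>). f s \<omega> * g s \<omega>)"
  using integrable_mult_square_integrable[OF assms] by (simp add: case_prod_unfold)

lemma square_integrable_dominated:
  assumes "square_integrable M f" "g \<in> borel_measurable M" "AE x in M. \<bar>g x\<bar> \<le> \<bar>f x\<bar>"
  shows "square_integrable M g"
  unfolding square_integrable_def
proof (intro conjI)
  show "integrable M (\<lambda>x. (g x)\<^sup>2)"
    by (rule Bochner_Integration.integrable_bound[of _ "\<lambda>x. (f x)\<^sup>2"])
      (use assms in \<open>auto simp: square_integrable_def abs_le_square_iff\<close>)
qed (use assms in auto)

lemma square_integrable_cong_AE:
  assumes "square_integrable M f" "g \<in> borel_measurable M" "AE x in M. g x = f x"
  shows "square_integrable M g"
  by (rule square_integrable_dominated[OF assms(1,2)]) (use assms(3) in auto)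

lemma square_integrable_mult_bounded:
  assumes "square_integrable M f" "g \<in> borel_measurable M" "AE x in M. \<bar>g x\<bar> \<le> b"
  shows "square_integrable M (\<lambda>x. g x * f x)"
proof (rule square_integrable_dominated)
  show "square_integrable M (\<lambda>x. b * f x)" by (intro square_integrable_cmult assms)
  show "AE x in M. \<bar>g x * f x\<bar> \<le> \<bar>b * f x\<bar>"
    using assms(3) by eventually_elim (auto simp: abs_mult intro!: mult_right_mono)
qed (use assms in measurable)

lemma (in finite_measure) square_integrable_const: "square_integrable M (\<lambda>_. c)"
  by (simp add: square_integrable_def)

lemma (in finite_measure) square_integrable_bounded:
  assumes "f \<in> borel_measurable M" "\<And>x. x \<in> space M \<Longrightarrow> \<bar>f x\<bar> \<le> (b::real)"
  shows "square_integrable M f"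
  by (rule square_integrable_dominated[OF square_integrable_const[of b]])
    (use assms in \<open>auto intro!: AE_I2 order_trans[OF _ abs_ge_self]\<close>)

lemma (in finite_measure) integrable_square_integrable:
  "square_integrable M f \<Longrightarrow> integrable M f"
  by (simp add: square_integrable_def square_integrable_imp_integrable)

lemma Cauchy_Schwarz_integral:
  assumes f: "square_integrable M f" and g: "square_integrable M g"
  shows "\<bar>\<integral>x. f x * g x \<partial>M\<bar> \<le> sqrt (\<integral>x. (f x)\<^sup>2 \<partial>M) * sqrt (\<integral>x. (g x)\<^sup>2 \<partial>M)"
proof -
  have "ennreal (\<integral>x. \<bar>f x * g x\<bar> \<partial>M) = (\<integral>\<^sup>+x. ennreal \<bar>f x\<bar> * ennreal \<bar>g x\<bar> \<partial>M)"
    using nn_integral_eq_integral[OF integrable_abs[OF integrable_mult_square_integrable[OF f g]]]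
    by (simp add: abs_mult ennreal_mult)
  then have "(ennreal (\<integral>x. \<bar>f x * g x\<bar> \<partial>M))\<^sup>2 \<le>
      (\<integral>\<^sup>+x. (ennreal \<bar>f x\<bar>)\<^sup>2 \<partial>M) * (\<integral>\<^sup>+x. (ennreal \<bar>g x\<bar>)\<^sup>2 \<partial>M)"
    using f g Cauchy_Schwarz_nn_integral[of "\<lambda>x. ennreal \<bar>f x\<bar>" M "\<lambda>x. ennreal \<bar>g x\<bar>"]
    by (auto simp: square_integrable_def)
  also have "\<dots> = ennreal ((\<integral>x. (f x)\<^sup>2 \<partial>M) * (\<integral>x. (g x)\<^sup>2 \<partial>M))"
    using nn_integral_power2_eq_integral[OF f] nn_integral_power2_eq_integral[OF g]
    by (simp add: ennreal_power ennreal_mult)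
  finally have "(\<integral>x. \<bar>f x * g x\<bar> \<partial>M)\<^sup>2 \<le> (\<integral>x. (f x)\<^sup>2 \<partial>M) * (\<integral>x. (g x)\<^sup>2 \<partial>M)"
    by (simp add: ennreal_power ennreal_le_iff)
  then have "(\<integral>x. \<bar>f x * g x\<bar> \<partial>M) \<le> sqrt (\<integral>x. (f x)\<^sup>2 \<partial>M) * sqrt (\<integral>x. (g x)\<^sup>2 \<partial>M)"
    by (metis real_le_rsqrt real_sqrt_mult)
  then show ?thesis
    using integral_abs_bound[of M "\<lambda>x. f x * g x"] by linarith
qed

lemma tendsto_integral_mult_L2:
  assumes X: "\<And>k. square_integrable M (X k)" "square_integrable M X'"
    and Z: "\<And>k. square_integrable M (Z k)" "square_integrable M Z'"
    and X_lim: "(\<lambda>k. \<integral>x. (X k x - X' x)\<^sup>2 \<partial>M) \<longlonglongrightarrow> 0"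
    and Z_lim: "(\<lambda>k. \<integral>x. (Z k x - Z' x)\<^sup>2 \<partial>M) \<longlonglongrightarrow> 0"
  shows "(\<lambda>k. \<integral>x. X k x * Z k x \<partial>M) \<longlonglongrightarrow> (\<integral>x. X' x * Z' x \<partial>M)"
proof (rule LIM_zero_cancel, rule Lim_null_comparison)
  let ?n = "\<lambda>f. sqrt (\<integral>x. (f x)\<^sup>2 \<partial>M)"
  let ?dX = "\<lambda>k x. X k x - X' x" and ?dZ = "\<lambda>k x. Z k x - Z' x"
  let ?bound = "\<lambda>k. ?n (?dX k) * ?n (?dZ k) + ?n (?dX k) * ?n Z' + ?n X' * ?n (?dZ k)"
  note dX = square_integrable_diff[OF X] and dZ = square_integrable_diff[OF Z]
  have expand: "(\<integral>x. X k x * Z k x \<partial>M) - (\<integral>x. X' x * Z' x \<partial>M) =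
     (\<integral>x. ?dX k x * ?dZ k x \<partial>M) + (\<integral>x. ?dX k x * Z' x \<partial>M) + (\<integral>x. X' x * ?dZ k x \<partial>M)" for k
    using integrable_mult_square_integrable[OF dX[of k] dZ[of k]]
      integrable_mult_square_integrable[OF dX[of k] Z(2)]
      integrable_mult_square_integrable[OF X(2) dZ[of k]]
      integrable_mult_square_integrable[OF X(1)[of k] Z(1)[of k]]
      integrable_mult_square_integrable[OF X(2) Z(2)]
    by (simp flip: Bochner_Integration.integral_add Bochner_Integration.integral_diff)
      (simp add: algebra_simps)
  have "norm ((\<integral>x. X k x * Z k x \<partial>M) - (\<integral>x. X' x * Z' x \<partial>M)) \<le> ?bound k" for k
    using expand[of k] Cauchy_Schwarz_integral[OF dX[of k] dZ[of k]]
      Cauchy_Schwarz_integral[OF dX[of k] Z(2)] Cauchy_Schwarz_integral[OF X(2) dZ[of k]]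
    unfolding real_norm_def by linarith
  then show "\<forall>\<^sub>F k in sequentially.
      norm ((\<integral>x. X k x * Z k x \<partial>M) - (\<integral>x. X' x * Z' x \<partial>M)) \<le> ?bound k"
    by auto
  have "?bound \<longlonglongrightarrow> sqrt 0 * sqrt 0 + sqrt 0 * ?n Z' + ?n X' * sqrt 0"
    by (intro tendsto_intros X_lim Z_lim)
  then show "?bound \<longlonglongrightarrow> 0" by simp
qed

lemma tendsto_integral_power2_zero_iff:
  assumes "\<And>k. square_integrable M (X k)"
  shows "(\<lambda>k. \<integral>\<^sup>+x. ennreal ((X k x)\<^sup>2) \<partial>M) \<longlonglongrightarrow> 0 \<longleftrightarrow> (\<lambda>k. \<integral>x. (X k x)\<^sup>2 \<partial>M) \<longlonglongrightarrow> 0"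
  unfolding nn_integral_power2_eq_integral[OF assms] by (subst ennreal_tendsto_0_iff) auto

lemma square_integrable_L2_limit:
  assumes X: "\<And>k. square_integrable M (X k)" and Y: "Y \<in> borel_measurable M"
    and lim: "(\<lambda>k. \<integral>\<^sup>+x. ennreal ((X k x - Y x)\<^sup>2) \<partial>M) \<longlonglongrightarrow> 0"
  shows "square_integrable M Y" "(\<lambda>k. \<integral>x. (X k x - Y x)\<^sup>2 \<partial>M) \<longlonglongrightarrow> 0"
proof -
  have "\<forall>\<^sub>F k in sequentially. (\<integral>\<^sup>+x. ennreal ((X k x - Y x)\<^sup>2) \<partial>M) < 1"
    using order_tendstoD(2)[OF lim] by simp
  then obtain k where "(\<integral>\<^sup>+x. ennreal ((X k x - Y x)\<^sup>2) \<partial>M) < 1"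
    by (auto dest: eventually_happens)
  then have "(\<integral>\<^sup>+x. ennreal ((X k x - Y x)\<^sup>2) \<partial>M) < \<infinity>"
    by (rule order.strict_trans) (simp add: less_top[symmetric])
  then have "square_integrable M (\<lambda>x. X k x - Y x)"
    using X[of k] Y by (auto simp: square_integrable_iff_nn_integral)
  from square_integrable_diff[OF X[of k] this] show "square_integrable M Y" by simp
  with lim show "(\<lambda>k. \<integral>x. (X k x - Y x)\<^sup>2 \<partial>M) \<longlonglongrightarrow> 0"
    by (subst tendsto_integral_power2_zero_iff[symmetric]) (auto intro: square_integrable_diff X)
qed

lemma integral_double_sum:
  fixes f :: "'i \<Rightarrow> 'j \<Rightarrow> 'a \<Rightarrow> real"
  assumes "\<And>i j. i \<in> I \<Longrightarrow> j \<in> J \<Longrightarrow> integrable N (f i j)"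
  shows "(\<integral>x. (\<Sum>i\<in>I. \<Sum>j\<in>J. f i j x) \<partial>N) = (\<Sum>i\<in>I. \<Sum>j\<in>J. \<integral>x. f i j x \<partial>N)"
proof -
  have "(\<integral>x. (\<Sum>i\<in>I. \<Sum>j\<in>J. f i j x) \<partial>N) = (\<Sum>i\<in>I. \<integral>x. (\<Sum>j\<in>J. f i j x) \<partial>N)"
    using assms
    by (intro Bochner_Integration.integral_sum Bochner_Integration.integrable_sum)
  also have "\<dots> = (\<Sum>i\<in>I. \<Sum>j\<in>J. \<integral>x. f i j x \<partial>N)"
    using assms by (intro sum.cong refl Bochner_Integration.integral_sum)
  finally show ?thesis .
qed

section \<open>Iterated integrals over a triangle\<close>

lemma (in sigma_finite_measure) integrable_mult_pair:
  fixes f g :: "'a \<Rightarrow> real"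
  assumes f: "integrable M f" and g: "integrable M g"
  shows "integrable (M \<Otimes>\<^sub>M M) (\<lambda>(t, s). f t * g s)"
proof -
  interpret pair: pair_sigma_finite M M ..
  have [measurable]: "f \<in> borel_measurable M" "g \<in> borel_measurable M" using f g by auto
  show ?thesis
    using f g by (intro pair.Fubini_integrable) (auto simp: abs_mult)
qed

locale atomless_real_measure = sigma_finite_measure M for M :: "real measure" +
  assumes ident_measurable [measurable]: "(\<lambda>x. x) \<in> borel_measurable M"
    and AE_neq: "\<And>t. AE s in M. s \<noteq> t"
begin

lemma integrable_triangle:
  fixes f g :: "real \<Rightarrow> real"
  assumes f: "integrable M f" and g: "integrable M g"
  shows "integrable (M \<Otimes>\<^sub>M M) (\<lambda>(t, s). f t * (indicator {..t} s * g s))"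
proof (rule Bochner_Integration.integrable_bound[OF integrable_mult_pair[OF f g]])
  have [measurable]: "f \<in> borel_measurable M" "g \<in> borel_measurable M" using f g by auto
  have "(\<lambda>p. f (fst p) * ((if snd p \<le> fst p then 1 else 0) * g (snd p)))
      \<in> borel_measurable (M \<Otimes>\<^sub>M M)"
    by measurable
  then show "(\<lambda>(t, s). f t * (indicator {..t} s * g s)) \<in> borel_measurable (M \<Otimes>\<^sub>M M)"
    by (simp add: case_prod_unfold indicator_def)
qed (auto simp: indicator_def)

lemma integral_triangle_swap:
  fixes f g :: "real \<Rightarrow> real"
  assumes f: "integrable M f" and g: "integrable M g"
  shows "(\<integral>t. f t * (\<integral>s. indicator {..t} s * g s \<partial>M) \<partial>M) =
      (\<integral>t. g t * (\<integral>s. indicator {t..} s * f s \<partial>M) \<partial>M)"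
    and "integrable M (\<lambda>t. g t * (\<integral>s. indicator {t..} s * f s \<partial>M))"
proof -
  interpret pair: pair_sigma_finite M M ..
  note int = integrable_triangle[OF f g]
  have swap: "(\<lambda>(t, s). f s * (indicator {..s} t * g t)) =
      (\<lambda>(t, s). g t * (indicator {t..} s * f s))"
    by (auto simp: indicator_def)
  note int' = pair.integrable_product_swap[OF int, unfolded split_conv swap]
  have "(\<integral>t. f t * (\<integral>s. indicator {..t} s * g s \<partial>M) \<partial>M) =
      (\<integral>(t, s). f t * (indicator {..t} s * g s) \<partial>(M \<Otimes>\<^sub>M M))"
    using pair.integral_fst[OF int] by simp
  also have "\<dots> = (\<integral>(t, s). g t * (indicator {t..} s * f s) \<partial>(M \<Otimes>\<^sub>M M))"
    using pair.integral_product_swap[OF borel_measurable_integrable[OF int]]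
    unfolding split_conv swap by simp
  also have "\<dots> = (\<integral>t. g t * (\<integral>s. indicator {t..} s * f s \<partial>M) \<partial>M)"
    using pair.integral_fst[OF int'] by simp
  finally show "(\<integral>t. f t * (\<integral>s. indicator {..t} s * g s \<partial>M) \<partial>M) =
      (\<integral>t. g t * (\<integral>s. indicator {t..} s * f s \<partial>M) \<partial>M)" .
  show "integrable M (\<lambda>t. g t * (\<integral>s. indicator {t..} s * f s \<partial>M))"
    using pair.integrable_fst[OF int'] by simp
qed

lemma integral_mult_eq_iterated:
  fixes f g :: "real \<Rightarrow> real"
  assumes f: "integrable M f" and g: "integrable M g"
  shows "(\<integral>s. f s \<partial>M) * (\<integral>s. g s \<partial>M) =
      (\<integral>t. g t * (\<integral>s. indicator {..t} s * f s \<partial>M) \<partial>M) +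
      (\<integral>t. f t * (\<integral>s. indicator {..t} s * g s \<partial>M) \<partial>M)"
proof -
  interpret pair: pair_sigma_finite M M ..
  have [measurable]: "f \<in> borel_measurable M" using f by simp
  have indicators: "integrable M (\<lambda>s. indicator {..t} s * f s)"
      "integrable M (\<lambda>s. indicator {t..} s * f s)" for t
  proof -
    have "(\<lambda>s. (if s \<le> t then 1 else 0) * f s) \<in> borel_measurable M"
      "(\<lambda>s. (if t \<le> s then 1 else 0) * f s) \<in> borel_measurable M" by measurable
    then show "integrable M (\<lambda>s. indicator {..t} s * f s)"
        "integrable M (\<lambda>s. indicator {t..} s * f s)"
      by (auto intro!: Bochner_Integration.integrable_bound[OF f] simp: indicator_def)
  qed
  have split: "(\<integral>s. indicator {..t} s * f s \<partial>M) + (\<integral>s. indicator {t..} s * f s \<partial>M) =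
      (\<integral>s. f s \<partial>M)" for t
  proof -
    have "(\<integral>s. indicator {..t} s * f s \<partial>M) + (\<integral>s. indicator {t..} s * f s \<partial>M) =
        (\<integral>s. indicator {..t} s * f s + indicator {t..} s * f s \<partial>M)"
      using indicators[of t] by simp
    also have "\<dots> = (\<integral>s. f s \<partial>M)"
    proof (rule integral_cong_AE)
      show "AE s in M. indicator {..t} s * f s + indicator {t..} s * f s = f s"
        using AE_neq[of t] by eventually_elim (auto simp: indicator_def)
    qed (use indicators[of t] in auto)
    finally show ?thesis .
  qed
  have "integrable M (\<lambda>t. g t * (\<integral>s. indicator {..t} s * f s \<partial>M))"
    using pair.integrable_fst[OF integrable_triangle[OF g f]] by simp
  then have "(\<integral>t. g t * (\<integral>s. indicator {..t} s * f s \<partial>M) \<partial>M) +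
        (\<integral>t. f t * (\<integral>s. indicator {..t} s * g s \<partial>M) \<partial>M) =
      (\<integral>t. g t * (\<integral>s. indicator {..t} s * f s \<partial>M) + g t * (\<integral>s. indicator {t..} s * f s \<partial>M) \<partial>M)"
    using integral_triangle_swap[OF f g] by simp
  also have "\<dots> = (\<integral>t. g t * (\<integral>s. f s \<partial>M) \<partial>M)"
    unfolding distrib_left[symmetric] split ..
  finally show ?thesis by simp
qed

end

section \<open>The time interval\<close>

abbreviation Time :: "real \<Rightarrow> real measure" where
  "Time T \<equiv> restrict_space lborel {0..T}"

lemma finite_measure_Time: "finite_measure (Time T)"
  by (rule finite_measureI)
    (simp add: space_restrict_space emeasure_restrict_space emeasure_lborel_Icc_eq)

lemma ident_measurable_Time [measurable]: "(\<lambda>x. x) \<in> borel_measurable (Time T)"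
  by (intro measurable_restrict_space1) simp

lemma AE_Time_neq: "AE s in Time T. s \<noteq> t"
  using AE_lborel_singleton[of t] by (subst AE_restrict_space_iff) auto

lemma atomless_real_measure_Time: "atomless_real_measure (Time T)"
  by (intro atomless_real_measure.intro atomless_real_measure_axioms.intro ident_measurable_Time
      AE_Time_neq finite_measure.axioms(1) finite_measure_Time)

section \<open>Brownian increments\<close>

lemma finite_subset_strict_grid:
  fixes J :: "real set"
  assumes J: "finite J" "J \<subseteq> {a..b}" and ab: "a \<le> b"
  obtains m \<tau> where "\<tau> (0::nat) = a" "\<tau> m = b" "\<And>j. j < m \<Longrightarrow> \<tau> j < \<tau> (Suc j)" "J \<subseteq> \<tau> ` {..m}"
proof
  define xs where "xs = sorted_list_of_set (J \<union> {a, b})"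
  define m where "m = length xs - 1"
  have set_xs: "set xs = J \<union> {a, b}"
    unfolding xs_def using J(1) by (intro set_sorted_list_of_set) simp
  then have len: "length xs = Suc m"
    unfolding m_def by (cases xs) auto
  have strict: "xs ! i < xs ! j" if "i < j" "j \<le> m" for i j
    using that len sorted_wrt_nth_less[of "(<)" xs i j]
    by (simp add: xs_def strict_sorted_list_of_set)
  have range: "xs ! i \<in> {a..b}" if "i \<le> m" for i
    using nth_mem[of i xs] that J(2) ab unfolding len set_xs by auto
  have index: "\<exists>i\<le>m. xs ! i = u" if "u \<in> J \<union> {a, b}" for u
    using that len unfolding set_xs[symmetric] in_set_conv_nth by (auto simp: less_Suc_eq_le)
  obtain i where i: "i \<le> m" "xs ! i = a" using index[of a] by blast
  show "xs ! 0 = a" using i strict[of 0 i] range[of 0] by (cases "i = 0") auto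
  obtain i where i: "i \<le> m" "xs ! i = b" using index[of b] by blast
  show "xs ! m = b" using i strict[of i m] range[of m] by (cases "i = m") auto
  show "xs ! j < xs ! Suc j" if "j < m" for j using strict that by simp
  show "J \<subseteq> (!) xs ` {..m}" using index by (force simp: image_iff)
qed

lemma Int_stable_Un_null_sets:
  assumes "P \<subseteq> sets M" "Int_stable P"
  shows "Int_stable (P \<union> null_sets M)"
proof (rule Int_stableI)
  fix a b assume a: "a \<in> P \<union> null_sets M" and b: "b \<in> P \<union> null_sets M"
  show "a \<inter> b \<in> P \<union> null_sets M"
  proof (cases "a \<in> P \<and> b \<in> P")
    case True
    then show ?thesis using assms(2) by (auto simp: Int_stable_def)
  next
    case False
    then show ?thesis using a b assms(1) null_set_Int1 null_set_Int2 by blast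
  qed
qed

lemma Int_stable_vimage: "Int_stable {X -` A \<inter> S |A. A \<in> sets N}"
proof (rule Int_stableI)
  fix a b assume "a \<in> {X -` A \<inter> S |A. A \<in> sets N}" "b \<in> {X -` A \<inter> S |A. A \<in> sets N}"
  then obtain A A' where "A \<in> sets N" "A' \<in> sets N" "a = X -` A \<inter> S" "b = X -` A' \<inter> S" by blast
  then show "a \<inter> b \<in> {X -` A \<inter> S |A. A \<in> sets N}"
    by (auto intro!: exI[of _ "A \<inter> A'"])
qed

locale brownian = prob_space M for M :: "'w measure" +
  fixes B :: "real \<Rightarrow> 'w \<Rightarrow> real"
  assumes brownian_motion: "brownian_motion M B"
begin

abbreviation "Filt \<equiv> aug_filtration M B"

lemma B_measurable [measurable]: "0 \<le> t \<Longrightarrow> B t \<in> borel_measurable M"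
  using brownian_motion by (simp add: brownian_motion_def)

lemma AE_B_0: "AE \<omega> in M. B 0 \<omega> = 0"
  using brownian_motion by (simp add: brownian_motion_def)

lemma filtration_generator_subset:
  "{B s -` A \<inter> space M |s A. 0 \<le> s \<and> s \<le> t \<and> A \<in> sets borel} \<union> null_sets M \<subseteq> sets M"
  using B_measurable by (auto dest: measurable_sets)

lemma space_Filt [simp]: "space (Filt t) = space M"
  unfolding aug_filtration_def by (rule space_measure_of_conv)

lemma sets_Filt:
  "sets (Filt t) = sigma_sets (space M)
     ({B s -` A \<inter> space M |s A. 0 \<le> s \<and> s \<le> t \<and> A \<in> sets borel} \<union> null_sets M)"
  unfolding aug_filtration_def
  by (rule sets_measure_of) (use filtration_generator_subset sets.space_closed in blast)

lemma sets_Filt_subset: "sets (Filt t) \<subseteq> sets M"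
  unfolding sets_Filt by (rule sets.sigma_sets_subset[OF filtration_generator_subset])

lemma sets_Filt_mono: "s \<le> t \<Longrightarrow> sets (Filt s) \<subseteq> sets (Filt t)"
  unfolding sets_Filt by (rule sigma_sets_mono') (use order_trans in blast)

lemma Filt_measurable: "f \<in> borel_measurable (Filt t) \<Longrightarrow> f \<in> borel_measurable M"
  using sets_Filt_subset[of t] by (auto simp: measurable_def)

lemma Filt_measurable_mono:
  "f \<in> borel_measurable (Filt s) \<Longrightarrow> s \<le> t \<Longrightarrow> f \<in> borel_measurable (Filt t)"
  using sets_Filt_mono[of s t] by (auto simp: measurable_def)

lemma B_adapted: "0 \<le> u \<Longrightarrow> u \<le> s \<Longrightarrow> B u \<in> borel_measurable (Filt s)"
proof (rule measurableI)
  fix A :: "real set" assume "0 \<le> u" "u \<le> s" "A \<in> sets borel"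
  then show "B u -` A \<inter> space (Filt s) \<in> sets (Filt s)"
    unfolding sets_Filt space_Filt by (intro sigma_sets.Basic) auto
qed simp

lemma grid_values_indep_var_increment:
  assumes start: "\<tau> (0::nat) = 0" and grid: "\<And>j. j < m \<Longrightarrow> \<tau> j < \<tau> (Suc j)" and t: "\<tau> m < t"
  shows "indep_var (PiM {..m} (\<lambda>_. borel)) (\<lambda>\<omega>. \<lambda>i\<in>{..m}. B (\<tau> i) \<omega> - B 0 \<omega>)
      (PiM {m} (\<lambda>_. borel)) (\<lambda>\<omega>. \<lambda>_\<in>{m}. B t \<omega> - B (\<tau> m) \<omega>)"
proof -
  define \<sigma> where "\<sigma> = \<tau>(Suc m := t)"
  define \<Delta> where "\<Delta> = (\<lambda>j \<omega>. B (\<sigma> (Suc j)) \<omega> - B (\<sigma> j) \<omega>)"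
  have "0 \<le> \<sigma> 0" "\<forall>j<Suc m. \<sigma> j < \<sigma> (Suc j)"
    using start grid t by (auto simp: \<sigma>_def less_Suc_eq)
  then have "indep_vars (\<lambda>_. borel) \<Delta> {..<Suc m}"
    using brownian_motion unfolding brownian_motion_def \<Delta>_def by blast
  from indep_var_restrict[OF this, of "{..<m}" "{m}"]
  have indep: "indep_var (PiM {..<m} (\<lambda>_. borel)) (\<lambda>\<omega>. \<lambda>i\<in>{..<m}. \<Delta> i \<omega>)
      (PiM {m} (\<lambda>_. borel)) (\<lambda>\<omega>. \<lambda>i\<in>{m}. \<Delta> i \<omega>)"
    by auto
  define S where "S = (\<lambda>f. \<lambda>i\<in>{..m}. \<Sum>j<i. f j :: real)"
  have S_measurable: "S \<in> PiM {..<m} (\<lambda>_. borel) \<rightarrow>\<^sub>M PiM {..m} (\<lambda>_. borel)"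
    unfolding S_def
    by (intro measurable_restrict borel_measurable_sum measurable_component_singleton) auto
  have last_measurable:
    "(\<lambda>f. \<lambda>_\<in>{m}. f m) \<in> PiM {m} (\<lambda>_. borel :: real measure) \<rightarrow>\<^sub>M PiM {m} (\<lambda>_. borel)"
    by (intro measurable_restrict measurable_component_singleton) simp
  have S_comp: "S \<circ> (\<lambda>\<omega>. \<lambda>i\<in>{..<m}. \<Delta> i \<omega>) = (\<lambda>\<omega>. \<lambda>i\<in>{..m}. B (\<tau> i) \<omega> - B 0 \<omega>)"
  proof -
    have "(\<Sum>j<i. (\<lambda>k\<in>{..<m}. \<Delta> k \<omega>) j) = B (\<tau> i) \<omega> - B 0 \<omega>" if "i \<le> m" for i \<omega>
    proof -
      have "(\<Sum>j<i. (\<lambda>k\<in>{..<m}. \<Delta> k \<omega>) j) = (\<Sum>j<i. B (\<sigma> (Suc j)) \<omega> - B (\<sigma> j) \<omega>)"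
        using that by (intro sum.cong) (auto simp: \<Delta>_def)
      also have "\<dots> = B (\<sigma> i) \<omega> - B (\<sigma> 0) \<omega>" by (rule sum_lessThan_telescope)
      finally show ?thesis using that start by (simp add: \<sigma>_def)
    qed
    then show ?thesis by (auto simp: S_def fun_eq_iff restrict_def)
  qed
  have last_comp: "(\<lambda>f. \<lambda>_\<in>{m}. f m) \<circ> (\<lambda>\<omega>. \<lambda>i\<in>{m}. \<Delta> i \<omega>) =
       (\<lambda>\<omega>. \<lambda>_\<in>{m}. B t \<omega> - B (\<tau> m) \<omega>)"
    by (auto simp: \<Delta>_def \<sigma>_def fun_eq_iff restrict_def)
  show ?thesis
    using indep_var_compose[OF indep S_measurable last_measurable] unfolding S_comp last_comp .
qed

lemma grid_values_indep_increment:
  assumes start: "\<tau> (0::nat) = 0" and grid: "\<And>j. j < m \<Longrightarrow> \<tau> j < \<tau> (Suc j)" and t: "\<tau> m < t"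
    and E: "E \<in> sets (PiM {..m} (\<lambda>_. borel))" and D: "D \<in> sets borel"
  defines "vals \<equiv> (\<lambda>\<omega>. \<lambda>i\<in>{..m}. B (\<tau> i) \<omega> - B 0 \<omega>) -` E \<inter> space M"
    and "incr \<equiv> (\<lambda>\<omega>. B t \<omega> - B (\<tau> m) \<omega>) -` D \<inter> space M"
  shows "vals \<in> events" "incr \<in> events" "prob (vals \<inter> incr) = prob vals * prob incr"
proof -
  note indep = grid_values_indep_var_increment[OF start grid t]
  define D' where "D' = {f \<in> space (PiM {m} (\<lambda>_. borel)). f m \<in> D}"
  have D': "D' \<in> sets (PiM {m} (\<lambda>_. borel))"
    unfolding D'_def using D by measurable
  have incr: "incr = (\<lambda>\<omega>. \<lambda>_\<in>{m}. B t \<omega> - B (\<tau> m) \<omega>) -` D' \<inter> space M"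
    by (auto simp: incr_def D'_def space_PiM)
  show "vals \<in> events" "incr \<in> events"
    unfolding incr vals_def
    using measurable_sets[OF indep_var_rv1[OF indep] E]
      measurable_sets[OF indep_var_rv2[OF indep] D'] by auto
  have "vals \<inter> incr = (\<lambda>\<omega>. (\<lambda>i\<in>{..m}. B (\<tau> i) \<omega> - B 0 \<omega>, \<lambda>_\<in>{m}. B t \<omega> - B (\<tau> m) \<omega>)) -` (E \<times> D')
      \<inter> space M"
    unfolding incr vals_def by blast
  then show "prob (vals \<inter> incr) = prob vals * prob incr"
    unfolding incr vals_def using indep_varD[OF indep E D'] by simp
qed

definition cylinders :: "real \<Rightarrow> 'w set set" where
  "cylinders s = {{\<omega>\<in>space M. \<forall>u\<in>J. B u \<omega> \<in> A u} |J A.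
     finite J \<and> J \<subseteq> {0..s} \<and> (\<forall>u. A u \<in> sets borel)}"

lemma cylinders_subset_sets: "cylinders s \<subseteq> sets M"
  unfolding cylinders_def
  by (auto intro!: sets.sets_Collect_finite_All measurable_sets_Collect[OF B_measurable])

lemma Int_stable_cylinders: "Int_stable (cylinders s)"
proof (rule Int_stableI)
  fix a b assume "a \<in> cylinders s" "b \<in> cylinders s"
  then obtain J A J' A' where
    J: "finite J" "J \<subseteq> {0..s}" "\<And>u. A u \<in> sets borel" "a = {\<omega>\<in>space M. \<forall>u\<in>J. B u \<omega> \<in> A u}" and
    J': "finite J'" "J' \<subseteq> {0..s}" "\<And>u. A' u \<in> sets borel"
      "b = {\<omega>\<in>space M. \<forall>u\<in>J'. B u \<omega> \<in> A' u}"
    unfolding cylinders_def by blast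
  let ?A = "\<lambda>u. (if u \<in> J then A u else UNIV) \<inter> (if u \<in> J' then A' u else UNIV)"
  have "a \<inter> b = {\<omega>\<in>space M. \<forall>u\<in>J \<union> J'. B u \<omega> \<in> ?A u}"
    unfolding J(4) J'(4) by (auto split: if_splits)
  moreover have "\<forall>u. ?A u \<in> sets borel" using J(3) J'(3) by auto
  ultimately show "a \<inter> b \<in> cylinders s"
    unfolding cylinders_def mem_Collect_eq using J(1,2) J'(1,2)
    by (intro exI[of _ "J \<union> J'"] exI[of _ ?A]) simp
qed

lemma sets_Filt_subset_cylinders:
  "sets (Filt s) \<subseteq> sigma_sets (space M) (cylinders s \<union> null_sets M)"
proof -
  have "B u -` A \<inter> space M \<in> cylinders s" if "0 \<le> u" "u \<le> s" "A \<in> sets borel" for u A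
    unfolding cylinders_def mem_Collect_eq using that
    by (intro exI[of _ "{u}"] exI[of _ "\<lambda>_. A"]) auto
  then show ?thesis unfolding sets_Filt by (intro sigma_sets_mono') auto
qed

lemma cylinder_indep_increment:
  assumes s: "0 \<le> s" "s < t" and a: "a \<in> cylinders s" and D: "D \<in> sets borel"
  defines "incr \<equiv> (\<lambda>\<omega>. B t \<omega> - B s \<omega>) -` D \<inter> space M"
  shows "prob (a \<inter> incr) = prob a * prob incr"
proof -
  obtain J A where J: "finite J" "J \<subseteq> {0..s}" and A: "\<And>u. A u \<in> sets borel"
    and a_eq: "a = {\<omega>\<in>space M. \<forall>u\<in>J. B u \<omega> \<in> A u}"
    using a unfolding cylinders_def by blast
  obtain m \<tau> where \<tau>: "\<tau> (0::nat) = 0" "\<tau> m = s" "\<And>j. j < m \<Longrightarrow> \<tau> j < \<tau> (Suc j)"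
      "J \<subseteq> \<tau> ` {..m}"
    using finite_subset_strict_grid[OF J s(1)] by metis
  have "\<forall>u\<in>J. \<exists>i. i \<le> m \<and> \<tau> i = u" using \<tau>(4) by auto
  then obtain index where index: "\<And>u. u \<in> J \<Longrightarrow> index u \<le> m \<and> \<tau> (index u) = u" by metis
  define box where "box = {f \<in> space (PiM {..m} (\<lambda>_. borel)). \<forall>u\<in>J. f (index u) \<in> A u}"
  have box: "box \<in> sets (PiM {..m} (\<lambda>_. borel))"
    unfolding box_def
  proof (intro sets.sets_Collect_finite_All J(1))
    fix u assume "u \<in> J"
    then have "(\<lambda>f. f (index u)) \<in> PiM {..m} (\<lambda>_. borel :: real measure) \<rightarrow>\<^sub>M borel"
      using index by (intro measurable_component_singleton) auto
    then show "{f \<in> space (PiM {..m} (\<lambda>_. borel)). f (index u) \<in> A u}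
        \<in> sets (PiM {..m} (\<lambda>_. borel))"
      by (rule measurable_sets_Collect) (use A in simp)
  qed
  let ?vals = "(\<lambda>\<omega>. \<lambda>i\<in>{..m}. B (\<tau> i) \<omega> - B 0 \<omega>) -` box \<inter> space M"
  have vals: "?vals \<in> events" "incr \<in> events" "prob (?vals \<inter> incr) = prob ?vals * prob incr"
    using grid_values_indep_increment[OF \<tau>(1,3) _ box D, of t] s unfolding incr_def \<tau>(2) by auto
  have a_measurable: "a \<in> events" using a cylinders_subset_sets by blast
  have AE_cyl: "AE \<omega> in M. \<omega> \<in> a \<longleftrightarrow> \<omega> \<in> ?vals"
    using AE_B_0 by eventually_elim (use index in \<open>auto simp: a_eq box_def space_PiM\<close>)
  have "prob (a \<inter> incr) = prob (?vals \<inter> incr)"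
    using AE_cyl a_measurable vals by (intro finite_measure_eq_AE) auto
  moreover have "prob ?vals = prob a"
    using AE_cyl a_measurable vals by (intro finite_measure_eq_AE) auto
  ultimately show ?thesis using vals(3) by simp
qed

lemma increment_indep:
  assumes s: "0 \<le> s" "s < t" and Z: "Z \<in> borel_measurable (Filt s)"
  shows "indep_var borel Z borel (\<lambda>\<omega>. B t \<omega> - B s \<omega>)"
proof -
  define incrs where "incrs = {(\<lambda>\<omega>. B t \<omega> - B s \<omega>) -` A \<inter> space M |A. A \<in> sets borel}"
  have incrs_sets: "incrs \<subseteq> sets M" unfolding incrs_def using s by auto
  have "indep_set (cylinders s \<union> null_sets M) incrs"
    unfolding indep_sets2_eq
  proof (intro conjI ballI)
    fix a b assume a: "a \<in> cylinders s \<union> null_sets M" and b: "b \<in> incrs"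
    show "prob (a \<inter> b) = prob a * prob b"
    proof (cases "a \<in> cylinders s")
      case True
      then show ?thesis using b cylinder_indep_increment[OF s] by (auto simp: incrs_def)
    next
      case False
      then have "a \<in> null_sets M" "a \<inter> b \<in> null_sets M"
        using a b incrs_sets by (auto intro: null_set_Int2)
      then show ?thesis by (simp add: measure_eq_0_null_sets)
    qed
  qed (use cylinders_subset_sets incrs_sets in auto)
  then have "indep_set (sigma_sets (space M) (cylinders s \<union> null_sets M))
      (sigma_sets (space M) incrs)"
    unfolding incrs_def
    by (intro indep_set_sigma_sets Int_stable_vimage Int_stable_Un_null_sets
        cylinders_subset_sets Int_stable_cylinders)
  moreover have "sigma_sets (space M) {Z -` A \<inter> space M |A. A \<in> sets borel}
      \<subseteq> sigma_sets (space M) (cylinders s \<union> null_sets M)"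
    using measurable_sets[OF Z] sets_Filt_subset_cylinders by (intro sigma_sets_mono) auto
  ultimately have "indep_set (sigma_sets (space M) {Z -` A \<inter> space M |A. A \<in> sets borel})
      (sigma_sets (space M) incrs)"
    unfolding indep_sets2_eq by blast
  then show ?thesis
    unfolding indep_var_eq incrs_def using s Filt_measurable[OF Z] by auto
qed

lemma
  assumes s: "0 \<le> s" "s \<le> t"
  shows increment_square_integrable: "square_integrable M (\<lambda>\<omega>. B t \<omega> - B s \<omega>)"
    and expectation_increment: "(\<integral>\<omega>. B t \<omega> - B s \<omega> \<partial>M) = 0"
    and expectation_increment_square: "(\<integral>\<omega>. (B t \<omega> - B s \<omega>)\<^sup>2 \<partial>M) = t - s"
proof -
  have "square_integrable M (\<lambda>\<omega>. B t \<omega> - B s \<omega>) \<and> (\<integral>\<omega>. B t \<omega> - B s \<omega> \<partial>M) = 0 \<and>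
      (\<integral>\<omega>. (B t \<omega> - B s \<omega>)\<^sup>2 \<partial>M) = t - s"
  proof (cases "s = t")
    case True
    then show ?thesis by (simp add: square_integrable_zero)
  next
    case False
    then have "s < t" and pos: "0 < sqrt (t - s)" using s by auto
    then have normal: "distributed M lborel (\<lambda>\<omega>. B t \<omega> - B s \<omega>) (normal_density 0 (sqrt (t - s)))"
      using brownian_motion s unfolding brownian_motion_def by blast
    have mean: "(\<integral>\<omega>. B t \<omega> - B s \<omega> \<partial>M) = 0"
      by (rule normal_distributed_expectation[OF pos normal])
    moreover have "(\<integral>\<omega>. (B t \<omega> - B s \<omega>)\<^sup>2 \<partial>M) = t - s"
      using normal_distributed_variance[OF pos normal] unfolding mean using \<open>s < t\<close> by simp
    moreover have "integrable M (\<lambda>\<omega>. (B t \<omega> - B s \<omega>)\<^sup>2)"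
      using distributed_integrable[OF normal, of "\<lambda>x. x\<^sup>2"] integrable_normal_moment[OF pos, of 0 2]
      by simp
    ultimately show ?thesis using s by (simp add: square_integrable_def)
  qed
  then show "square_integrable M (\<lambda>\<omega>. B t \<omega> - B s \<omega>)" "(\<integral>\<omega>. B t \<omega> - B s \<omega> \<partial>M) = 0"
    "(\<integral>\<omega>. (B t \<omega> - B s \<omega>)\<^sup>2 \<partial>M) = t - s" by auto
qed

lemma expectation_adapted_times_increment:
  assumes s: "0 \<le> s" "s \<le> t" and Z: "Z \<in> borel_measurable (Filt s)" "square_integrable M Z"
  shows "(\<integral>\<omega>. Z \<omega> * (B t \<omega> - B s \<omega>) \<partial>M) = 0"
proof (cases "s = t")
  case False
  then have "indep_var borel Z borel (\<lambda>\<omega>. B t \<omega> - B s \<omega>)" using s Z by (intro increment_indep) auto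
  from indep_var_lebesgue_integral[OF this] show ?thesis
    using expectation_increment[OF s] Z(2) increment_square_integrable[OF s]
    by (simp add: integrable_square_integrable)
qed simp

lemma expectation_adapted_times_increment_square:
  assumes s: "0 \<le> s" "s \<le> t" and Z: "Z \<in> borel_measurable (Filt s)" "integrable M Z"
  shows "(\<integral>\<omega>. Z \<omega> * (B t \<omega> - B s \<omega>)\<^sup>2 \<partial>M) = (\<integral>\<omega>. Z \<omega> \<partial>M) * (t - s)"
proof (cases "s = t")
  case False
  have "indep_var borel ((\<lambda>x. x) \<circ> Z) borel ((\<lambda>x. x\<^sup>2) \<circ> (\<lambda>\<omega>. B t \<omega> - B s \<omega>))"
    using False s Z by (intro indep_var_compose[OF increment_indep]) auto
  then have "indep_var borel Z borel (\<lambda>\<omega>. (B t \<omega> - B s \<omega>)\<^sup>2)" by (simp add: comp_def)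
  from indep_var_lebesgue_integral[OF this Z(2)] show ?thesis
    using increment_square_integrable[OF s] expectation_increment_square[OF s]
    by (simp add: square_integrable_def)
qed simp

lemma bounded_times_increment_square_integrable:
  assumes "0 \<le> a" "a \<le> b" "\<xi> \<in> borel_measurable M" "\<And>\<omega>. \<omega> \<in> space M \<Longrightarrow> \<bar>\<xi> \<omega>\<bar> \<le> k"
  shows "square_integrable M (\<lambda>\<omega>. \<xi> \<omega> * (B b \<omega> - B a \<omega>))"
  using assms
  by (intro square_integrable_mult_bounded[of _ _ _ k] increment_square_integrable AE_I2)

lemma disjoint_increments_orthogonal:
  assumes times: "0 \<le> p" "p \<le> q" "q \<le> r" "r \<le> s"
    and X: "X \<in> borel_measurable (Filt r)" "\<And>\<omega>. \<omega> \<in> space M \<Longrightarrow> \<bar>X \<omega>\<bar> \<le> k"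
  shows "integrable M (\<lambda>\<omega>. X \<omega> * (B q \<omega> - B p \<omega>) * (B s \<omega> - B r \<omega>))"
    and "(\<integral>\<omega>. X \<omega> * (B q \<omega> - B p \<omega>) * (B s \<omega> - B r \<omega>) \<partial>M) = 0"
proof -
  have sq: "square_integrable M (\<lambda>\<omega>. X \<omega> * (B q \<omega> - B p \<omega>))"
    using times X by (intro bounded_times_increment_square_integrable Filt_measurable) auto
  show "integrable M (\<lambda>\<omega>. X \<omega> * (B q \<omega> - B p \<omega>) * (B s \<omega> - B r \<omega>))"
    using times by (intro integrable_mult_square_integrable sq increment_square_integrable) auto
  have "(\<lambda>\<omega>. X \<omega> * (B q \<omega> - B p \<omega>)) \<in> borel_measurable (Filt r)"
    using times X(1) B_adapted[of q r] B_adapted[of p r] by auto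
  then show "(\<integral>\<omega>. X \<omega> * (B q \<omega> - B p \<omega>) * (B s \<omega> - B r \<omega>) \<partial>M) = 0"
    using times sq by (intro expectation_adapted_times_increment) auto
qed

lemma expectation_increments_common_start:
  assumes c: "0 \<le> c" "c \<le> p" "c \<le> q"
    and X: "X \<in> borel_measurable (Filt c)" "\<And>\<omega>. \<omega> \<in> space M \<Longrightarrow> \<bar>X \<omega>\<bar> \<le> k"
  shows "integrable M (\<lambda>\<omega>. X \<omega> * (B p \<omega> - B c \<omega>) * (B q \<omega> - B c \<omega>))"
    and "(\<integral>\<omega>. X \<omega> * (B p \<omega> - B c \<omega>) * (B q \<omega> - B c \<omega>) \<partial>M) = (\<integral>\<omega>. X \<omega> \<partial>M) * (min p q - c)"
proof -
  show "integrable M (\<lambda>\<omega>. X \<omega> * (B p \<omega> - B c \<omega>) * (B q \<omega> - B c \<omega>))"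
    using c X by (intro integrable_mult_square_integrable increment_square_integrable
        bounded_times_increment_square_integrable Filt_measurable) auto
  have ordered: "(\<integral>\<omega>. X \<omega> * (B p \<omega> - B c \<omega>) * (B q \<omega> - B c \<omega>) \<partial>M) = (\<integral>\<omega>. X \<omega> \<partial>M) * (p - c)"
    if "c \<le> p" "p \<le> q" for p q
  proof -
    have X_int: "integrable M X"
      using X Filt_measurable by (intro integrable_square_integrable square_integrable_bounded)
    have "square_integrable M (\<lambda>\<omega>. X \<omega> * (B p \<omega> - B c \<omega>))"
      using that c X by (intro bounded_times_increment_square_integrable Filt_measurable) auto
    from integrable_mult_square_integrable[OF this increment_square_integrable[OF c(1) that(1)]]
    have sq_int: "integrable M (\<lambda>\<omega>. X \<omega> * (B p \<omega> - B c \<omega>)\<^sup>2)"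
      by (simp add: power2_eq_square mult.assoc)
    have "X \<omega> * (B p \<omega> - B c \<omega>) * (B q \<omega> - B c \<omega>) =
        X \<omega> * (B p \<omega> - B c \<omega>)\<^sup>2 + X \<omega> * (B p \<omega> - B c \<omega>) * (B q \<omega> - B p \<omega>)" for \<omega>
      by (simp add: power2_eq_square algebra_simps)
    then show ?thesis
      using disjoint_increments_orthogonal[of c p p q X k] Filt_measurable_mono[OF X(1) that(1)]
        X c that sq_int expectation_adapted_times_increment_square[OF c(1) that(1) X(1) X_int]
      by simp
  qed
  show "(\<integral>\<omega>. X \<omega> * (B p \<omega> - B c \<omega>) * (B q \<omega> - B c \<omega>) \<partial>M) = (\<integral>\<omega>. X \<omega> \<partial>M) * (min p q - c)"
  proof (cases "p \<le> q")
    case True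
    then show ?thesis using ordered[of p q] c by simp
  next
    case False
    then show ?thesis using ordered[of q p] c by (simp add: mult_ac)
  qed
qed

lemma expectation_increment_product:
  assumes "0 \<le> a" "a \<le> b" "0 \<le> c" "c \<le> d"
    and "\<xi> \<in> borel_measurable (Filt a)" "\<And>\<omega>. \<omega> \<in> space M \<Longrightarrow> \<bar>\<xi> \<omega>\<bar> \<le> k"
    and "\<eta> \<in> borel_measurable (Filt c)" "\<And>\<omega>. \<omega> \<in> space M \<Longrightarrow> \<bar>\<eta> \<omega>\<bar> \<le> l"
  shows "(\<integral>\<omega>. (\<xi> \<omega> * (B b \<omega> - B a \<omega>)) * (\<eta> \<omega> * (B d \<omega> - B c \<omega>)) \<partial>M) =
     (\<integral>\<omega>. \<xi> \<omega> * \<eta> \<omega> \<partial>M) * measure lborel ({a<..b} \<inter> {c<..d})"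
  using assms
proof (induction a c arbitrary: b d \<xi> \<eta> k l rule: linorder_wlog)
  case (le a c)
  define X where "X = (\<lambda>\<omega>. \<xi> \<omega> * \<eta> \<omega>)"
  have X: "X \<in> borel_measurable (Filt c)"
    unfolding X_def using Filt_measurable_mono[OF le.prems(5) le.hyps] le.prems(7) by measurable
  have X_bound: "\<bar>X \<omega>\<bar> \<le> k * l" if "\<omega> \<in> space M" for \<omega>
    using le.prems(6,8)[OF that] unfolding X_def abs_mult by (intro mult_mono) auto
  have "(\<xi> \<omega> * (B b \<omega> - B a \<omega>)) * (\<eta> \<omega> * (B d \<omega> - B c \<omega>)) =
      X \<omega> * (B (min b c) \<omega> - B a \<omega>) * (B d \<omega> - B c \<omega>) +
      X \<omega> * (B (max b c) \<omega> - B c \<omega>) * (B d \<omega> - B c \<omega>)" for \<omega>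
    by (simp add: X_def min_def max_def algebra_simps)
  then have "(\<integral>\<omega>. (\<xi> \<omega> * (B b \<omega> - B a \<omega>)) * (\<eta> \<omega> * (B d \<omega> - B c \<omega>)) \<partial>M) =
      (\<integral>\<omega>. X \<omega> \<partial>M) * (min (max b c) d - c)"
    using disjoint_increments_orthogonal[OF _ _ _ _ X X_bound, of a "min b c" d]
      expectation_increments_common_start[OF _ _ _ X X_bound, of "max b c" d] le
    by simp
  moreover have "{a<..b} \<inter> {c<..d} = {c<..min (max b c) d}" using le.hyps by auto
  moreover have "measure lborel {c<..min (max b c) d} = min (max b c) d - c"
    using le.prems by (intro measure_lborel_Ioc) auto
  ultimately show ?case by (simp add: X_def)
next
  case (sym a c)
  from sym.IH[OF sym.prems(3,4,1,2,7,8,5,6)] show ?case by (simp add: mult.commute Int_commute)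
qed

section \<open>The Ito integral\<close>

abbreviation "PT T \<equiv> Time T \<Otimes>\<^sub>M M"

lemma pair_sigma_finite_Time: "pair_sigma_finite (Time T) M"
  using finite_measure_Time[of T] finite_measure_axioms
  by (simp add: pair_sigma_finite_def finite_measure_def)

lemma finite_measure_PT: "finite_measure (PT T)"
  by (rule finite_measure_pair_measure[OF finite_measure_axioms finite_measure_Time])

lemma integral_PT_times_indicator:
  assumes Z: "integrable M Z" and I: "I \<in> sets borel" "I \<subseteq> {0..T}"
  shows "integrable (PT T) (\<lambda>(s, \<omega>). Z \<omega> * indicator I s)"
    and "(\<integral>(s, \<omega>). Z \<omega> * indicator I s \<partial>PT T) = (\<integral>\<omega>. Z \<omega> \<partial>M) * measure lborel I"
proof -
  interpret pair: pair_sigma_finite "Time T" M by (rule pair_sigma_finite_Time)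
  interpret T: finite_measure "Time T" by (rule finite_measure_Time)
  have I_Time: "I \<in> sets (Time T)" using I by (auto simp: sets_restrict_space)
  have [measurable]: "Z \<in> borel_measurable M" using Z by simp
  have [measurable]: "indicator I \<in> borel_measurable (Time T)"
    using I by (intro measurable_restrict_space1) auto
  have space: "I \<inter> space (Time T) = I" using I(2) by (auto simp: space_restrict_space)
  show int: "integrable (PT T) (\<lambda>(s, \<omega>). Z \<omega> * indicator I s)"
  proof (rule pair.Fubini_integrable)
    show "integrable (Time T) (\<lambda>s. \<integral>\<omega>. norm (case (s, \<omega>) of (s, \<omega>) \<Rightarrow> Z \<omega> * indicator I s) \<partial>M)"
      using I_Time by (simp add: abs_mult T.emeasure_finite less_top[symmetric])
  qed (use Z in simp_all)
  have "(\<integral>(s, \<omega>). Z \<omega> * indicator I s \<partial>PT T) = (\<integral>s. (\<integral>\<omega>. Z \<omega> \<partial>M) * indicator I s \<partial>Time T)"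
    using pair.integral_fst[OF int] by simp
  also have "\<dots> = (\<integral>\<omega>. Z \<omega> \<partial>M) * measure lborel I"
    using I space measure_restrict_space[of "{0..T}" lborel I] by simp
  finally show "(\<integral>(s, \<omega>). Z \<omega> * indicator I s \<partial>PT T) = (\<integral>\<omega>. Z \<omega> \<partial>M) * measure lborel I" .
qed

lemma simple_integrandD:
  assumes "simple_integrand M Filt t m \<tau> \<xi>"
  shows "j \<le> m \<Longrightarrow> 0 \<le> \<tau> j" "j \<le> m \<Longrightarrow> \<tau> j \<le> t" "j < m \<Longrightarrow> \<tau> j \<le> \<tau> (Suc j)"
    "j < m \<Longrightarrow> \<xi> j \<in> borel_measurable (Filt (\<tau> j))" "j < m \<Longrightarrow> \<xi> j \<in> borel_measurable M"
proof -
  have mono: "\<tau> i \<le> \<tau> j" if "i \<le> j" "j \<le> m" for i j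
    using that by (induction j rule: dec_induct)
      (use assms in \<open>auto simp: simple_integrand_def intro: order_trans\<close>)
  show "j \<le> m \<Longrightarrow> 0 \<le> \<tau> j" "j \<le> m \<Longrightarrow> \<tau> j \<le> t"
    using mono[of 0 j] mono[of j m] assms by (auto simp: simple_integrand_def)
  show "j < m \<Longrightarrow> \<tau> j \<le> \<tau> (Suc j)" "j < m \<Longrightarrow> \<xi> j \<in> borel_measurable (Filt (\<tau> j))"
    "j < m \<Longrightarrow> \<xi> j \<in> borel_measurable M"
    using assms Filt_measurable by (auto simp: simple_integrand_def)
qed

lemma simple_integrand_bound:
  assumes "simple_integrand M Filt t m \<tau> \<xi>"
  obtains k where "\<And>j \<omega>. j < m \<Longrightarrow> \<omega> \<in> space M \<Longrightarrow> \<bar>\<xi> j \<omega>\<bar> \<le> k j"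
proof -
  have "\<forall>j. \<exists>b. j < m \<longrightarrow> (\<forall>\<omega>\<in>space M. \<bar>\<xi> j \<omega>\<bar> \<le> b)"
    using assms by (auto simp: simple_integrand_def)
  then show ?thesis using that by metis
qed

lemma simple_ito_square_integrable:
  assumes "simple_integrand M Filt t m \<tau> \<xi>"
  shows "square_integrable M (simple_ito B m \<tau> \<xi>)"
proof -
  obtain k where k: "\<And>j \<omega>. j < m \<Longrightarrow> \<omega> \<in> space M \<Longrightarrow> \<bar>\<xi> j \<omega>\<bar> \<le> k j"
    using simple_integrand_bound[OF assms] by metis
  show ?thesis unfolding simple_ito_def[abs_def]
  proof (rule square_integrable_sum)
    fix j assume "j \<in> {..<m}"
    then show "square_integrable M (\<lambda>\<omega>. \<xi> j \<omega> * (B (\<tau> (Suc j)) \<omega> - B (\<tau> j) \<omega>))"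
      using simple_integrandD[OF assms] k
      by (intro bounded_times_increment_square_integrable[of _ _ _ "k j"]) auto
  qed
qed

lemma simple_process_square_integrable:
  assumes "simple_integrand M Filt t m \<tau> \<xi>"
  shows "square_integrable (PT T) (\<lambda>(s, \<omega>). simple_process m \<tau> \<xi> s \<omega>)"
proof -
  interpret PT: finite_measure "PT T" by (rule finite_measure_PT)
  obtain k where k: "\<And>j \<omega>. j < m \<Longrightarrow> \<omega> \<in> space M \<Longrightarrow> \<bar>\<xi> j \<omega>\<bar> \<le> k j"
    using simple_integrand_bound[OF assms] by metis
  note [measurable] = simple_integrandD(5)[OF assms]
  have "square_integrable (PT T)
      (\<lambda>p. \<Sum>j<m. \<xi> j (snd p) * indicator {\<tau> j<..\<tau> (Suc j)} (fst p))"
  proof (rule square_integrable_sum, rule PT.square_integrable_bounded)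
    fix j p assume "j \<in> {..<m}" "p \<in> space (PT T)"
    then show "\<bar>\<xi> j (snd p) * indicator {\<tau> j<..\<tau> (Suc j)} (fst p)\<bar> \<le> k j"
      using k[of j "snd p"] by (auto simp: space_pair_measure indicator_def)
  qed (auto intro!: borel_measurable_times measurable_compose[OF measurable_snd]
         measurable_compose[OF measurable_fst] measurable_restrict_space1)
  then show ?thesis by (simp add: simple_process_def case_prod_unfold)
qed

lemma integral_PT_steps_product:
  assumes \<xi>: "simple_integrand M Filt t m \<tau> \<xi>" "i < m"
    and \<xi>': "simple_integrand M Filt t m' \<tau>' \<xi>'" "j < m'"
  defines "I \<equiv> {\<tau> i<..\<tau> (Suc i)} \<inter> {\<tau>' j<..\<tau>' (Suc j)}"
  shows "integrable (PT t) (\<lambda>(s, \<omega>). \<xi> i \<omega> * \<xi>' j \<omega> * indicator I s)"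
    and "(\<integral>(s, \<omega>). \<xi> i \<omega> * \<xi>' j \<omega> * indicator I s \<partial>PT t) =
      (\<integral>\<omega>. \<xi> i \<omega> * \<xi>' j \<omega> \<partial>M) * measure lborel I"
proof -
  obtain k where k: "\<And>\<omega>. \<omega> \<in> space M \<Longrightarrow> \<bar>\<xi> i \<omega>\<bar> \<le> k i"
    using simple_integrand_bound[OF \<xi>(1)] \<xi>(2) by metis
  obtain k' where k': "\<And>\<omega>. \<omega> \<in> space M \<Longrightarrow> \<bar>\<xi>' j \<omega>\<bar> \<le> k' j"
    using simple_integrand_bound[OF \<xi>'(1)] \<xi>'(2) by metis
  have int: "integrable M (\<lambda>\<omega>. \<xi> i \<omega> * \<xi>' j \<omega>)"
    using simple_integrandD(5)[OF \<xi>] simple_integrandD(5)[OF \<xi>'] k k'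
    by (intro integrable_mult_square_integrable square_integrable_bounded[of _ "k i"]
        square_integrable_bounded[of _ "k' j"])
  have I: "I \<in> sets borel" "I \<subseteq> {0..t}"
  proof -
    show "I \<subseteq> {0..t}"
    proof
      fix s assume "s \<in> I"
      then show "s \<in> {0..t}"
        using simple_integrandD(1,2)[OF \<xi>(1), of "Suc i"] simple_integrandD(1)[OF \<xi>(1), of i] \<xi>(2)
        by (auto simp: I_def)
    qed
  qed (simp add: I_def)
  show "integrable (PT t) (\<lambda>(s, \<omega>). \<xi> i \<omega> * \<xi>' j \<omega> * indicator I s)"
    "(\<integral>(s, \<omega>). \<xi> i \<omega> * \<xi>' j \<omega> * indicator I s \<partial>PT t) = (\<integral>\<omega>. \<xi> i \<omega> * \<xi>' j \<omega> \<partial>M) * measure lborel I"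
    by (rule integral_PT_times_indicator[OF int I])+
qed

lemma simple_ito_isometry:
  assumes \<xi>: "simple_integrand M Filt t m \<tau> \<xi>" and \<xi>': "simple_integrand M Filt t m' \<tau>' \<xi>'"
  shows "(\<integral>\<omega>. simple_ito B m \<tau> \<xi> \<omega> * simple_ito B m' \<tau>' \<xi>' \<omega> \<partial>M) =
    (\<integral>(s, \<omega>). simple_process m \<tau> \<xi> s \<omega> * simple_process m' \<tau>' \<xi>' s \<omega> \<partial>PT t)"
proof -
  note D = simple_integrandD[OF \<xi>] and D' = simple_integrandD[OF \<xi>']
  obtain k where k: "\<And>j \<omega>. j < m \<Longrightarrow> \<omega> \<in> space M \<Longrightarrow> \<bar>\<xi> j \<omega>\<bar> \<le> k j"
    using simple_integrand_bound[OF \<xi>] by metis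
  obtain k' where k': "\<And>j \<omega>. j < m' \<Longrightarrow> \<omega> \<in> space M \<Longrightarrow> \<bar>\<xi>' j \<omega>\<bar> \<le> k' j"
    using simple_integrand_bound[OF \<xi>'] by metis
  let ?I = "\<lambda>i j. {\<tau> i<..\<tau> (Suc i)} \<inter> {\<tau>' j<..\<tau>' (Suc j)}"
  let ?dB = "\<lambda>i \<omega>. \<xi> i \<omega> * (B (\<tau> (Suc i)) \<omega> - B (\<tau> i) \<omega>)"
  let ?dB' = "\<lambda>j \<omega>. \<xi>' j \<omega> * (B (\<tau>' (Suc j)) \<omega> - B (\<tau>' j) \<omega>)"
  have "(\<integral>\<omega>. simple_ito B m \<tau> \<xi> \<omega> * simple_ito B m' \<tau>' \<xi>' \<omega> \<partial>M) =
      (\<integral>\<omega>. (\<Sum>i<m. \<Sum>j<m'. ?dB i \<omega> * ?dB' j \<omega>) \<partial>M)"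
    by (simp add: simple_ito_def sum_product)
  also have "\<dots> = (\<Sum>i<m. \<Sum>j<m'. \<integral>\<omega>. ?dB i \<omega> * ?dB' j \<omega> \<partial>M)"
    using k k' D D' by (intro integral_double_sum integrable_mult_square_integrable
        bounded_times_increment_square_integrable[of _ _ _ "k _"]
        bounded_times_increment_square_integrable[of _ _ _ "k' _"]) auto
  also have "\<dots> = (\<Sum>i<m. \<Sum>j<m'. (\<integral>\<omega>. \<xi> i \<omega> * \<xi>' j \<omega> \<partial>M) * measure lborel (?I i j))"
    using k k' D D'
    by (intro sum.cong refl expectation_increment_product[of _ _ _ _ _ "k _" _ "k' _"]) auto
  also have "\<dots> = (\<Sum>i<m. \<Sum>j<m'. \<integral>(s, \<omega>). \<xi> i \<omega> * \<xi>' j \<omega> * indicator (?I i j) s \<partial>PT t)"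
    by (intro sum.cong refl integral_PT_steps_product(2)[OF \<xi> _ \<xi>', symmetric]) auto
  also have "\<dots> =
      (\<integral>p. (\<Sum>i<m. \<Sum>j<m'. case p of (s, \<omega>) \<Rightarrow> \<xi> i \<omega> * \<xi>' j \<omega> * indicator (?I i j) s) \<partial>PT t)"
    by (intro integral_double_sum[symmetric] integral_PT_steps_product(1)[OF \<xi> _ \<xi>']) auto
  finally show ?thesis
    by (simp only: case_prod_unfold simple_process_def sum_product indicator_inter_arith mult_ac)
qed

lemma nn_integral_PT:
  fixes F :: "real \<Rightarrow> 'w \<Rightarrow> ennreal"
  assumes "(\<lambda>(s, \<omega>). F s \<omega>) \<in> borel_measurable (PT T)"
  shows "(\<integral>\<^sup>+\<omega>. (\<integral>\<^sup>+s\<in>{0..T}. F s \<omega> \<partial>lborel) \<partial>M) = (\<integral>\<^sup>+(s, \<omega>). F s \<omega> \<partial>PT T)"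
proof -
  interpret pair: pair_sigma_finite "Time T" M by (rule pair_sigma_finite_Time)
  show ?thesis
    using pair.nn_integral_snd[OF assms] by (simp add: nn_integral_restrict_space)
qed

lemma PT_measurable_mono:
  assumes "f \<in> borel_measurable (PT T)" "t \<le> T"
  shows "f \<in> borel_measurable (PT t)"
proof -
  have "(\<lambda>x. x) \<in> Time t \<rightarrow>\<^sub>M Time T"
    using assms(2) by (intro measurable_restrict_space2 measurable_restrict_space1)
      (auto simp: space_restrict_space)
  then have "(\<lambda>p. (fst p, snd p)) \<in> PT t \<rightarrow>\<^sub>M PT T"
    by (intro measurable_Pair measurable_compose[OF measurable_fst] measurable_snd)
  from measurable_compose[OF this assms(1)] show ?thesis by simp
qed

lemma nn_integral_PT_mono:
  fixes F :: "real \<Rightarrow> 'w \<Rightarrow> ennreal"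
  assumes "(\<lambda>(s, \<omega>). F s \<omega>) \<in> borel_measurable (PT T)" "t \<le> T"
  shows "(\<integral>\<^sup>+(s, \<omega>). F s \<omega> \<partial>PT t) \<le> (\<integral>\<^sup>+(s, \<omega>). F s \<omega> \<partial>PT T)"
  unfolding nn_integral_PT[OF assms(1), symmetric]
    nn_integral_PT[OF PT_measurable_mono[OF assms], symmetric]
  using assms(2) by (intro nn_integral_mono) (auto simp: indicator_def)

lemma square_integrable_PT_mono:
  assumes f: "square_integrable (PT T) (\<lambda>(s, \<omega>). f s \<omega>)" and t: "t \<le> T"
  shows "square_integrable (PT t) (\<lambda>(s, \<omega>). f s \<omega>)"
    and "(\<integral>(s, \<omega>). (f s \<omega>)\<^sup>2 \<partial>PT t) \<le> (\<integral>(s, \<omega>). (f s \<omega>)\<^sup>2 \<partial>PT T)"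
proof -
  note measurable = square_integrable_measurable[OF f]
  have "(\<lambda>(s, \<omega>). ennreal ((f s \<omega>)\<^sup>2)) \<in> borel_measurable (PT T)"
    using measurable unfolding case_prod_unfold by measurable
  from nn_integral_PT_mono[OF this t]
  have nn_le: "(\<integral>\<^sup>+p. ennreal ((case p of (s, \<omega>) \<Rightarrow> f s \<omega>)\<^sup>2) \<partial>PT t) \<le>
      (\<integral>\<^sup>+p. ennreal ((case p of (s, \<omega>) \<Rightarrow> f s \<omega>)\<^sup>2) \<partial>PT T)"
    by (simp add: case_prod_unfold)
  then show sq: "square_integrable (PT t) (\<lambda>(s, \<omega>). f s \<omega>)"
    using f PT_measurable_mono[OF measurable t]
    unfolding square_integrable_iff_nn_integral by (auto elim: order_le_less_trans)
  show "(\<integral>(s, \<omega>). (f s \<omega>)\<^sup>2 \<partial>PT t) \<le> (\<integral>(s, \<omega>). (f s \<omega>)\<^sup>2 \<partial>PT T)"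
    using nn_le unfolding nn_integral_power2_eq_integral[OF f] nn_integral_power2_eq_integral[OF sq]
    by (simp add: case_prod_unfold)
qed

definition L2_ito_integral :: "real \<Rightarrow> (real \<Rightarrow> 'w \<Rightarrow> real) \<Rightarrow> ('w \<Rightarrow> real) \<Rightarrow> bool" where
  "L2_ito_integral t f Y \<longleftrightarrow>
     square_integrable (PT t) (\<lambda>(s, \<omega>). f s \<omega>) \<and> has_ito_integral M Filt B t f Y"

lemma L2_ito_integral_approx:
  assumes "L2_ito_integral t f Y"
  obtains m \<tau> \<xi> where "\<And>k::nat. simple_integrand M Filt t (m k) (\<tau> k) (\<xi> k)"
    and "(\<lambda>k. \<integral>(s, \<omega>). (simple_process (m k) (\<tau> k) (\<xi> k) s \<omega> - f s \<omega>)\<^sup>2 \<partial>PT t) \<longlonglongrightarrow> 0"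
    and "(\<lambda>k. \<integral>\<omega>. (simple_ito B (m k) (\<tau> k) (\<xi> k) \<omega> - Y \<omega>)\<^sup>2 \<partial>M) \<longlonglongrightarrow> 0"
    and "square_integrable M Y"
proof -
  from assms obtain m \<tau> \<xi> where f: "square_integrable (PT t) (\<lambda>(s, \<omega>). f s \<omega>)"
    and Y: "Y \<in> borel_measurable M"
    and simple: "\<And>k::nat. simple_integrand M Filt t (m k) (\<tau> k) (\<xi> k)"
    and process_lim: "(\<lambda>k. \<integral>\<^sup>+\<omega>. (\<integral>\<^sup>+s\<in>{0..t}.
        ennreal ((simple_process (m k) (\<tau> k) (\<xi> k) s \<omega> - f s \<omega>)\<^sup>2) \<partial>lborel) \<partial>M) \<longlonglongrightarrow> 0"
    and ito_lim: "(\<lambda>k. \<integral>\<^sup>+\<omega>. ennreal ((simple_ito B (m k) (\<tau> k) (\<xi> k) \<omega> - Y \<omega>)\<^sup>2) \<partial>M) \<longlonglongrightarrow> 0"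
    unfolding L2_ito_integral_def has_ito_integral_def by blast
  let ?d = "\<lambda>k (s, \<omega>). simple_process (m k) (\<tau> k) (\<xi> k) s \<omega> - f s \<omega>"
  have sq: "square_integrable (PT t) (?d k)" for k
    by (rule square_integrable_diff_case_prod[OF simple_process_square_integrable[OF simple] f])
  have "(\<integral>\<^sup>+\<omega>. (\<integral>\<^sup>+s\<in>{0..t}.
        ennreal ((simple_process (m k) (\<tau> k) (\<xi> k) s \<omega> - f s \<omega>)\<^sup>2) \<partial>lborel) \<partial>M) =
      (\<integral>\<^sup>+p. ennreal ((?d k p)\<^sup>2) \<partial>PT t)" for k
    by (subst nn_integral_PT)
      (use square_integrable_measurable[OF sq[of k]] in \<open>auto simp: case_prod_unfold\<close>)
  with process_lim have "(\<lambda>k. \<integral>p. (?d k p)\<^sup>2 \<partial>PT t) \<longlonglongrightarrow> 0"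
    by (subst tendsto_integral_power2_zero_iff[symmetric, OF sq]) simp
  then show ?thesis
    using square_integrable_L2_limit[OF simple_ito_square_integrable[OF simple] Y ito_lim]
    by (intro that[OF simple]) (simp_all add: case_prod_unfold)
qed

lemma L2_ito_integral_square_integrable: "L2_ito_integral t f Y \<Longrightarrow> square_integrable M Y"
  using L2_ito_integral_approx by metis

lemma L2_ito_integral_simple:
  assumes "simple_integrand M Filt t m \<tau> \<xi>"
  shows "L2_ito_integral t (simple_process m \<tau> \<xi>) (simple_ito B m \<tau> \<xi>)"
  unfolding L2_ito_integral_def has_ito_integral_def
  using assms simple_process_square_integrable[OF assms]
    square_integrable_measurable[OF simple_ito_square_integrable[OF assms]]
  by (intro conjI exI[of _ "\<lambda>_. m"] exI[of _ "\<lambda>_. \<tau>"] exI[of _ "\<lambda>_. \<xi>"]) auto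

lemma ito_isometry:
  assumes Y: "L2_ito_integral t f Y" and Y': "L2_ito_integral t f' Y'"
  shows "(\<integral>\<omega>. Y \<omega> * Y' \<omega> \<partial>M) = (\<integral>(s, \<omega>). f s \<omega> * f' s \<omega> \<partial>PT t)"
proof -
  have f: "square_integrable (PT t) (\<lambda>(s, \<omega>). f s \<omega>)"
    and f': "square_integrable (PT t) (\<lambda>(s, \<omega>). f' s \<omega>)"
    using Y Y' by (auto simp: L2_ito_integral_def)
  obtain m \<tau> \<xi> where \<xi>: "\<And>k::nat. simple_integrand M Filt t (m k) (\<tau> k) (\<xi> k)"
    "(\<lambda>k. \<integral>(s, \<omega>). (simple_process (m k) (\<tau> k) (\<xi> k) s \<omega> - f s \<omega>)\<^sup>2 \<partial>PT t) \<longlonglongrightarrow> 0"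
    "(\<lambda>k. \<integral>\<omega>. (simple_ito B (m k) (\<tau> k) (\<xi> k) \<omega> - Y \<omega>)\<^sup>2 \<partial>M) \<longlonglongrightarrow> 0" "square_integrable M Y"
    using L2_ito_integral_approx[OF Y] by blast
  obtain m' \<tau>' \<xi>' where \<xi>': "\<And>k::nat. simple_integrand M Filt t (m' k) (\<tau>' k) (\<xi>' k)"
    "(\<lambda>k. \<integral>(s, \<omega>). (simple_process (m' k) (\<tau>' k) (\<xi>' k) s \<omega> - f' s \<omega>)\<^sup>2 \<partial>PT t) \<longlonglongrightarrow> 0"
    "(\<lambda>k. \<integral>\<omega>. (simple_ito B (m' k) (\<tau>' k) (\<xi>' k) \<omega> - Y' \<omega>)\<^sup>2 \<partial>M) \<longlonglongrightarrow> 0" "square_integrable M Y'"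
    using L2_ito_integral_approx[OF Y'] by blast
  let ?E = "\<lambda>k. \<integral>\<omega>. simple_ito B (m k) (\<tau> k) (\<xi> k) \<omega> * simple_ito B (m' k) (\<tau>' k) (\<xi>' k) \<omega> \<partial>M"
  have "?E \<longlonglongrightarrow> (\<integral>\<omega>. Y \<omega> * Y' \<omega> \<partial>M)"
    by (intro tendsto_integral_mult_L2 simple_ito_square_integrable[OF \<xi>(1)]
        simple_ito_square_integrable[OF \<xi>'(1)] \<xi> \<xi>')
  moreover have "?E \<longlonglongrightarrow> (\<integral>(s, \<omega>). f s \<omega> * f' s \<omega> \<partial>PT t)"
    using tendsto_integral_mult_L2[OF simple_process_square_integrable[OF \<xi>(1), of t] f
        simple_process_square_integrable[OF \<xi>'(1), of t] f'] \<xi>(2) \<xi>'(2)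
    unfolding simple_ito_isometry[OF \<xi>(1) \<xi>'(1)] case_prod_unfold by simp
  ultimately show ?thesis by (rule LIMSEQ_unique)
qed

lemma ito_isometry_diff:
  assumes Y: "L2_ito_integral t f\<^sub>1 Y\<^sub>1" "L2_ito_integral t f\<^sub>2 Y\<^sub>2"
    and Z: "L2_ito_integral t g\<^sub>1 Z\<^sub>1" "L2_ito_integral t g\<^sub>2 Z\<^sub>2"
  shows "(\<integral>\<omega>. (Y\<^sub>1 \<omega> - Y\<^sub>2 \<omega>) * (Z\<^sub>1 \<omega> - Z\<^sub>2 \<omega>) \<partial>M) =
    (\<integral>(s, \<omega>). (f\<^sub>1 s \<omega> - f\<^sub>2 s \<omega>) * (g\<^sub>1 s \<omega> - g\<^sub>2 s \<omega>) \<partial>PT t)"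
proof -
  have expand: "(a - b) * (c - d) = a * c - a * d - b * c + b * d" for a b c d :: real
    by (simp add: algebra_simps)
  have sq: "square_integrable (PT t) (\<lambda>(s, \<omega>). f s \<omega>)" if "L2_ito_integral t f X" for f X
    using that by (simp add: L2_ito_integral_def)
  note ito_int = integrable_mult_square_integrable[OF L2_ito_integral_square_integrable
      L2_ito_integral_square_integrable]
  note process_int = integrable_mult_case_prod[OF sq sq, unfolded case_prod_unfold]
  show ?thesis
    unfolding expand
    using ito_isometry[OF Y(1) Z(1)] ito_isometry[OF Y(1) Z(2)]
      ito_isometry[OF Y(2) Z(1)] ito_isometry[OF Y(2) Z(2)]
      ito_int[OF Y(1) Z(1)] ito_int[OF Y(1) Z(2)] ito_int[OF Y(2) Z(1)] ito_int[OF Y(2) Z(2)]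
      process_int[OF Y(1) Z(1)] process_int[OF Y(1) Z(2)]
      process_int[OF Y(2) Z(1)] process_int[OF Y(2) Z(2)]
    by (simp add: case_prod_unfold)
qed

section \<open>The martingale property\<close>

text \<open>Steps that start at \<open>t\<close> or later are set to zero and not merely cut off: their values need
  not be measurable at time \<open>t\<close>.\<close>

definition truncate_steps ::
    "real \<Rightarrow> (nat \<Rightarrow> real) \<Rightarrow> (nat \<Rightarrow> 'w \<Rightarrow> real) \<Rightarrow> nat \<Rightarrow> 'w \<Rightarrow> real" where
  "truncate_steps t \<tau> \<xi> j = (if \<tau> j < t then \<xi> j else (\<lambda>_. 0))"

lemma simple_integrand_truncate:
  assumes "simple_integrand M Filt T m \<tau> \<xi>" "0 \<le> t" "t \<le> T"
  shows "simple_integrand M Filt t m (\<lambda>j. min (\<tau> j) t) (truncate_steps t \<tau> \<xi>)"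
  using assms unfolding simple_integrand_def truncate_steps_def
  by (auto simp: min_def intro!: exI[of _ 0])

lemma simple_process_truncate:
  assumes "s \<le> t"
  shows "simple_process m (\<lambda>j. min (\<tau> j) t) (truncate_steps t \<tau> \<xi>) s \<omega> = simple_process m \<tau> \<xi> s \<omega>"
  using assms unfolding simple_process_def truncate_steps_def
  by (intro sum.cong) (auto simp: indicator_def min_def)

lemma expectation_simple_ito_truncate:
  assumes simple: "simple_integrand M Filt T m \<tau> \<xi>" and t: "0 \<le> t" "t \<le> T"
    and Z: "Z \<in> borel_measurable (Filt t)" "square_integrable M Z"
  shows "(\<integral>\<omega>. simple_ito B m \<tau> \<xi> \<omega> * Z \<omega> \<partial>M) =
    (\<integral>\<omega>. simple_ito B m (\<lambda>j. min (\<tau> j) t) (truncate_steps t \<tau> \<xi>) \<omega> * Z \<omega> \<partial>M)"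
proof -
  note D = simple_integrandD[OF simple]
  note truncated = simple_integrand_truncate[OF simple t]
  obtain k where k: "\<And>j \<omega>. j < m \<Longrightarrow> \<omega> \<in> space M \<Longrightarrow> \<bar>\<xi> j \<omega>\<bar> \<le> k j"
    using simple_integrand_bound[OF simple] by metis
  let ?late = "\<lambda>j \<omega>. \<xi> j \<omega> * Z \<omega> * (B (max (\<tau> (Suc j)) t) \<omega> - B (max (\<tau> j) t) \<omega>)"
  have late: "integrable M (?late j)" "(\<integral>\<omega>. ?late j \<omega> \<partial>M) = 0" if j: "j < m" for j
  proof -
    have sq: "square_integrable M (\<lambda>\<omega>. \<xi> j \<omega> * Z \<omega>)"
      using D k j by (intro square_integrable_mult_bounded[of _ _ _ "k j"] Z AE_I2) auto
    have times: "0 \<le> max (\<tau> j) t" "max (\<tau> j) t \<le> max (\<tau> (Suc j)) t" using t D(3)[OF j] by auto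
    show "integrable M (?late j)"
      by (intro integrable_mult_square_integrable sq increment_square_integrable times)
    have "(\<lambda>\<omega>. \<xi> j \<omega> * Z \<omega>) \<in> borel_measurable (Filt (max (\<tau> j) t))"
      using Filt_measurable_mono[OF D(4)[OF j]] Filt_measurable_mono[OF Z(1)] by auto
    then show "(\<integral>\<omega>. ?late j \<omega> \<partial>M) = 0"
      using sq times by (intro expectation_adapted_times_increment)
  qed
  have "\<xi> j \<omega> * (B (\<tau> (Suc j)) \<omega> - B (\<tau> j) \<omega>) * Z \<omega> = ?late j \<omega> +
      truncate_steps t \<tau> \<xi> j \<omega> * (B (min (\<tau> (Suc j)) t) \<omega> - B (min (\<tau> j) t) \<omega>) * Z \<omega>"
    if "j < m" for j \<omega>
  proof (cases "\<tau> j < t")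
    case True
    then show ?thesis by (simp add: truncate_steps_def min_def max_def algebra_simps)
  next
    case False
    then have "t \<le> \<tau> j" "t \<le> \<tau> (Suc j)" using D(3)[OF that] by auto
    then show ?thesis by (simp add: truncate_steps_def max.absorb1 min.absorb2 mult_ac)
  qed
  then have "simple_ito B m \<tau> \<xi> \<omega> * Z \<omega> = (\<Sum>j<m. ?late j \<omega>) +
      simple_ito B m (\<lambda>j. min (\<tau> j) t) (truncate_steps t \<tau> \<xi>) \<omega> * Z \<omega>" for \<omega>
    by (simp add: simple_ito_def sum_distrib_right flip: sum.distrib)
  moreover have "integrable M
      (\<lambda>\<omega>. simple_ito B m (\<lambda>j. min (\<tau> j) t) (truncate_steps t \<tau> \<xi>) \<omega> * Z \<omega>)"
    by (intro integrable_mult_square_integrable simple_ito_square_integrable[OF truncated] Z)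
  moreover have "integrable M (\<lambda>\<omega>. \<Sum>j<m. ?late j \<omega>)" "(\<integral>\<omega>. (\<Sum>j<m. ?late j \<omega>) \<partial>M) = 0"
    using late by (auto simp: Bochner_Integration.integral_sum)
  ultimately show ?thesis by simp
qed

lemma ito_martingale:
  assumes t: "0 \<le> t" "t \<le> T" and Y: "L2_ito_integral T f Y" and Y': "L2_ito_integral t f Y'"
    and Z: "Z \<in> borel_measurable (Filt t)" "square_integrable M Z"
  shows "(\<integral>\<omega>. Y \<omega> * Z \<omega> \<partial>M) = (\<integral>\<omega>. Y' \<omega> * Z \<omega> \<partial>M)"
proof -
  have f: "square_integrable (PT T) (\<lambda>(s, \<omega>). f s \<omega>)" using Y by (simp add: L2_ito_integral_def)
  obtain m \<tau> \<xi> where simple: "\<And>k::nat. simple_integrand M Filt T (m k) (\<tau> k) (\<xi> k)"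
    and process_lim: "(\<lambda>k. \<integral>(s, \<omega>). (simple_process (m k) (\<tau> k) (\<xi> k) s \<omega> - f s \<omega>)\<^sup>2 \<partial>PT T) \<longlonglongrightarrow> 0"
    and ito_lim: "(\<lambda>k. \<integral>\<omega>. (simple_ito B (m k) (\<tau> k) (\<xi> k) \<omega> - Y \<omega>)\<^sup>2 \<partial>M) \<longlonglongrightarrow> 0"
    and Y_sq: "square_integrable M Y"
    using L2_ito_integral_approx[OF Y] by blast
  let ?\<sigma> = "\<lambda>k j. min (\<tau> k j) t" and ?\<eta> = "\<lambda>k. truncate_steps t (\<tau> k) (\<xi> k)"
  note truncated = simple_integrand_truncate[OF simple t]
  have "(\<lambda>k. \<integral>\<omega>. (simple_ito B (m k) (?\<sigma> k) (?\<eta> k) \<omega> - Y' \<omega>)\<^sup>2 \<partial>M) \<longlonglongrightarrow> 0"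
  proof (rule tendsto_sandwich[OF always_eventually always_eventually tendsto_const process_lim])
    show "\<forall>k. (\<integral>\<omega>. (simple_ito B (m k) (?\<sigma> k) (?\<eta> k) \<omega> - Y' \<omega>)\<^sup>2 \<partial>M) \<le>
        (\<integral>(s, \<omega>). (simple_process (m k) (\<tau> k) (\<xi> k) s \<omega> - f s \<omega>)\<^sup>2 \<partial>PT T)"
    proof
      fix k
      have "(\<integral>\<omega>. (simple_ito B (m k) (?\<sigma> k) (?\<eta> k) \<omega> - Y' \<omega>)\<^sup>2 \<partial>M) =
          (\<integral>(s, \<omega>). (simple_process (m k) (?\<sigma> k) (?\<eta> k) s \<omega> - f s \<omega>)\<^sup>2 \<partial>PT t)"
        using ito_isometry_diff[OF L2_ito_integral_simple[OF truncated] Y'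
            L2_ito_integral_simple[OF truncated] Y']
        by (simp add: power2_eq_square)
      also have "\<dots> = (\<integral>(s, \<omega>). (simple_process (m k) (\<tau> k) (\<xi> k) s \<omega> - f s \<omega>)\<^sup>2 \<partial>PT t)"
        by (intro Bochner_Integration.integral_cong refl)
          (auto simp: simple_process_truncate space_pair_measure space_restrict_space)
      also have "\<dots> \<le> (\<integral>(s, \<omega>). (simple_process (m k) (\<tau> k) (\<xi> k) s \<omega> - f s \<omega>)\<^sup>2 \<partial>PT T)"
        by (intro square_integrable_PT_mono(2) square_integrable_diff_case_prod
            simple_process_square_integrable[OF simple] f t)
      finally show "(\<integral>\<omega>. (simple_ito B (m k) (?\<sigma> k) (?\<eta> k) \<omega> - Y' \<omega>)\<^sup>2 \<partial>M) \<le>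
          (\<integral>(s, \<omega>). (simple_process (m k) (\<tau> k) (\<xi> k) s \<omega> - f s \<omega>)\<^sup>2 \<partial>PT T)" .
    qed
  qed simp
  then have "(\<lambda>k. \<integral>\<omega>. simple_ito B (m k) (?\<sigma> k) (?\<eta> k) \<omega> * Z \<omega> \<partial>M) \<longlonglongrightarrow> (\<integral>\<omega>. Y' \<omega> * Z \<omega> \<partial>M)"
    by (intro tendsto_integral_mult_L2 simple_ito_square_integrable[OF truncated]
        L2_ito_integral_square_integrable[OF Y'] Z) simp_all
  moreover have "(\<lambda>k. \<integral>\<omega>. simple_ito B (m k) (\<tau> k) (\<xi> k) \<omega> * Z \<omega> \<partial>M) \<longlonglongrightarrow> (\<integral>\<omega>. Y \<omega> * Z \<omega> \<partial>M)"
    by (intro tendsto_integral_mult_L2 simple_ito_square_integrable[OF simple] Y_sq Z ito_lim)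
      simp
  ultimately show ?thesis
    unfolding expectation_simple_ito_truncate[OF simple t Z]
    by (rule LIMSEQ_unique[THEN sym])
qed

end

section \<open>Time integrals of processes\<close>

definition time_integral :: "real \<Rightarrow> (real \<Rightarrow> 'w \<Rightarrow> real) \<Rightarrow> real \<Rightarrow> 'w \<Rightarrow> real" where
  "time_integral T b t \<omega> = (\<integral>s. indicator {..t} s * b s \<omega> \<partial>Time T)"

lemma set_integral_eq_time_integral:
  assumes "0 \<le> t" "t \<le> T"
  shows "(LINT s:{0..t}|lborel. b s \<omega>) = time_integral T b t \<omega>"
  unfolding time_integral_def set_lebesgue_integral_def
  by (subst integral_restrict_space)
    (use assms in \<open>auto simp: indicator_def intro!: Bochner_Integration.integral_cong\<close>)

lemma time_integral_full: "time_integral T b T \<omega> = (\<integral>s. b s \<omega> \<partial>Time T)"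
  unfolding time_integral_def
  by (intro Bochner_Integration.integral_cong) (auto simp: indicator_def space_restrict_space)

lemma square_integrable_mult_indicator_atMost:
  assumes "square_integrable (Time T) f"
  shows "square_integrable (Time T) (\<lambda>s. indicator {..t} s * f s)"
  by (rule square_integrable_mult_bounded[OF assms, of _ 1]) (auto simp: indicator_def)

lemma abs_time_integral_le:
  assumes "square_integrable (Time T) (\<lambda>s. b s \<omega>)"
  shows "\<bar>time_integral T b t \<omega>\<bar> \<le>
    sqrt (measure (Time T) (space (Time T)) * (\<integral>s. (b s \<omega>)\<^sup>2 \<partial>Time T))"
proof -
  interpret T: finite_measure "Time T" by (rule finite_measure_Time)
  have sq: "square_integrable (Time T) (indicator {..t})"
    by (rule T.square_integrable_bounded[of _ 1]) (auto simp: indicator_def)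
  have "(\<integral>s. (indicator {..t} s)\<^sup>2 \<partial>Time T) \<le> (\<integral>s. 1 \<partial>Time T :: real)"
    using sq by (intro integral_mono) (auto simp: square_integrable_def indicator_def)
  then have "sqrt (\<integral>s. (indicator {..t} s)\<^sup>2 \<partial>Time T) \<le> sqrt (measure (Time T) (space (Time T)))"
    by simp
  then have "sqrt (\<integral>s. (indicator {..t} s)\<^sup>2 \<partial>Time T) * sqrt (\<integral>s. (b s \<omega>)\<^sup>2 \<partial>Time T) \<le>
      sqrt (measure (Time T) (space (Time T))) * sqrt (\<integral>s. (b s \<omega>)\<^sup>2 \<partial>Time T)"
    by (intro mult_right_mono) (auto intro: Bochner_Integration.integral_nonneg)
  then show ?thesis
    using Cauchy_Schwarz_integral[OF sq assms] unfolding time_integral_def real_sqrt_mult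
    by linarith
qed

lemma time_integral_diff:
  assumes "square_integrable (Time T) (\<lambda>s. b s \<omega>)" "square_integrable (Time T) (\<lambda>s. b' s \<omega>)"
  shows "time_integral T (\<lambda>s \<omega>. b s \<omega> - b' s \<omega>) t \<omega> =
    time_integral T b t \<omega> - time_integral T b' t \<omega>"
proof -
  interpret T: finite_measure "Time T" by (rule finite_measure_Time)
  show ?thesis
    unfolding time_integral_def right_diff_distrib
    by (intro Bochner_Integration.integral_diff T.integrable_square_integrable
        square_integrable_mult_indicator_atMost assms)
qed

context brownian
begin

lemma AE_square_integrable_path:
  assumes b: "square_integrable (PT T) (\<lambda>(s, \<omega>). b s \<omega>)"
  shows "AE \<omega> in M. square_integrable (Time T) (\<lambda>s. b s \<omega>)"
proof -
  interpret pair: pair_sigma_finite "Time T" M by (rule pair_sigma_finite_Time)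
  have "integrable (PT T) (\<lambda>(s, \<omega>). (b s \<omega>)\<^sup>2)"
    using b by (simp add: square_integrable_def case_prod_unfold)
  from pair.AE_integrable_snd[OF this] AE_space show ?thesis
  proof eventually_elim
    case (elim \<omega>)
    then show ?case
      using measurable_compose[OF measurable_Pair2'[of \<omega> M "Time T"]
          square_integrable_measurable[OF b]]
      by (simp add: square_integrable_def)
  qed
qed

lemma square_integrable_PT_const:
  assumes "square_integrable M f"
  shows "square_integrable (PT T) (\<lambda>(t, \<omega>). f \<omega>)"
proof -
  interpret pair: pair_sigma_finite "Time T" M by (rule pair_sigma_finite_Time)
  interpret finite_measure "Time T" by (rule finite_measure_Time)
  have [measurable]: "f \<in> borel_measurable M" using assms by (rule square_integrable_measurable)
  have "integrable (PT T) (\<lambda>(t, \<omega>). (f \<omega>)\<^sup>2)"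
    using assms by (intro pair.Fubini_integrable) (auto simp: square_integrable_def)
  then show ?thesis by (simp add: square_integrable_def case_prod_unfold)
qed

lemma time_integral_measurable:
  assumes [measurable]: "(\<lambda>(s, \<omega>). b s \<omega>) \<in> borel_measurable (PT T)"
  shows "(\<lambda>(t, \<omega>). time_integral T b t \<omega>) \<in> borel_measurable (PT T)"
    and "t \<in> {0..T} \<Longrightarrow> time_integral T b t \<in> borel_measurable M"
proof -
  interpret T: finite_measure "Time T" by (rule finite_measure_Time)
  show on_PT: "(\<lambda>(t, \<omega>). time_integral T b t \<omega>) \<in> borel_measurable (PT T)"
    unfolding time_integral_def case_prod_unfold
  proof (rule T.borel_measurable_lebesgue_integral)
    have "(\<lambda>p. (if snd p \<le> fst (fst p) then 1 else 0) * (\<lambda>(s, \<omega>). b s \<omega>) (snd p, snd (fst p)))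
      \<in> borel_measurable (PT T \<Otimes>\<^sub>M Time T)" by measurable
    then show "(\<lambda>(p, s). indicator {..fst p} s * b s (snd p)) \<in>
        borel_measurable (PT T \<Otimes>\<^sub>M Time T)"
      by (simp add: case_prod_unfold indicator_def)
  qed
  show "time_integral T b t \<in> borel_measurable M" if "t \<in> {0..T}"
    using that measurable_compose[OF measurable_Pair1'[of t "Time T" M] on_PT]
    by (simp add: space_restrict_space)
qed

lemma time_integral_square_integrable:
  assumes b: "square_integrable (PT T) (\<lambda>(s, \<omega>). b s \<omega>)"
  shows "square_integrable (PT T) (\<lambda>(t, \<omega>). time_integral T b t \<omega>)"
    and "t \<in> {0..T} \<Longrightarrow> square_integrable M (time_integral T b t)"
proof -
  interpret pair: pair_sigma_finite "Time T" M by (rule pair_sigma_finite_Time)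
  note measurable = time_integral_measurable[OF square_integrable_measurable[OF b]]
  define Z where "Z = (\<lambda>\<omega>. sqrt (measure (Time T) (space (Time T)) * (\<integral>s. (b s \<omega>)\<^sup>2 \<partial>Time T)))"
  have "integrable M (\<lambda>\<omega>. \<integral>s. (b s \<omega>)\<^sup>2 \<partial>Time T)"
    using b by (intro pair.integrable_snd) (simp add: square_integrable_def case_prod_unfold)
  then have Z: "square_integrable M Z"
    by (auto simp: square_integrable_def Z_def intro!: Bochner_Integration.integral_nonneg)
  have dominated: "AE \<omega> in M. \<forall>t. \<bar>time_integral T b t \<omega>\<bar> \<le> \<bar>Z \<omega>\<bar>"
    using AE_square_integrable_path[OF b]
    by eventually_elim (auto simp: Z_def intro: order_trans[OF abs_time_integral_le])
  show "square_integrable M (time_integral T b t)" if "t \<in> {0..T}"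
    by (rule square_integrable_dominated[OF Z measurable(2)[OF that]]) (use dominated in auto)
  show "square_integrable (PT T) (\<lambda>(t, \<omega>). time_integral T b t \<omega>)"
  proof (rule square_integrable_dominated[OF square_integrable_PT_const[OF Z] measurable(1)])
    have [measurable]: "Z \<in> borel_measurable M" by (rule square_integrable_measurable[OF Z])
    show "AE p in PT T. \<bar>case p of (t, \<omega>) \<Rightarrow> time_integral T b t \<omega>\<bar> \<le> \<bar>case p of (t, \<omega>) \<Rightarrow> Z \<omega>\<bar>"
    proof (rule pair.AE_pair_measure)
      show "AE t in Time T. AE \<omega> in M. \<bar>case (t, \<omega>) of (t, \<omega>) \<Rightarrow> time_integral T b t \<omega>\<bar>
          \<le> \<bar>case (t, \<omega>) of (t, \<omega>) \<Rightarrow> Z \<omega>\<bar>"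
        by (rule AE_I2) (use dominated in \<open>eventually_elim, simp\<close>)
    qed (use measurable(1) in measurable)
  qed
qed

lemma expectation_time_integral_product:
  assumes T: "0 \<le> T" and b: "square_integrable (PT T) (\<lambda>(s, \<omega>). b s \<omega>)"
    and b': "square_integrable (PT T) (\<lambda>(s, \<omega>). b' s \<omega>)"
  shows "(\<integral>\<omega>. time_integral T b T \<omega> * time_integral T b' T \<omega> \<partial>M) =
    (\<integral>(t, \<omega>). b' t \<omega> * time_integral T b t \<omega> \<partial>PT T) +
    (\<integral>(t, \<omega>). b t \<omega> * time_integral T b' t \<omega> \<partial>PT T)"
proof -
  interpret pair: pair_sigma_finite "Time T" M by (rule pair_sigma_finite_Time)
  interpret T: finite_measure "Time T" by (rule finite_measure_Time)
  interpret T: atomless_real_measure "Time T" by (rule atomless_real_measure_Time)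
  let ?I = "time_integral T b" and ?I' = "time_integral T b'"
  note int = integrable_mult_case_prod[OF b' time_integral_square_integrable(1)[OF b]]
    and int' = integrable_mult_case_prod[OF b time_integral_square_integrable(1)[OF b']]
  have "AE \<omega> in M. ?I T \<omega> * ?I' T \<omega> =
      (\<integral>t. b' t \<omega> * ?I t \<omega> \<partial>Time T) + (\<integral>t. b t \<omega> * ?I' t \<omega> \<partial>Time T)"
    using AE_square_integrable_path[OF b] AE_square_integrable_path[OF b']
  proof eventually_elim
    case (elim \<omega>)
    from T.integral_mult_eq_iterated[OF elim[THEN T.integrable_square_integrable]] show ?case
      unfolding time_integral_full by (simp add: time_integral_def)
  qed
  then have "(\<integral>\<omega>. ?I T \<omega> * ?I' T \<omega> \<partial>M) =
      (\<integral>\<omega>. (\<integral>t. b' t \<omega> * ?I t \<omega> \<partial>Time T) + (\<integral>t. b t \<omega> * ?I' t \<omega> \<partial>Time T) \<partial>M)"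
    using T time_integral_measurable(2)[OF square_integrable_measurable[OF b], of T]
      time_integral_measurable(2)[OF square_integrable_measurable[OF b'], of T]
      pair.integrable_snd[OF int] pair.integrable_snd[OF int']
    by (intro integral_cong_AE) auto
  also have "\<dots> = (\<integral>(t, \<omega>). b' t \<omega> * ?I t \<omega> \<partial>PT T) + (\<integral>(t, \<omega>). b t \<omega> * ?I' t \<omega> \<partial>PT T)"
    using pair.integrable_snd[OF int] pair.integrable_snd[OF int']
      pair.integral_snd[OF int] pair.integral_snd[OF int'] by simp
  finally show ?thesis .
qed

end

section \<open>Ito processes and the product rule\<close>

context brownian
begin

definition L2_adapted :: "real \<Rightarrow> (real \<Rightarrow> 'w \<Rightarrow> real) \<Rightarrow> bool" where
  "L2_adapted T f \<longleftrightarrow> square_integrable (PT T) (\<lambda>(t, \<omega>). f t \<omega>) \<and>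
     (\<forall>t\<in>{0..T}. f t \<in> borel_measurable (Filt t))"

text \<open>The values of an Ito integral are versions that need not be adapted, so only the
  orthogonality of later increments to the past is required.\<close>

definition weak_martingale :: "real \<Rightarrow> (real \<Rightarrow> 'w \<Rightarrow> real) \<Rightarrow> bool" where
  "weak_martingale T Y \<longleftrightarrow> (\<forall>t\<in>{0..T}. square_integrable M (Y t) \<and>
     (\<forall>Z\<in>borel_measurable (Filt t). square_integrable M Z \<longrightarrow>
        (\<integral>\<omega>. Y T \<omega> * Z \<omega> \<partial>M) = (\<integral>\<omega>. Y t \<omega> * Z \<omega> \<partial>M)))"

definition ito_process ::
    "real \<Rightarrow> ('w \<Rightarrow> real) \<Rightarrow> (real \<Rightarrow> 'w \<Rightarrow> real) \<Rightarrow> (real \<Rightarrow> 'w \<Rightarrow> real) \<Rightarrow> (real \<Rightarrow> 'w \<Rightarrow> real) \<Rightarrow> bool"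
  where
  "ito_process T p0 p b Y \<longleftrightarrow> L2_adapted T p \<and> L2_adapted T b \<and> weak_martingale T Y \<and>
     (\<forall>t\<in>{0..T}. AE \<omega> in M. p t \<omega> = p0 \<omega> + time_integral T b t \<omega> + Y t \<omega>)"

lemma L2_adapted_diff:
  "L2_adapted T f \<Longrightarrow> L2_adapted T g \<Longrightarrow> L2_adapted T (\<lambda>t \<omega>. f t \<omega> - g t \<omega>)"
  unfolding L2_adapted_def
  by (intro conjI ballI square_integrable_diff_case_prod borel_measurable_diff) auto

lemma L2_adapted_measurable: "L2_adapted T f \<Longrightarrow> t \<in> {0..T} \<Longrightarrow> f t \<in> borel_measurable M"
  unfolding L2_adapted_def using Filt_measurable[of "f t" t] by blast

lemma L2_adapted_AE_square_integrable:
  assumes f: "L2_adapted T f"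
  shows "AE t in Time T. square_integrable M (f t)"
proof -
  interpret pair: pair_sigma_finite "Time T" M by (rule pair_sigma_finite_Time)
  have "integrable (PT T) (\<lambda>(t, \<omega>). (f t \<omega>)\<^sup>2)"
    using f by (simp add: L2_adapted_def square_integrable_def case_prod_unfold)
  from pair.AE_integrable_fst[OF this] AE_space show ?thesis
    by eventually_elim
      (use L2_adapted_measurable[OF f] in \<open>auto simp: square_integrable_def space_restrict_space\<close>)
qed

lemma L2_ito_integral_weak_martingale:
  assumes "\<And>t. t \<in> {0..T} \<Longrightarrow> L2_ito_integral t f (Y t)"
  shows "weak_martingale T Y"
  unfolding weak_martingale_def
proof (intro ballI conjI impI)
  fix t assume t: "t \<in> {0..T}"
  then have T: "T \<in> {0..T}" by simp
  show "square_integrable M (Y t)" by (rule L2_ito_integral_square_integrable[OF assms[OF t]])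
  fix Z assume "Z \<in> borel_measurable (Filt t)" "square_integrable M Z"
  then show "(\<integral>\<omega>. Y T \<omega> * Z \<omega> \<partial>M) = (\<integral>\<omega>. Y t \<omega> * Z \<omega> \<partial>M)"
    using t by (intro ito_martingale[OF _ _ assms[OF T] assms[OF t]]) auto
qed

lemma weak_martingale_diff:
  assumes Y: "weak_martingale T Y" and Y': "weak_martingale T Y'"
  shows "weak_martingale T (\<lambda>t \<omega>. Y t \<omega> - Y' t \<omega>)"
  unfolding weak_martingale_def
proof (intro ballI conjI impI)
  fix t assume t: "t \<in> {0..T}"
  then have T: "T \<in> {0..T}" by simp
  have sq: "square_integrable M (Y s)" "square_integrable M (Y' s)" if "s \<in> {0..T}" for s
    using Y Y' that by (auto simp: weak_martingale_def)
  show "square_integrable M (\<lambda>\<omega>. Y t \<omega> - Y' t \<omega>)"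
    by (intro square_integrable_diff sq t)
  fix Z assume Z: "Z \<in> borel_measurable (Filt t)" "square_integrable M Z"
  then have "(\<integral>\<omega>. Y T \<omega> * Z \<omega> \<partial>M) = (\<integral>\<omega>. Y t \<omega> * Z \<omega> \<partial>M)"
    "(\<integral>\<omega>. Y' T \<omega> * Z \<omega> \<partial>M) = (\<integral>\<omega>. Y' t \<omega> * Z \<omega> \<partial>M)"
    using Y Y' t by (auto simp: weak_martingale_def)
  then show "(\<integral>\<omega>. (Y T \<omega> - Y' T \<omega>) * Z \<omega> \<partial>M) = (\<integral>\<omega>. (Y t \<omega> - Y' t \<omega>) * Z \<omega> \<partial>M)"
    using sq[OF T] sq[OF t] Z(2) by (simp add: left_diff_distrib integrable_mult_square_integrable)
qed

lemma ito_process_diff: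
  assumes p: "ito_process T p0 p b Y" and p': "ito_process T p0 p' b' Y'"
  shows "ito_process T (\<lambda>_. 0) (\<lambda>t \<omega>. p t \<omega> - p' t \<omega>) (\<lambda>t \<omega>. b t \<omega> - b' t \<omega>)
    (\<lambda>t \<omega>. Y t \<omega> - Y' t \<omega>)"
  unfolding ito_process_def
proof (intro conjI ballI)
  fix t assume t: "t \<in> {0..T}"
  have sq: "square_integrable (PT T) (\<lambda>(t, \<omega>). b t \<omega>)" "square_integrable (PT T) (\<lambda>(t, \<omega>). b' t \<omega>)"
    using p p' by (auto simp: ito_process_def L2_adapted_def)
  have "AE \<omega> in M. p t \<omega> = p0 \<omega> + time_integral T b t \<omega> + Y t \<omega>"
    "AE \<omega> in M. p' t \<omega> = p0 \<omega> + time_integral T b' t \<omega> + Y' t \<omega>"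
    using p p' t by (auto simp: ito_process_def)
  then show "AE \<omega> in M. p t \<omega> - p' t \<omega> =
      0 + time_integral T (\<lambda>t \<omega>. b t \<omega> - b' t \<omega>) t \<omega> + (Y t \<omega> - Y' t \<omega>)"
    using sq[THEN AE_square_integrable_path] by eventually_elim (simp add: time_integral_diff)
qed (use p p' in \<open>auto simp: ito_process_def intro: L2_adapted_diff weak_martingale_diff\<close>)

lemma ito_process_martingale_part:
  assumes "ito_process T (\<lambda>_. 0) p b Y" "t \<in> {0..T}"
  shows "AE \<omega> in M. Y t \<omega> = p t \<omega> - time_integral T b t \<omega>"
proof -
  have "AE \<omega> in M. p t \<omega> = 0 + time_integral T b t \<omega> + Y t \<omega>"
    using assms unfolding ito_process_def by blast
  then show ?thesis by eventually_elim simp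
qed

lemma ito_process_terminal_square_integrable:
  assumes T: "0 \<le> T" and p: "ito_process T (\<lambda>_. 0) p b Y"
  shows "square_integrable M (p T)"
proof (rule square_integrable_cong_AE)
  show "square_integrable M (\<lambda>\<omega>. time_integral T b T \<omega> + Y T \<omega>)"
    using T p by (intro square_integrable_add time_integral_square_integrable(2))
      (auto simp: ito_process_def L2_adapted_def weak_martingale_def)
  show "p T \<in> borel_measurable M"
    using T p by (auto simp: ito_process_def intro: L2_adapted_measurable)
  show "AE \<omega> in M. p T \<omega> = time_integral T b T \<omega> + Y T \<omega>"
    using T p by (auto simp: ito_process_def)
qed

lemma expectation_time_integral_martingale:
  assumes T: "0 \<le> T" and p: "ito_process T (\<lambda>_. 0) p b Y" and c: "L2_adapted T c"
  shows "(\<integral>\<omega>. time_integral T c T \<omega> * Y T \<omega> \<partial>M) =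
    (\<integral>(t, \<omega>). p t \<omega> * c t \<omega> \<partial>PT T) - (\<integral>(t, \<omega>). time_integral T b t \<omega> * c t \<omega> \<partial>PT T)"
proof -
  interpret pair: pair_sigma_finite "Time T" M by (rule pair_sigma_finite_Time)
  have sq: "square_integrable (PT T) (\<lambda>(t, \<omega>). p t \<omega>)" "square_integrable (PT T) (\<lambda>(t, \<omega>). b t \<omega>)"
    "square_integrable (PT T) (\<lambda>(t, \<omega>). c t \<omega>)" "square_integrable M (Y T)"
    using T p c by (auto simp: ito_process_def L2_adapted_def weak_martingale_def)
  note I_sq = time_integral_square_integrable(1)[OF sq(2)]
  note YT_int = integrable_mult_case_prod[OF square_integrable_PT_const[OF sq(4)] sq(3)]
    and Yt_int = integrable_mult_case_prod[OF square_integrable_diff_case_prod[OF sq(1) I_sq] sq(3)]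
  have "(\<integral>\<omega>. time_integral T c T \<omega> * Y T \<omega> \<partial>M) = (\<integral>(t, \<omega>). Y T \<omega> * c t \<omega> \<partial>PT T)"
    using pair.integral_snd[OF YT_int] by (simp add: time_integral_full mult.commute)
  also have "\<dots> = (\<integral>t. (\<integral>\<omega>. Y T \<omega> * c t \<omega> \<partial>M) \<partial>Time T)"
    by (rule pair.integral_fst[OF YT_int, symmetric])
  also have "\<dots> = (\<integral>t. (\<integral>\<omega>. (p t \<omega> - time_integral T b t \<omega>) * c t \<omega> \<partial>M) \<partial>Time T)"
  proof (rule integral_cong_AE)
    show "AE t in Time T. (\<integral>\<omega>. Y T \<omega> * c t \<omega> \<partial>M) =
        (\<integral>\<omega>. (p t \<omega> - time_integral T b t \<omega>) * c t \<omega> \<partial>M)"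
      using L2_adapted_AE_square_integrable[OF c] AE_space
    proof eventually_elim
      case (elim t)
      then have t: "t \<in> {0..T}" by (simp add: space_restrict_space)
      have measurable: "p t \<in> borel_measurable M" "Y t \<in> borel_measurable M"
        "time_integral T b t \<in> borel_measurable M" "c t \<in> borel_measurable M"
        using p c t time_integral_measurable(2)[OF square_integrable_measurable[OF sq(2)] t]
        by (auto simp: ito_process_def weak_martingale_def
            intro: L2_adapted_measurable square_integrable_measurable)
      have "(\<integral>\<omega>. Y T \<omega> * c t \<omega> \<partial>M) = (\<integral>\<omega>. Y t \<omega> * c t \<omega> \<partial>M)"
        using p c t elim(1) by (auto simp: ito_process_def L2_adapted_def weak_martingale_def)
      also have "\<dots> = (\<integral>\<omega>. (p t \<omega> - time_integral T b t \<omega>) * c t \<omega> \<partial>M)"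
        using ito_process_martingale_part[OF p t] measurable by (intro integral_cong_AE) auto
      finally show ?case .
    qed
  qed (use pair.integrable_fst[OF YT_int] pair.integrable_fst[OF Yt_int] in auto)
  also have "\<dots> = (\<integral>(t, \<omega>). (p t \<omega> - time_integral T b t \<omega>) * c t \<omega> \<partial>PT T)"
    by (rule pair.integral_fst[OF Yt_int])
  also have "\<dots> = (\<integral>(t, \<omega>). p t \<omega> * c t \<omega> \<partial>PT T) - (\<integral>(t, \<omega>). time_integral T b t \<omega> * c t \<omega> \<partial>PT T)"
    using Bochner_Integration.integral_diff[OF integrable_mult_case_prod[OF sq(1,3)]
        integrable_mult_case_prod[OF I_sq sq(3)]]
    by (simp add: case_prod_unfold left_diff_distrib)
  finally show ?thesis .
qed

text \<open>No partition of the time interval is needed: with \<open>p = I + Y\<close>, the martingale property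
  replaces \<open>Y T\<close> by \<open>Y t\<close> against the drift at time \<open>t\<close>, and what is left is \<open>I * I'\<close>, which
  is handled by Fubini.\<close>

theorem ito_product_rule:
  assumes T: "0 \<le> T" and p: "ito_process T (\<lambda>_. 0) p b Y" and p': "ito_process T (\<lambda>_. 0) p' b' Y'"
  shows "(\<integral>\<omega>. p T \<omega> * p' T \<omega> \<partial>M) = (\<integral>\<omega>. Y T \<omega> * Y' T \<omega> \<partial>M) +
    (\<integral>(t, \<omega>). p t \<omega> * b' t \<omega> + p' t \<omega> * b t \<omega> \<partial>PT T)"
proof -
  let ?I = "time_integral T b" and ?I' = "time_integral T b'"
  have adapted: "L2_adapted T p" "L2_adapted T b" "L2_adapted T p'" "L2_adapted T b'"
    using p p' by (auto simp: ito_process_def)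
  then have sq: "square_integrable (PT T) (\<lambda>(t, \<omega>). p t \<omega>)"
    "square_integrable (PT T) (\<lambda>(t, \<omega>). b t \<omega>)" "square_integrable (PT T) (\<lambda>(t, \<omega>). p' t \<omega>)"
    "square_integrable (PT T) (\<lambda>(t, \<omega>). b' t \<omega>)"
    by (auto simp: L2_adapted_def)
  have terminal: "square_integrable M (?I T)" "square_integrable M (?I' T)"
    "square_integrable M (Y T)" "square_integrable M (Y' T)"
    "square_integrable M (p T)" "square_integrable M (p' T)"
    using T p p' sq ito_process_terminal_square_integrable[OF T]
    by (auto simp: ito_process_def weak_martingale_def intro: time_integral_square_integrable)
  have "AE \<omega> in M. p T \<omega> = ?I T \<omega> + Y T \<omega>" "AE \<omega> in M. p' T \<omega> = ?I' T \<omega> + Y' T \<omega>"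
    using T p p' by (auto simp: ito_process_def)
  then have "AE \<omega> in M. p T \<omega> * p' T \<omega> =
      ?I T \<omega> * ?I' T \<omega> + ?I' T \<omega> * Y T \<omega> + ?I T \<omega> * Y' T \<omega> + Y T \<omega> * Y' T \<omega>"
    by eventually_elim (simp add: algebra_simps)
  then have "(\<integral>\<omega>. p T \<omega> * p' T \<omega> \<partial>M) =
      (\<integral>\<omega>. ?I T \<omega> * ?I' T \<omega> + ?I' T \<omega> * Y T \<omega> + ?I T \<omega> * Y' T \<omega> + Y T \<omega> * Y' T \<omega> \<partial>M)"
    using terminal[THEN square_integrable_measurable] by (intro integral_cong_AE) auto
  also have "\<dots> = (\<integral>\<omega>. ?I T \<omega> * ?I' T \<omega> \<partial>M) + (\<integral>\<omega>. ?I' T \<omega> * Y T \<omega> \<partial>M) +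
      (\<integral>\<omega>. ?I T \<omega> * Y' T \<omega> \<partial>M) + (\<integral>\<omega>. Y T \<omega> * Y' T \<omega> \<partial>M)"
    using terminal by (simp add: integrable_mult_square_integrable)
  also have "\<dots> = (\<integral>\<omega>. Y T \<omega> * Y' T \<omega> \<partial>M) + (\<integral>(t, \<omega>). p t \<omega> * b' t \<omega> \<partial>PT T) +
      (\<integral>(t, \<omega>). p' t \<omega> * b t \<omega> \<partial>PT T)"
    using expectation_time_integral_product[OF T sq(2,4)]
      expectation_time_integral_martingale[OF T p adapted(4)]
      expectation_time_integral_martingale[OF T p' adapted(2)]
    by (simp add: case_prod_unfold mult.commute)
  also have "\<dots> = (\<integral>\<omega>. Y T \<omega> * Y' T \<omega> \<partial>M) + (\<integral>(t, \<omega>). p t \<omega> * b' t \<omega> + p' t \<omega> * b t \<omega> \<partial>PT T)"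
    using integrable_mult_case_prod[OF sq(1,4)] integrable_mult_case_prod[OF sq(3,2)]
    by (simp add: case_prod_unfold)
  finally show ?thesis .
qed

end

section \<open>A discrete Gagliardo inequality\<close>

lemma power_powr_inverse:
  fixes x :: real
  assumes "0 \<le> x" "0 < m"
  shows "(x ^ m) powr (1 / real m) = x"
  using assms by (simp add: powr_powr flip: powr_realpow')

lemma powr_inverse_power:
  fixes x :: real
  assumes "0 \<le> x" "0 < m"
  shows "(x powr (1 / real m)) ^ m = x"
  using assms by (simp add: powr_powr flip: powr_realpow')

lemma Hoelder_sum_prod_normalized:
  fixes x :: "'i \<Rightarrow> 'a \<Rightarrow> real"
  assumes I: "finite I" "I \<noteq> {}" and x: "\<And>i a. i \<in> I \<Longrightarrow> a \<in> A \<Longrightarrow> 0 \<le> x i a"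
    and sum_x: "\<And>i. i \<in> I \<Longrightarrow> (\<Sum>a\<in>A. x i a) = 1"
  shows "(\<Sum>a\<in>A. (\<Prod>i\<in>I. x i a) powr (1 / card I)) \<le> 1"
proof -
  have "(\<Sum>a\<in>A. (\<Prod>i\<in>I. x i a) powr (1 / card I)) \<le> (\<Sum>a\<in>A. \<Sum>i\<in>I. x i a / card I)"
    by (intro sum_mono arith_geom_mean I x)
  also have "\<dots> = (\<Sum>i\<in>I. (\<Sum>a\<in>A. x i a) / card I)"
    by (subst sum.swap) (simp only: sum_divide_distrib)
  also have "\<dots> = 1" using sum_x I by simp
  finally show ?thesis .
qed

lemma Hoelder_sum_prod:
  fixes x :: "'i \<Rightarrow> 'a \<Rightarrow> real"
  assumes I: "finite I" "I \<noteq> {}" and x: "\<And>i a. i \<in> I \<Longrightarrow> a \<in> A \<Longrightarrow> 0 \<le> x i a" and A: "finite A"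
  shows "(\<Sum>a\<in>A. (\<Prod>i\<in>I. x i a) powr (1 / card I)) \<le> (\<Prod>i\<in>I. \<Sum>a\<in>A. x i a) powr (1 / card I)"
proof (cases "\<exists>i\<in>I. (\<Sum>a\<in>A. x i a) = 0")
  case True
  then obtain i where i: "i \<in> I" "(\<Sum>a\<in>A. x i a) = 0" by blast
  then have "\<forall>a\<in>A. x i a = 0" using A x[OF i(1)] by (simp add: sum_nonneg_eq_0_iff)
  then have "(\<Prod>i\<in>I. x i a) = 0" if "a \<in> A" for a using I i(1) that by (auto intro: prod_zero)
  then show ?thesis by simp
next
  case False
  let ?X = "\<lambda>i. \<Sum>a\<in>A. x i a"
  have X: "0 < ?X i" if "i \<in> I" for i
    using False that sum_nonneg[of A "x i"] x[OF that] by (metis order_le_less)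
  have "(\<Prod>i\<in>I. x i a) powr (1 / card I) =
      (\<Prod>i\<in>I. ?X i) powr (1 / card I) * (\<Prod>i\<in>I. x i a / ?X i) powr (1 / card I)" for a
  proof -
    have "(\<Prod>i\<in>I. x i a) = (\<Prod>i\<in>I. ?X i) * (\<Prod>i\<in>I. x i a / ?X i)"
      unfolding prod.distrib[symmetric] using X by (intro prod.cong) (auto simp: less_le)
    then show ?thesis by (simp add: powr_mult)
  qed
  then have "(\<Sum>a\<in>A. (\<Prod>i\<in>I. x i a) powr (1 / card I)) =
      (\<Prod>i\<in>I. ?X i) powr (1 / card I) * (\<Sum>a\<in>A. (\<Prod>i\<in>I. x i a / ?X i) powr (1 / card I))"
    by (simp add: sum_distrib_left)
  also have "\<dots> \<le> (\<Prod>i\<in>I. ?X i) powr (1 / card I) * 1"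
    using I x X by (intro mult_left_mono Hoelder_sum_prod_normalized)
      (auto simp: less_le simp flip: sum_divide_distrib intro!: divide_nonneg_nonneg)
  finally show ?thesis by simp
qed

lemma Hoelder_sum_mult_power:
  fixes x y :: "'a \<Rightarrow> real"
  assumes "finite A" "\<And>a. a \<in> A \<Longrightarrow> 0 \<le> x a" "\<And>a. a \<in> A \<Longrightarrow> 0 \<le> y a"
  shows "(\<Sum>a\<in>A. (x a * y a ^ m) powr (1 / Suc m)) \<le>
    ((\<Sum>a\<in>A. x a) * (\<Sum>a\<in>A. y a) ^ m) powr (1 / Suc m)"
proof -
  let ?f = "\<lambda>i a. case i of 0 \<Rightarrow> x a | Suc _ \<Rightarrow> y a"
  have "(\<Sum>a\<in>A. (\<Prod>i\<le>m. ?f i a) powr (1 / card {..m})) \<le>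
      (\<Prod>i\<le>m. \<Sum>a\<in>A. ?f i a) powr (1 / card {..m})"
    using assms by (intro Hoelder_sum_prod) (auto split: nat.split)
  then show ?thesis by (simp add: prod.atMost_shift)
qed

definition slice :: "'a set \<Rightarrow> 'n set \<Rightarrow> ('n \<Rightarrow> 'a) \<Rightarrow> ('n \<Rightarrow> 'a) set" where
  "slice A J k = {z. (\<forall>i\<in>J. z i \<in> A) \<and> (\<forall>i. i \<notin> J \<longrightarrow> z i = k i)}"

lemma slice_UNIV: "slice A UNIV k = (UNIV \<rightarrow>\<^sub>E A)"
  by (auto simp: slice_def)

lemma finite_slice:
  fixes k :: "'n::finite \<Rightarrow> 'a"
  assumes "finite A"
  shows "finite (slice A J k)"
proof (rule finite_subset)
  show "slice A J k \<subseteq> (UNIV \<rightarrow>\<^sub>E A \<union> range k)" by (auto simp: slice_def)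
  show "finite (UNIV \<rightarrow>\<^sub>E A \<union> range k :: ('n \<Rightarrow> 'a) set)" using assms by (intro finite_PiE) auto
qed

lemma sum_slice_insert:
  fixes k :: "'n::finite \<Rightarrow> 'a"
  assumes "finite A" "j \<notin> J"
  shows "(\<Sum>z\<in>slice A (insert j J) k. F z) = (\<Sum>a\<in>A. \<Sum>z\<in>slice A J (k(j := a)). F z)"
proof -
  have "z j = a" if "z \<in> slice A J (k(j := a))" for z a
    using that assms(2) by (auto simp: slice_def)
  then have disjoint: "\<forall>a\<in>A. \<forall>b\<in>A. a \<noteq> b \<longrightarrow> slice A J (k(j := a)) \<inter> slice A J (k(j := b)) = {}"
    by blast
  have "slice A (insert j J) k = (\<Union>a\<in>A. slice A J (k(j := a)))"
    using assms(2) by (auto simp: slice_def; metis)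
  then show ?thesis
    using sum.UNION_disjoint[OF assms(1) _ disjoint, of F] by (simp add: finite_slice assms(1))
qed

lemma sum_slice_upd:
  assumes "j \<notin> J"
  shows "(\<Sum>z\<in>slice A J (k(j := a)). F z) = (\<Sum>z\<in>slice A J k. F (z(j := a)))"
proof (rule sum.reindex_bij_witness[of _ "\<lambda>z. z(j := a)" "\<lambda>z. z(j := k j)"])
  fix z assume z: "z \<in> slice A J (k(j := a))"
  then have "z j = a" using assms by (auto simp: slice_def)
  then show "z(j := k j, j := a) = z" "F (z(j := k j, j := a)) = F z" by (auto simp: fun_upd_idem)
  show "z(j := k j) \<in> slice A J k" using z assms by (auto simp: slice_def)
next
  fix z assume z: "z \<in> slice A J k"
  then have "z j = k j" using assms by (auto simp: slice_def)
  then show "z(j := a, j := k j) = z" by (auto simp: fun_upd_idem)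
  show "z(j := a) \<in> slice A J (k(j := a))" using z assms by (auto simp: slice_def)
qed

text \<open>Coordinates are summed out one at a time. Summing over coordinate \<open>j\<close> does not affect \<open>G j\<close>,
  and the Hoelder inequality with \<open>n - 1\<close> factors applies to the others.\<close>

lemma Loomis_Whitney_slice:
  fixes G :: "'n::finite \<Rightarrow> ('n \<Rightarrow> 'a) \<Rightarrow> real"
  assumes n: "CARD('n) \<ge> 2" and A: "finite A"
    and G_nonneg: "\<And>i z. 0 \<le> G i z" and G_indep: "\<And>i z a. G i (z(i := a)) = G i z"
  shows "(\<Sum>z\<in>slice A J k. (\<Prod>i\<in>UNIV. G i z) powr (1 / (CARD('n) - 1))) \<le>
    (\<Prod>i\<in>UNIV. \<Sum>z\<in>slice A (J - {i}) k. G i z) powr (1 / (CARD('n) - 1))"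
  using finite[of J]
proof (induction J arbitrary: k rule: finite_induct)
  case empty
  have "slice A {} k = {k}" by (auto simp: slice_def)
  then show ?case by simp
next
  case (insert j J)
  let ?c = "1 / real (CARD('n) - 1)"
  let ?H = "\<lambda>i k. \<Sum>z\<in>slice A (J - {i}) k. G i z"
  have H_nonneg: "0 \<le> ?H i k" for i k by (intro sum_nonneg G_nonneg)
  have card: "card (UNIV - {j}) = CARD('n) - 1" by (simp add: card_Diff_singleton)
  then have ne: "UNIV - {j} \<noteq> {}" using n by (intro notI) simp
  have split: "(\<Prod>i\<in>UNIV. f i) = f j * (\<Prod>i\<in>UNIV - {j}. f i)" for f :: "'n \<Rightarrow> real"
    by (rule prod.remove) auto
  have H_j: "?H j (k(j := a)) = ?H j k" for a
    using sum_slice_upd[of j "J - {j}" "G j" A k a] G_indep by simp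
  have "(\<Sum>z\<in>slice A (insert j J) k. (\<Prod>i\<in>UNIV. G i z) powr ?c) \<le>
      (\<Sum>a\<in>A. (\<Prod>i\<in>UNIV. ?H i (k(j := a))) powr ?c)"
    unfolding sum_slice_insert[OF A insert.hyps(2)] by (intro sum_mono insert.IH)
  also have "\<dots> = ?H j k powr ?c * (\<Sum>a\<in>A. (\<Prod>i\<in>UNIV - {j}. ?H i (k(j := a))) powr ?c)"
    by (simp add: split H_j powr_mult sum_distrib_left)
  also have "\<dots> \<le> ?H j k powr ?c * (\<Prod>i\<in>UNIV - {j}. \<Sum>a\<in>A. ?H i (k(j := a))) powr ?c"
    using Hoelder_sum_prod[of "UNIV - {j}" A "\<lambda>i a. ?H i (k(j := a))"] ne A H_nonneg
    unfolding card by (intro mult_left_mono) auto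
  also have "\<dots> = (?H j k * (\<Prod>i\<in>UNIV - {j}. \<Sum>a\<in>A. ?H i (k(j := a)))) powr ?c"
    by (simp add: powr_mult)
  also have "?H j k * (\<Prod>i\<in>UNIV - {j}. \<Sum>a\<in>A. ?H i (k(j := a))) =
      (\<Prod>i\<in>UNIV. \<Sum>z\<in>slice A (insert j J - {i}) k. G i z)"
    unfolding split using insert.hyps(2)
    by (intro arg_cong2[of _ _ _ _ "(*)"] prod.cong)
      (auto simp: insert_Diff_if sum_slice_insert[OF A])
  finally show ?case .
qed

lemma Loomis_Whitney:
  fixes f :: "'n::finite \<Rightarrow> ('n \<Rightarrow> 'a) \<Rightarrow> real"
  assumes n: "CARD('n) \<ge> 2" and A: "finite A" and f: "\<And>i z. 0 \<le> f i z"
  shows "(\<Sum>z\<in>UNIV \<rightarrow>\<^sub>E A. (\<Prod>i\<in>UNIV. \<Sum>c\<in>A. f i (z(i := c))) powr (1 / (CARD('n) - 1))) \<le>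
    (\<Prod>i\<in>UNIV. \<Sum>z\<in>UNIV \<rightarrow>\<^sub>E A. f i z) powr (1 / (CARD('n) - 1))"
proof -
  fix k :: "'n \<Rightarrow> 'a"
  have "(\<Sum>z\<in>slice A (UNIV - {i}) k. \<Sum>c\<in>A. f i (z(i := c))) = (\<Sum>z\<in>UNIV \<rightarrow>\<^sub>E A. f i z)" for i
  proof -
    have "(\<Sum>z\<in>slice A (UNIV - {i}) k. \<Sum>c\<in>A. f i (z(i := c))) =
        (\<Sum>c\<in>A. \<Sum>z\<in>slice A (UNIV - {i}) (k(i := c)). f i z)"
      by (subst sum.swap) (simp add: sum_slice_upd)
    also have "\<dots> = (\<Sum>z\<in>slice A (insert i (UNIV - {i})) k. f i z)"
      by (rule sum_slice_insert[OF A, symmetric]) simp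
    finally show ?thesis by (simp add: insert_absorb slice_UNIV)
  qed
  then show ?thesis
    using Loomis_Whitney_slice[OF n A, of "\<lambda>i z. \<Sum>c\<in>A. f i (z(i := c))" UNIV k] f
    by (simp add: sum_nonneg slice_UNIV)
qed

lemma discrete_Gagliardo:
  fixes V a :: "('n::finite \<Rightarrow> 'a) \<Rightarrow> real" and f :: "'n \<Rightarrow> ('n \<Rightarrow> 'a) \<Rightarrow> real"
  assumes n: "CARD('n) \<ge> 2" and A: "finite A"
    and a: "\<And>z. 0 \<le> a z" and V: "\<And>z. 0 \<le> V z" and f: "\<And>i z. 0 \<le> f i z"
    and V_le: "\<And>i z. z \<in> UNIV \<rightarrow>\<^sub>E A \<Longrightarrow> V z \<le> (\<Sum>c\<in>A. f i (z(i := c)))"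
  shows "(\<Sum>z\<in>UNIV \<rightarrow>\<^sub>E A. a z * V z) \<le>
    ((\<Sum>z\<in>UNIV \<rightarrow>\<^sub>E A. a z ^ CARD('n)) * (\<Prod>i\<in>UNIV. \<Sum>z\<in>UNIV \<rightarrow>\<^sub>E A. f i z)) powr (1 / CARD('n))"
proof -
  let ?cube = "UNIV \<rightarrow>\<^sub>E A :: ('n \<Rightarrow> 'a) set"
  define m where "m = CARD('n) - 1"
  have m: "CARD('n) = Suc m" "0 < m" using n by (auto simp: m_def)
  define Q where "Q = (\<lambda>z. (\<Prod>i\<in>UNIV. \<Sum>c\<in>A. f i (z(i := c))) powr (1 / m))"
  have sum_Q: "(\<Sum>z\<in>?cube. Q z) ^ m \<le> (\<Prod>i\<in>UNIV. \<Sum>z\<in>?cube. f i z)"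
  proof -
    have "(\<Sum>z\<in>?cube. Q z) ^ m \<le> ((\<Prod>i\<in>UNIV. \<Sum>z\<in>?cube. f i z) powr (1 / m)) ^ m"
      using Loomis_Whitney[OF n A f] unfolding Q_def m_def
      by (intro power_mono sum_nonneg) auto
    then show ?thesis
      using f m(2) by (simp add: powr_inverse_power prod_nonneg sum_nonneg)
  qed
  have "(\<Sum>z\<in>?cube. a z * V z) \<le> (\<Sum>z\<in>?cube. (a z ^ Suc m * Q z ^ m) powr (1 / Suc m))"
  proof (rule sum_mono)
    fix z assume z: "z \<in> ?cube"
    have "V z ^ Suc m = (\<Prod>i\<in>(UNIV::'n set). V z)" by (simp add: m)
    also have "\<dots> \<le> (\<Prod>i\<in>UNIV. \<Sum>c\<in>A. f i (z(i := c)))"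
      using V V_le[OF z] by (intro prod_mono) auto
    also have "\<dots> = Q z ^ m"
      unfolding Q_def using f m(2) by (simp add: powr_inverse_power prod_nonneg sum_nonneg)
    finally have "(a z * V z) ^ Suc m \<le> a z ^ Suc m * Q z ^ m"
      unfolding power_mult_distrib using a[of z] by (intro mult_left_mono) auto
    then have "((a z * V z) ^ Suc m) powr (1 / Suc m) \<le> (a z ^ Suc m * Q z ^ m) powr (1 / Suc m)"
      using a V by (intro powr_mono2) auto
    then show "a z * V z \<le> (a z ^ Suc m * Q z ^ m) powr (1 / Suc m)"
      using power_powr_inverse[of "a z * V z" "Suc m"] a[of z] V[of z] by simp
  qed
  also have "\<dots> \<le> ((\<Sum>z\<in>?cube. a z ^ Suc m) * (\<Sum>z\<in>?cube. Q z) ^ m) powr (1 / Suc m)"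
    using A a by (intro Hoelder_sum_mult_power finite_PiE) (auto simp: Q_def)
  also have "\<dots> \<le> ((\<Sum>z\<in>?cube. a z ^ Suc m) * (\<Prod>i\<in>UNIV. \<Sum>z\<in>?cube. f i z)) powr (1 / Suc m)"
    using sum_Q a
    by (intro powr_mono2 mult_left_mono mult_nonneg_nonneg sum_nonneg zero_le_power)
      (auto simp: Q_def)
  finally show ?thesis unfolding m(1) .
qed

section \<open>Calculus on the mesh\<close>

lemma mesh_integral_add:
  "mesh_integral h W (\<lambda>x. f x + g x) = mesh_integral h W f + mesh_integral h W g"
  by (simp add: mesh_integral_def sum.distrib algebra_simps)

lemma mesh_integral_cmult: "mesh_integral h W (\<lambda>x. c * f x) = c * mesh_integral h W f"
  by (simp add: mesh_integral_def flip: sum_distrib_left)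

lemma mesh_integral_sum:
  "mesh_integral h W (\<lambda>x. \<Sum>i\<in>I. f i x) = (\<Sum>i\<in>I. mesh_integral h W (f i))"
  by (simp add: mesh_integral_def sum_distrib_left sum.swap[of _ W I])

lemma mesh_integral_cong:
  "(\<And>x. x \<in> W \<Longrightarrow> f x = g x) \<Longrightarrow> mesh_integral h W f = mesh_integral h W g"
  by (simp add: mesh_integral_def)

lemma mesh_integral_mono:
  "0 \<le> h \<Longrightarrow> (\<And>x. x \<in> W \<Longrightarrow> f x \<le> g x) \<Longrightarrow> mesh_integral h W f \<le> mesh_integral h W g"
  unfolding mesh_integral_def by (intro mult_left_mono sum_mono) auto

lemma mesh_integral_nonneg:
  "0 \<le> h \<Longrightarrow> (\<And>x. x \<in> W \<Longrightarrow> 0 \<le> f x) \<Longrightarrow> 0 \<le> mesh_integral h W f"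
  unfolding mesh_integral_def by (intro mult_nonneg_nonneg sum_nonneg) auto

lemma mesh_integral_abs:
  "0 \<le> h \<Longrightarrow> \<bar>mesh_integral h W f\<bar> \<le> mesh_integral h W (\<lambda>x. \<bar>f x\<bar>)"
  unfolding mesh_integral_def abs_mult by (auto intro: mult_left_mono sum_abs)

lemma mesh_integral_Cauchy_Schwarz:
  "(mesh_integral h W (\<lambda>x. f x * g x))\<^sup>2 \<le>
    mesh_integral h W (\<lambda>x. (f x)\<^sup>2) * mesh_integral h W (\<lambda>x. (g x)\<^sup>2)"
proof -
  have "(mesh_integral h W (\<lambda>x. f x * g x))\<^sup>2 \<le>
      (h ^ CARD('a))\<^sup>2 * ((\<Sum>x\<in>W. (f x)\<^sup>2) * (\<Sum>x\<in>W. (g x)\<^sup>2))"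
    unfolding mesh_integral_def power_mult_distrib
    by (intro mult_left_mono Cauchy_Schwarz_ineq_sum) auto
  also have "\<dots> = mesh_integral h W (\<lambda>x. (f x)\<^sup>2) * mesh_integral h W (\<lambda>x. (g x)\<^sup>2)"
    by (simp add: mesh_integral_def power2_eq_square mult_ac)
  finally show ?thesis .
qed

lemma L2_norm_square: "0 \<le> h \<Longrightarrow> (L2_norm h W f)\<^sup>2 = mesh_integral h W (\<lambda>x. (f x)\<^sup>2)"
  unfolding L2_norm_def by (simp add: mesh_integral_nonneg)

lemma finite_dual: "finite W \<Longrightarrow> finite (dual h i W)"
  by (simp add: dual_def)

lemma mesh_boundary_disjoint: "x \<in> mesh_boundary h \<Longrightarrow> x \<notin> primal_mesh h"
  by (auto simp: mesh_boundary_def)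

lemma Dh_diff: "Dh h i (\<lambda>x. f x - g x) = (\<lambda>x. Dh h i f x - Dh h i g x)"
  by (simp add: Dh_def diff_divide_distrib fun_eq_iff)

lemma Ah_diff: "Ah h i (\<lambda>x. f x - g x) = (\<lambda>x. Ah h i f x - Ah h i g x)"
  by (simp add: Ah_def diff_divide_distrib add_divide_distrib fun_eq_iff)

lemma Dh_mult: "Dh h i (\<lambda>x. f x * g x) y = Ah h i f y * Dh h i g y + Dh h i f y * Ah h i g y"
  by (cases "h = 0") (simp_all add: Dh_def Ah_def field_simps)

lemma Dh_power2: "Dh h i (\<lambda>x. (f x)\<^sup>2) y = 2 * Ah h i f y * Dh h i f y"
  using Dh_mult[of h i f f y] by (simp add: power2_eq_square)

lemma Ah_power2_le: "(Ah h i f y)\<^sup>2 \<le> Ah h i (\<lambda>x. (f x)\<^sup>2) y"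
proof -
  have "0 \<le> ((f (y + (h / 2) *\<^sub>R axis i 1) - f (y - (h / 2) *\<^sub>R axis i 1)) / 2)\<^sup>2" by simp
  then show ?thesis unfolding Ah_def by (simp add: power2_eq_square field_simps)
qed

lemma Ah_nonneg: "(\<And>x. 0 \<le> f x) \<Longrightarrow> 0 \<le> Ah h i f y"
  by (simp add: Ah_def)

lemma sum_shift_dual:
  fixes f F :: "real ^ 'n \<Rightarrow> real"
  assumes W: "finite W" and f: "\<And>x. x \<in> dual h i (dual h i W) - W \<Longrightarrow> f x = 0"
    and s: "s = 1 \<or> s = -1"
  shows "(\<Sum>x\<in>W. f x * F (x + (s * h / 2) *\<^sub>R axis i 1)) =
    (\<Sum>y\<in>dual h i W. f (y - (s * h / 2) *\<^sub>R axis i 1) * F y)"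
proof -
  let ?t = "\<lambda>x. x + (s * h / 2) *\<^sub>R axis i 1 :: real ^ 'n"
  have "(\<Sum>x\<in>W. f x * F (?t x)) = (\<Sum>y\<in>?t ` W. f (y - (s * h / 2) *\<^sub>R axis i 1) * F y)"
    by (subst sum.reindex) (auto simp: inj_on_def)
  also have "\<dots> = (\<Sum>y\<in>dual h i W. f (y - (s * h / 2) *\<^sub>R axis i 1) * F y)"
  proof (rule sum.mono_neutral_left)
    show "?t ` W \<subseteq> dual h i W" using s by (auto simp: dual_def)
    show "\<forall>y\<in>dual h i W - ?t ` W. f (y - (s * h / 2) *\<^sub>R axis i 1) * F y = 0"
    proof
      fix y assume y: "y \<in> dual h i W - ?t ` W"
      let ?x = "y - (s * h / 2) *\<^sub>R axis i 1"
      have "?x \<notin> W" using y by (auto simp: image_iff algebra_simps)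
      moreover have "?x \<in> dual h i (dual h i W)"
        using y s by (auto simp: dual_def[of h i "dual h i W"])
      ultimately show "f ?x * F y = 0" using f by simp
    qed
  qed (use W finite_dual in auto)
  finally show ?thesis .
qed

lemma
  fixes f F :: "real ^ 'n \<Rightarrow> real"
  assumes W: "finite W" and f: "\<And>x. x \<in> dual h i (dual h i W) - W \<Longrightarrow> f x = 0"
  shows summation_by_parts_Dh:
      "mesh_integral h W (\<lambda>x. f x * Dh h i F x) =
        - mesh_integral h (dual h i W) (\<lambda>y. Dh h i f y * F y)"
    and summation_by_parts_Ah:
      "mesh_integral h W (\<lambda>x. f x * Ah h i F x) =
        mesh_integral h (dual h i W) (\<lambda>y. Ah h i f y * F y)"
proof -
  have plus: "(\<Sum>x\<in>W. f x * F (x + (h / 2) *\<^sub>R axis i 1)) =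
      (\<Sum>y\<in>dual h i W. f (y - (h / 2) *\<^sub>R axis i 1) * F y)"
    and minus: "(\<Sum>x\<in>W. f x * F (x - (h / 2) *\<^sub>R axis i 1)) =
      (\<Sum>y\<in>dual h i W. f (y + (h / 2) *\<^sub>R axis i 1) * F y)"
    using sum_shift_dual[OF W f, where s = 1 and F = F]
      sum_shift_dual[OF W f, where s = "-1" and F = F]
    by simp_all
  have "(\<Sum>x\<in>W. f x * Dh h i F x) = - (\<Sum>y\<in>dual h i W. Dh h i f y * F y)"
    using plus minus
    by (simp add: Dh_def sum_subtractf right_diff_distrib left_diff_distrib diff_divide_distrib
        flip: sum_divide_distrib)
  then show "mesh_integral h W (\<lambda>x. f x * Dh h i F x) =
      - mesh_integral h (dual h i W) (\<lambda>y. Dh h i f y * F y)"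
    by (simp add: mesh_integral_def)
  have "(\<Sum>x\<in>W. f x * Ah h i F x) = (\<Sum>y\<in>dual h i W. Ah h i f y * F y)"
    using plus minus
    by (simp add: Ah_def sum.distrib distrib_left distrib_right add_divide_distrib
        flip: sum_divide_distrib)
  then show "mesh_integral h W (\<lambda>x. f x * Ah h i F x) =
      mesh_integral h (dual h i W) (\<lambda>y. Ah h i f y * F y)"
    by (simp add: mesh_integral_def)
qed

definition grid :: "real \<Rightarrow> ('n \<Rightarrow> int) \<Rightarrow> real ^ 'n" where
  "grid h z = (\<chi> i. h * of_int (z i))"

definition grid_edge :: "real \<Rightarrow> 'n \<Rightarrow> ('n \<Rightarrow> int) \<Rightarrow> real ^ 'n" where
  "grid_edge h i z = grid h z + (h / 2) *\<^sub>R axis i 1"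

lemma inj_grid: "h \<noteq> 0 \<Longrightarrow> inj (grid h)"
  by (auto simp: inj_def grid_def vec_eq_iff)

lemma half_step_twice: "x + (h / 2) *\<^sub>R v + (h / 2) *\<^sub>R v = x + h *\<^sub>R v"
    "x - (h / 2) *\<^sub>R v - (h / 2) *\<^sub>R v = x - h *\<^sub>R (v :: real ^ 'n)"
  by (simp_all add: add.assoc diff_diff_eq flip: scaleR_left_distrib)

lemma grid_step: "grid h (z(i := z i + 1)) = grid h z + h *\<^sub>R axis i 1"
  by (simp add: grid_def vec_eq_iff axis_def algebra_simps)

lemma grid_edge_ends: "grid_edge h i z - (h / 2) *\<^sub>R axis i 1 = grid h z"
    "grid_edge h i z + (h / 2) *\<^sub>R axis i 1 = grid h (z(i := z i + 1))"
  by (simp_all add: grid_edge_def grid_step half_step_twice)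

lemma Dh_grid_edge: "Dh h i u (grid_edge h i z) = (u (grid h (z(i := z i + 1))) - u (grid h z)) / h"
  by (simp add: Dh_def grid_edge_ends)

lemma Ah_grid_edge: "Ah h i u (grid_edge h i z) = (u (grid h (z(i := z i + 1))) + u (grid h z)) / 2"
  by (simp add: Ah_def grid_edge_ends)

lemma grid_edge_in_dual:
  assumes "grid h z \<in> W \<or> grid h (z(i := z i + 1)) \<in> W"
  shows "grid_edge h i z \<in> dual h i W"
proof -
  have "grid_edge h i z = grid h (z(i := z i + 1)) - (h / 2) *\<^sub>R axis i 1"
    using grid_edge_ends(2)[of h i z] by (metis add_diff_cancel_right')
  then show ?thesis using assms by (auto simp: dual_def grid_edge_def)
qed

locale uniform_mesh =
  fixes N :: nat and h :: real
  assumes h_eq: "h = 1 / (real N + 1)"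
begin

abbreviation primal_int :: "(real ^ 'n \<Rightarrow> real) \<Rightarrow> real" where
  "primal_int \<equiv> mesh_integral h (primal_mesh h)"

abbreviation dual_int :: "'n \<Rightarrow> (real ^ 'n \<Rightarrow> real) \<Rightarrow> real" where
  "dual_int i \<equiv> mesh_integral h (dual h i (primal_mesh h))"

lemma h_pos: "0 < h" and h_nonneg: "0 \<le> h"
  by (simp_all add: h_eq)

lemma grid_in_primal_mesh_iff: "grid h z \<in> primal_mesh h \<longleftrightarrow> (\<forall>i. z i \<in> {1..int N})"
proof -
  have "0 < h * of_int k \<and> h * of_int k < 1 \<longleftrightarrow> k \<in> {1..int N}" for k :: int
  proof -
    have "h * of_int k < 1 \<longleftrightarrow> (of_int k :: real) < of_int (int N + 1)"
      unfolding h_eq by (simp add: field_simps)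
    moreover have "0 < h * of_int k \<longleftrightarrow> 0 < k" using h_pos by (simp add: zero_less_mult_iff)
    ultimately show ?thesis unfolding of_int_less_iff by auto
  qed
  then show ?thesis by (auto simp: primal_mesh_def unit_cube_def grid_def)
qed

lemma primal_mesh_eq_grid: "primal_mesh h = grid h ` (UNIV \<rightarrow>\<^sub>E {1..int N})"
proof
  show "primal_mesh h \<subseteq> grid h ` (UNIV \<rightarrow>\<^sub>E {1..int N})"
  proof
    fix x :: "real ^ 'n" assume x: "x \<in> primal_mesh h"
    then have "\<forall>i. \<exists>k::int. x $ i = h * of_int k" by (simp add: primal_mesh_def)
    then obtain k where "\<And>i. x $ i = h * of_int (k i)" by metis
    then have "x = grid h k" by (simp add: grid_def vec_eq_iff)
    then show "x \<in> grid h ` (UNIV \<rightarrow>\<^sub>E {1..int N})"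
      using x grid_in_primal_mesh_iff[of k] by auto
  qed
qed (auto simp: grid_in_primal_mesh_iff PiE_iff)

lemma finite_primal_mesh: "finite (primal_mesh h)"
  unfolding primal_mesh_eq_grid by (intro finite_imageI finite_PiE) auto

lemma primal_mesh_nonempty: "0 < N \<Longrightarrow> primal_mesh h \<noteq> {}"
  unfolding primal_mesh_eq_grid by (auto simp: PiE_eq_empty_iff)

lemma card_primal_mesh: "card (primal_mesh h :: (real ^ 'n) set) = N ^ CARD('n)"
  unfolding primal_mesh_eq_grid
  using h_pos by (simp add: card_image inj_on_subset[OF inj_grid] card_funcsetE)

lemma primal_int_one_le: "primal_int (\<lambda>_ :: real ^ 'n. 1) \<le> 1"
proof -
  have "primal_int (\<lambda>_ :: real ^ 'n. 1) = (h * real N) ^ CARD('n)"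
    by (simp add: mesh_integral_def card_primal_mesh power_mult_distrib)
  also have "\<dots> \<le> 1" unfolding h_eq by (intro power_le_one) auto
  finally show ?thesis .
qed

lemma dual_int_one_le: "dual_int i (\<lambda>_ :: real ^ 'n. 1) \<le> 2"
proof -
  have "card (dual h i (primal_mesh h :: (real ^ 'n) set)) \<le>
      2 * card (primal_mesh h :: (real ^ 'n) set)"
    unfolding dual_def mult_2
    by (intro order_trans[OF card_Un_le] add_mono card_image_le finite_primal_mesh)
  then have "real (card (dual h i (primal_mesh h :: (real ^ 'n) set))) \<le>
      2 * real (card (primal_mesh h :: (real ^ 'n) set))"
    by linarith
  then have "dual_int i (\<lambda>_ :: real ^ 'n. 1) \<le> 2 * primal_int (\<lambda>_ :: real ^ 'n. 1)"
    using h_nonneg by (simp add: mesh_integral_def mult.left_commute[of 2] mult_left_mono)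
  then show ?thesis using primal_int_one_le[where 'n = 'n] by linarith
qed

lemma primal_int_bounded_mult_power2_le:
  fixes \<phi> f :: "real ^ 'n \<Rightarrow> real"
  assumes "\<And>x. \<bar>\<phi> x\<bar> \<le> 1"
  shows "(primal_int (\<lambda>x. \<phi> x * f x))\<^sup>2 \<le> primal_int (\<lambda>x. (f x)\<^sup>2)"
proof -
  have "primal_int (\<lambda>x. (\<phi> x)\<^sup>2) \<le> primal_int (\<lambda>_ :: real ^ 'n. 1)"
    using assms by (intro mesh_integral_mono h_nonneg) (auto simp: abs_square_le_1)
  then have "primal_int (\<lambda>x. (\<phi> x)\<^sup>2) * primal_int (\<lambda>x. (f x)\<^sup>2) \<le> 1 * primal_int (\<lambda>x. (f x)\<^sup>2)"
    using primal_int_one_le[where 'n = 'n]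
    by (intro mult_right_mono mesh_integral_nonneg h_nonneg) auto
  then show ?thesis
    using mesh_integral_Cauchy_Schwarz[of h "primal_mesh h" \<phi> f] by simp
qed

lemma dual_subset_unit_cube: "dual h i (primal_mesh h) \<subseteq> (unit_cube :: (real ^ 'n) set)"
proof
  fix y :: "real ^ 'n" assume "y \<in> dual h i (primal_mesh h)"
  then obtain z s where z: "\<And>j. z j \<in> {1..int N}" and s: "s = h / 2 \<or> s = - h / 2"
    and y: "y = grid h z + s *\<^sub>R axis i 1"
    unfolding dual_def primal_mesh_eq_grid PiE_iff by fastforce
  have "0 < y $ j \<and> y $ j < 1" for j
  proof -
    have "1 \<le> real_of_int (z j)" "real_of_int (z j) \<le> real N" using z[of j] by auto
    then have "h * 1 \<le> h * of_int (z j)" "h * of_int (z j) \<le> h * real N"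
      using h_pos by (simp_all del: mult_1_right)
    moreover have "h * real N = 1 - h" unfolding h_eq by (simp add: field_simps)
    moreover have "y $ j = h * of_int (z j) + (if j = i then s else 0)"
      unfolding y grid_def by (simp add: axis_def)
    moreover have "- h / 2 \<le> (if j = i then s else 0)" "(if j = i then s else 0) \<le> h / 2"
      using s h_pos by auto
    ultimately show ?thesis using h_pos by linarith
  qed
  then show "y \<in> unit_cube" by (simp add: unit_cube_def)
qed

lemma sum_primal_mesh_eq_grid:
  fixes F :: "real ^ 'n \<Rightarrow> real"
  assumes "\<And>x. x \<notin> primal_mesh h \<Longrightarrow> F x = 0"
  shows "(\<Sum>x\<in>primal_mesh h. F x) = (\<Sum>z\<in>UNIV \<rightarrow>\<^sub>E {0..int N}. F (grid h z))"
proof -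
  have "(\<Sum>x\<in>primal_mesh h. F x) = (\<Sum>z\<in>UNIV \<rightarrow>\<^sub>E {1..int N}. F (grid h z))"
    unfolding primal_mesh_eq_grid using h_pos
    by (subst sum.reindex) (auto intro: inj_on_subset[OF inj_grid])
  also have "\<dots> = (\<Sum>z\<in>UNIV \<rightarrow>\<^sub>E {0..int N}. F (grid h z))"
  proof (rule sum.mono_neutral_left)
    show "\<forall>z\<in>(UNIV \<rightarrow>\<^sub>E {0..int N}) - (UNIV \<rightarrow>\<^sub>E {1..int N}). F (grid h z) = 0"
    proof
      fix z :: "'n \<Rightarrow> int" assume "z \<in> (UNIV \<rightarrow>\<^sub>E {0..int N}) - (UNIV \<rightarrow>\<^sub>E {1..int N})"
      then have "grid h z \<notin> primal_mesh h"
        unfolding grid_in_primal_mesh_iff by (simp add: PiE_iff del: atLeastAtMost_iff)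
      then show "F (grid h z) = 0" by (rule assms)
    qed
  qed (auto intro!: finite_PiE PiE_mono)
  finally show ?thesis .
qed

lemma grid_value_le_sum_differences:
  fixes V :: "real ^ 'n \<Rightarrow> real"
  assumes V: "\<And>x. x \<notin> primal_mesh h \<Longrightarrow> V x = 0" and z: "z \<in> UNIV \<rightarrow>\<^sub>E {0..int N}"
  shows "V (grid h z) \<le> (\<Sum>c\<in>{0..int N}. \<bar>V (grid h (z(i := c + 1))) - V (grid h (z(i := c)))\<bar>)"
proof -
  let ?F = "\<lambda>c. V (grid h (z(i := int c)))"
  define m where "m = nat (z i)"
  have "z i \<in> {0..int N}" using z by auto
  then have m: "z i = int m" "m \<le> N" by (auto simp: m_def)
  have "?F 0 = 0" using grid_in_primal_mesh_iff[of "z(i := 0)"] by (intro V) auto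
  moreover have "?F m = V (grid h z)" using m(1) by (simp add: fun_upd_idem)
  ultimately have "V (grid h z) = (\<Sum>c<m. ?F (Suc c) - ?F c)"
    unfolding sum_lessThan_telescope[of ?F] by simp
  also have "\<dots> \<le> (\<Sum>c<m. \<bar>V (grid h (z(i := int c + 1))) - V (grid h (z(i := int c)))\<bar>)"
    by (intro sum_mono) (simp add: add.commute)
  also have "\<dots> = (\<Sum>c\<in>int ` {..<m}. \<bar>V (grid h (z(i := c + 1))) - V (grid h (z(i := c)))\<bar>)"
    by (subst sum.reindex) auto
  also have "\<dots> \<le> (\<Sum>c\<in>{0..int N}. \<bar>V (grid h (z(i := c + 1))) - V (grid h (z(i := c)))\<bar>)"
    using m by (intro sum_mono2) auto
  finally show ?thesis .
qed

lemma sum_grid_differences_le: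
  fixes V :: "real ^ 'n \<Rightarrow> real"
  assumes V: "\<And>x. x \<notin> primal_mesh h \<Longrightarrow> V x = 0" and Z: "finite Z"
  shows "(\<Sum>z\<in>Z. \<bar>V (grid h (z(i := z i + 1))) - V (grid h z)\<bar>) \<le>
    h * (\<Sum>y\<in>dual h i (primal_mesh h). \<bar>Dh h i V y\<bar>)"
proof -
  let ?d = "\<lambda>z. \<bar>V (grid h (z(i := z i + 1))) - V (grid h z)\<bar>"
  let ?Z = "{z\<in>Z. ?d z \<noteq> 0}"
  have "(\<Sum>z\<in>Z. ?d z) = (\<Sum>z\<in>?Z. ?d z)"
    using Z by (intro sum.mono_neutral_right) auto
  also have "\<dots> = (\<Sum>z\<in>?Z. h * \<bar>Dh h i V (grid_edge h i z)\<bar>)"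
    using h_pos by (simp add: Dh_grid_edge)
  also have "\<dots> = (\<Sum>y\<in>grid_edge h i ` ?Z. h * \<bar>Dh h i V y\<bar>)"
    using inj_grid[of h] h_pos
    by (subst sum.reindex) (auto simp: inj_on_def inj_def grid_edge_def)
  also have "\<dots> \<le> (\<Sum>y\<in>dual h i (primal_mesh h). h * \<bar>Dh h i V y\<bar>)"
  proof (rule sum_mono2)
    show "grid_edge h i ` ?Z \<subseteq> dual h i (primal_mesh h)"
      using V by (force intro: grid_edge_in_dual)
  qed (use finite_dual[OF finite_primal_mesh] h_pos in auto)
  finally show ?thesis by (simp add: sum_distrib_left)
qed

lemma mesh_Gagliardo:
  fixes V a :: "real ^ 'n \<Rightarrow> real"
  assumes n: "CARD('n) \<ge> 2" and a: "\<And>x. 0 \<le> a x"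
    and V: "\<And>x. 0 \<le> V x" "\<And>x. x \<notin> primal_mesh h \<Longrightarrow> V x = 0"
  shows "primal_int (\<lambda>x. a x * V x) \<le>
    (primal_int (\<lambda>x. a x ^ CARD('n)) * (\<Prod>i\<in>UNIV. dual_int i (\<lambda>y. \<bar>Dh h i V y\<bar>)))
      powr (1 / CARD('n))"
proof -
  let ?n = "CARD('n)"
  let ?cube = "UNIV \<rightarrow>\<^sub>E {0..int N} :: ('n \<Rightarrow> int) set"
  define a' where "a' = (\<lambda>x. if x \<in> primal_mesh h then a x else 0)"
  define D where "D = (\<lambda>i. \<Sum>y\<in>dual h i (primal_mesh h). \<bar>Dh h i V y\<bar>)"
  let ?d = "\<lambda>i z. \<bar>V (grid h (z(i := z i + 1))) - V (grid h z)\<bar>"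
  have a': "0 \<le> a' x" for x using a by (simp add: a'_def)
  have finite_cube: "finite ?cube" by (intro finite_PiE) auto
  have "(\<Sum>x\<in>primal_mesh h. a x * V x) = (\<Sum>z\<in>?cube. a' (grid h z) * V (grid h z))"
    using V(2) by (subst sum_primal_mesh_eq_grid) (auto simp: a'_def intro!: sum.cong)
  also have "\<dots> \<le> ((\<Sum>z\<in>?cube. a' (grid h z) ^ ?n) * (\<Prod>i\<in>UNIV. \<Sum>z\<in>?cube. ?d i z)) powr (1 / ?n)"
    using grid_value_le_sum_differences[of V, OF V(2)] V(1) a'
    by (intro discrete_Gagliardo[OF n]) auto
  also have "\<dots> \<le> ((\<Sum>z\<in>?cube. a' (grid h z) ^ ?n) * (\<Prod>i\<in>UNIV. h * D i)) powr (1 / ?n)"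
    using sum_grid_differences_le[of V ?cube, OF V(2) finite_cube] a' unfolding D_def
    by (intro powr_mono2 mult_left_mono prod_mono conjI mult_nonneg_nonneg sum_nonneg prod_nonneg)
      auto
  also have "(\<Sum>z\<in>?cube. a' (grid h z) ^ ?n) = (\<Sum>x\<in>primal_mesh h. a x ^ ?n)"
    by (subst sum_primal_mesh_eq_grid[symmetric]) (auto simp: a'_def)
  finally have "primal_int (\<lambda>x. a x * V x) \<le>
      h ^ ?n * ((\<Sum>x\<in>primal_mesh h. a x ^ ?n) * (\<Prod>i\<in>UNIV. h * D i)) powr (1 / ?n)"
    unfolding mesh_integral_def using h_nonneg by (intro mult_left_mono) auto
  also have "\<dots> =
      ((h ^ ?n) ^ ?n * ((\<Sum>x\<in>primal_mesh h. a x ^ ?n) * (\<Prod>i\<in>UNIV. h * D i))) powr (1 / ?n)"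
    using power_powr_inverse[of "h ^ ?n" ?n] h_nonneg by (simp add: powr_mult)
  also have "(h ^ ?n) ^ ?n * ((\<Sum>x\<in>primal_mesh h. a x ^ ?n) * (\<Prod>i\<in>UNIV. h * D i)) =
      primal_int (\<lambda>x. a x ^ ?n) * (\<Prod>i\<in>UNIV. dual_int i (\<lambda>y. \<bar>Dh h i V y\<bar>))"
    by (simp add: mesh_integral_def D_def prod.distrib mult_ac)
  finally show ?thesis .
qed

end

section \<open>Localized estimate of the drift\<close>

lemma weighted_Young:
  fixes x y \<epsilon> :: real
  assumes "0 < \<epsilon>"
  shows "2 * x * y \<le> \<epsilon> * x\<^sup>2 + y\<^sup>2 / \<epsilon>"
proof -
  have "0 \<le> (\<epsilon> * x - y)\<^sup>2 / \<epsilon>" using assms by simp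
  also have "\<dots> = \<epsilon> * x\<^sup>2 + y\<^sup>2 / \<epsilon> - 2 * x * y"
    using assms by (simp add: power2_eq_square field_simps)
  finally show ?thesis by simp
qed

lemma diffusion_cross_term_bound:
  fixes q D g d a A c0 \<epsilon> :: real
  assumes "\<bar>D\<bar> \<le> 2 * \<bar>a\<bar>" "a\<^sup>2 \<le> A" "0 \<le> g" "g \<le> c0" "0 < \<epsilon>"
  shows "\<bar>q * (D * (g * d))\<bar> \<le> \<epsilon> * (A * d\<^sup>2) + c0\<^sup>2 / \<epsilon> * q\<^sup>2"
proof -
  have "\<bar>q * (D * (g * d))\<bar> = \<bar>q\<bar> * (\<bar>D\<bar> * (g * \<bar>d\<bar>))" using assms by (simp add: abs_mult)
  also have "\<dots> \<le> \<bar>q\<bar> * ((2 * \<bar>a\<bar>) * (c0 * \<bar>d\<bar>))"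
    using assms by (intro mult_left_mono mult_mono) auto
  also have "\<dots> = 2 * (\<bar>a\<bar> * \<bar>d\<bar>) * (c0 * \<bar>q\<bar>)" by simp
  also have "\<dots> \<le> \<epsilon> * (\<bar>a\<bar> * \<bar>d\<bar>)\<^sup>2 + (c0 * \<bar>q\<bar>)\<^sup>2 / \<epsilon>" by (rule weighted_Young) fact
  also have "\<dots> = \<epsilon> * (a\<^sup>2 * d\<^sup>2) + c0\<^sup>2 / \<epsilon> * q\<^sup>2" by (simp add: power_mult_distrib)
  also have "\<dots> \<le> \<epsilon> * (A * d\<^sup>2) + c0\<^sup>2 / \<epsilon> * q\<^sup>2"
    using assms by (intro add_right_mono mult_left_mono mult_right_mono) auto
  finally show ?thesis .
qed

lemma advection_term_bound:
  fixes q c \<beta> A R \<epsilon> :: real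
  assumes "0 \<le> c" "c \<le> 1" "\<bar>\<beta>\<bar> \<le> R" "0 < \<epsilon>"
  shows "\<bar>q * (c\<^sup>2 * (\<beta> * A))\<bar> \<le> \<epsilon> * (c\<^sup>2 * A\<^sup>2) + R\<^sup>2 / \<epsilon> * q\<^sup>2"
proof -
  have "\<bar>q * (c\<^sup>2 * (\<beta> * A))\<bar> = (c * \<bar>A\<bar>) * ((c * \<bar>\<beta>\<bar>) * \<bar>q\<bar>)"
    using assms by (simp add: abs_mult power2_eq_square)
  also have "\<dots> \<le> (c * \<bar>A\<bar>) * ((1 * R) * \<bar>q\<bar>)"
    using assms by (intro mult_left_mono mult_right_mono mult_mono) auto
  also have "\<dots> \<le> 2 * (c * \<bar>A\<bar>) * (R * \<bar>q\<bar>)" using assms by simp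
  also have "\<dots> \<le> \<epsilon> * (c * \<bar>A\<bar>)\<^sup>2 + (R * \<bar>q\<bar>)\<^sup>2 / \<epsilon>" by (rule weighted_Young) fact
  finally show ?thesis by (simp add: power_mult_distrib)
qed

definition (in uniform_mesh) localized_form ::
    "(real ^ 'n \<Rightarrow> real) \<Rightarrow> real \<Rightarrow> (real ^ 'n \<Rightarrow> real) \<Rightarrow> (real ^ 'n \<Rightarrow> real) \<Rightarrow> real" where
  "localized_form \<phi> \<theta> f g = primal_int (\<lambda>x. \<phi> x * f x) * primal_int (\<lambda>x. \<phi> x * g x)
     - \<theta> * primal_int (\<lambda>x. \<phi> x * f x * g x)"

locale localized_drift = uniform_mesh N h for N h +
  fixes c0 R K :: real and \<zeta> v :: "real ^ 'n \<Rightarrow> real"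
    and \<gamma> :: "'n \<Rightarrow> real ^ 'n \<Rightarrow> real" and b1 :: "'n \<Rightarrow> real ^ 'n \<Rightarrow> real" and b2 :: "real ^ 'n \<Rightarrow> real"
  assumes dim_ge_2: "CARD('n) \<ge> 2" and c0_pos: "0 < c0" and K_pos: "0 < K"
    and \<zeta>_range: "\<And>x. 0 \<le> \<zeta> x" "\<And>x. \<zeta> x \<le> 1"
    and \<zeta>_boundary: "\<And>x. x \<in> mesh_boundary h \<Longrightarrow> \<zeta> x = 0"
    and \<zeta>_Lipschitz: "\<And>i y. \<bar>Dh h i \<zeta> y\<bar> \<le> 1"
    and v_outside: "\<And>x. x \<notin> primal_mesh h \<Longrightarrow> v x = 0"
    and \<gamma>_bounds: "\<And>i y. y \<in> dual h i (primal_mesh h) \<Longrightarrow> 1 / c0 \<le> \<gamma> i y \<and> \<gamma> i y \<le> c0"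
    and b1_bound: "\<And>i x. x \<in> primal_mesh h \<Longrightarrow> \<bar>b1 i x\<bar> \<le> R"
    and b2_Ln: "mesh_integral h (primal_mesh h) (\<lambda>x. \<bar>b2 x\<bar> ^ CARD('n)) \<le> K ^ CARD('n)"
    and b2_L2: "mesh_integral h (primal_mesh h) (\<lambda>x. (b2 x)\<^sup>2) \<le> K\<^sup>2"
begin

abbreviation \<phi> :: "real ^ 'n \<Rightarrow> real" where
  "\<phi> \<equiv> \<lambda>x. (\<zeta> x)\<^sup>2"

definition edge_energy :: "'n \<Rightarrow> real" where
  "edge_energy i = dual_int i (\<lambda>y. Ah h i \<phi> y * (Dh h i v y)\<^sup>2)"

definition energy :: real where
  "energy = (\<Sum>i\<in>UNIV. edge_energy i)"

definition mass :: real where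
  "mass = primal_int (\<lambda>x. (v x)\<^sup>2)"

lemma edge_energy_nonneg: "0 \<le> edge_energy i"
  unfolding edge_energy_def
  by (intro mesh_integral_nonneg h_nonneg mult_nonneg_nonneg Ah_nonneg) auto

lemma edge_energy_le_energy: "edge_energy i \<le> energy"
  unfolding energy_def by (rule member_le_sum) (auto simp: edge_energy_nonneg)

lemma energy_nonneg: "0 \<le> energy"
  unfolding energy_def by (intro sum_nonneg edge_energy_nonneg)

lemma mass_nonneg: "0 \<le> mass"
  unfolding mass_def by (intro mesh_integral_nonneg h_nonneg) auto

lemma summation_by_parts_boundary:
  assumes "\<And>x. x \<in> mesh_boundary h \<Longrightarrow> f x = 0"
  shows "primal_int (\<lambda>x. f x * Dh h i F x) = - dual_int i (\<lambda>y. Dh h i f y * F y)"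
    and "primal_int (\<lambda>x. f x * Ah h i F x) = dual_int i (\<lambda>y. Ah h i f y * F y)"
  using assms
  by (intro summation_by_parts_Dh summation_by_parts_Ah finite_primal_mesh;
      auto simp: mesh_boundary_def)+

lemma dual_int_Ah_power2_le:
  assumes "\<And>x. x \<notin> primal_mesh h \<Longrightarrow> u x = 0"
  shows "dual_int i (\<lambda>y. (Ah h i u y)\<^sup>2) \<le> primal_int (\<lambda>x. (u x)\<^sup>2)"
proof -
  have "dual_int i (\<lambda>y. (Ah h i u y)\<^sup>2) \<le> dual_int i (\<lambda>y. Ah h i (\<lambda>x. (u x)\<^sup>2) y * 1)"
    by (intro mesh_integral_mono h_nonneg) (simp add: Ah_power2_le)
  also have "\<dots> = primal_int (\<lambda>x. (u x)\<^sup>2 * Ah h i (\<lambda>_. 1) x)"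
    by (rule summation_by_parts_boundary(2)[symmetric])
      (use assms mesh_boundary_disjoint in auto)
  finally show ?thesis by (simp add: Ah_def)
qed

lemma primal_int_Ah_Dh_power2_le: "primal_int (\<lambda>x. \<phi> x * (Ah h i (Dh h i v) x)\<^sup>2) \<le> edge_energy i"
proof -
  have "primal_int (\<lambda>x. \<phi> x * (Ah h i (Dh h i v) x)\<^sup>2) \<le>
      primal_int (\<lambda>x. \<phi> x * Ah h i (\<lambda>y. (Dh h i v y)\<^sup>2) x)"
    by (intro mesh_integral_mono h_nonneg mult_left_mono Ah_power2_le) auto
  also have "\<dots> = edge_energy i" unfolding edge_energy_def
    by (rule summation_by_parts_boundary(2)) (simp add: \<zeta>_boundary)
  finally show ?thesis .
qed

lemma abs_Dh_cutoff_le: "\<bar>Dh h i \<phi> y\<bar> \<le> 2 * \<bar>Ah h i \<zeta> y\<bar>"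
  using \<zeta>_Lipschitz[of i y] by (simp add: Dh_power2 abs_mult mult_left_le)

lemma \<gamma>_nonneg: "y \<in> dual h i (primal_mesh h) \<Longrightarrow> 0 \<le> \<gamma> i y"
  using \<gamma>_bounds[of y i] c0_pos by (meson divide_nonneg_pos order_trans zero_le_one)

lemma primal_int_drift:
  "primal_int (\<lambda>x. \<psi> x * drift h \<gamma> b1 b2 v x) =
    (\<Sum>i\<in>UNIV. primal_int (\<lambda>x. \<psi> x * Dh h i (\<lambda>y. \<gamma> i y * Dh h i v y) x))
    + (\<Sum>i\<in>UNIV. primal_int (\<lambda>x. \<psi> x * (b1 i x * Ah h i (Dh h i v) x)))
    + primal_int (\<lambda>x. \<psi> x * (b2 x * v x))"
  unfolding drift_def distrib_left mesh_integral_add sum_distrib_left mesh_integral_sum by simp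

lemma diffusion_pairing_bound:
  assumes \<epsilon>: "0 < \<epsilon>"
  shows "\<bar>q * primal_int (\<lambda>x. \<phi> x * Dh h i (\<lambda>y. \<gamma> i y * Dh h i v y) x)\<bar> \<le>
    \<epsilon> * edge_energy i + 2 * c0\<^sup>2 / \<epsilon> * q\<^sup>2"
proof -
  let ?flux = "\<lambda>y. q * (Dh h i \<phi> y * (\<gamma> i y * Dh h i v y))"
  have "q * primal_int (\<lambda>x. \<phi> x * Dh h i (\<lambda>y. \<gamma> i y * Dh h i v y) x) = - dual_int i ?flux"
    unfolding mesh_integral_cmult
    by (subst summation_by_parts_boundary(1)) (auto simp: \<zeta>_boundary)
  then have "\<bar>q * primal_int (\<lambda>x. \<phi> x * Dh h i (\<lambda>y. \<gamma> i y * Dh h i v y) x)\<bar> \<le>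
      dual_int i (\<lambda>y. \<bar>?flux y\<bar>)"
    using mesh_integral_abs[OF h_nonneg, of "dual h i (primal_mesh h)" ?flux] by simp
  also have "\<dots> \<le> dual_int i (\<lambda>y. \<epsilon> * (Ah h i \<phi> y * (Dh h i v y)\<^sup>2) + c0\<^sup>2 / \<epsilon> * q\<^sup>2 * 1)"
    using \<gamma>_bounds \<gamma>_nonneg \<epsilon> diffusion_cross_term_bound[OF abs_Dh_cutoff_le Ah_power2_le]
    by (intro mesh_integral_mono h_nonneg) auto
  also have "\<dots> = \<epsilon> * edge_energy i + c0\<^sup>2 / \<epsilon> * q\<^sup>2 * dual_int i (\<lambda>_ :: real ^ 'n. 1)"
    unfolding mesh_integral_add mesh_integral_cmult edge_energy_def ..
  also have "\<dots> \<le> \<epsilon> * edge_energy i + c0\<^sup>2 / \<epsilon> * q\<^sup>2 * 2"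
    using \<epsilon> by (intro add_left_mono mult_left_mono dual_int_one_le) auto
  finally show ?thesis by (simp add: mult_ac)
qed

lemma advection_pairing_bound:
  assumes \<epsilon>: "0 < \<epsilon>"
  shows "\<bar>q * primal_int (\<lambda>x. \<phi> x * (b1 i x * Ah h i (Dh h i v) x))\<bar> \<le>
    \<epsilon> * edge_energy i + R\<^sup>2 / \<epsilon> * q\<^sup>2"
proof -
  have "\<bar>q * primal_int (\<lambda>x. \<phi> x * (b1 i x * Ah h i (Dh h i v) x))\<bar> \<le>
      primal_int (\<lambda>x. \<bar>q * (\<phi> x * (b1 i x * Ah h i (Dh h i v) x))\<bar>)"
    unfolding mesh_integral_cmult[symmetric] by (rule mesh_integral_abs[OF h_nonneg])
  also have "\<dots> \<le> primal_int (\<lambda>x. \<epsilon> * (\<phi> x * (Ah h i (Dh h i v) x)\<^sup>2) + R\<^sup>2 / \<epsilon> * q\<^sup>2 * 1)"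
    using advection_term_bound[OF \<zeta>_range b1_bound \<epsilon>] by (intro mesh_integral_mono h_nonneg) auto
  also have "\<dots> = \<epsilon> * primal_int (\<lambda>x. \<phi> x * (Ah h i (Dh h i v) x)\<^sup>2)
      + R\<^sup>2 / \<epsilon> * q\<^sup>2 * primal_int (\<lambda>_ :: real ^ 'n. 1)"
    unfolding mesh_integral_add mesh_integral_cmult ..
  also have "\<dots> \<le> \<epsilon> * edge_energy i + R\<^sup>2 / \<epsilon> * q\<^sup>2 * 1"
    using \<epsilon> by (intro add_mono mult_left_mono primal_int_one_le primal_int_Ah_Dh_power2_le) auto
  finally show ?thesis by simp
qed

lemma potential_pairing_bound:
  "\<bar>q * primal_int (\<lambda>x. \<phi> x * (b2 x * v x))\<bar> \<le> K\<^sup>2 * q\<^sup>2 + mass"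
proof -
  have pointwise: "\<bar>q * (\<phi> x * (b2 x * v x))\<bar> \<le> q\<^sup>2 * (b2 x)\<^sup>2 + (v x)\<^sup>2" for x
  proof -
    have "\<bar>q * (\<phi> x * (b2 x * v x))\<bar> = \<phi> x * (\<bar>q * b2 x\<bar> * \<bar>v x\<bar>)" by (simp add: abs_mult)
    also have "\<dots> \<le> 1 * (\<bar>q * b2 x\<bar> * \<bar>v x\<bar>)"
      using \<zeta>_range by (intro mult_right_mono power_le_one) auto
    also have "\<dots> \<le> 2 * \<bar>q * b2 x\<bar> * \<bar>v x\<bar>" by simp
    also have "\<dots> \<le> 1 * \<bar>q * b2 x\<bar>\<^sup>2 + \<bar>v x\<bar>\<^sup>2 / 1" by (rule weighted_Young) simp
    finally show ?thesis by (simp add: power_mult_distrib)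
  qed
  have "\<bar>q * primal_int (\<lambda>x. \<phi> x * (b2 x * v x))\<bar> \<le> primal_int (\<lambda>x. \<bar>q * (\<phi> x * (b2 x * v x))\<bar>)"
    unfolding mesh_integral_cmult[symmetric] by (rule mesh_integral_abs[OF h_nonneg])
  also have "\<dots> \<le> primal_int (\<lambda>x. q\<^sup>2 * (b2 x)\<^sup>2 + (v x)\<^sup>2)"
    by (intro mesh_integral_mono h_nonneg pointwise)
  also have "\<dots> = q\<^sup>2 * primal_int (\<lambda>x. (b2 x)\<^sup>2) + mass"
    unfolding mesh_integral_add mesh_integral_cmult mass_def ..
  also have "\<dots> \<le> q\<^sup>2 * K\<^sup>2 + mass" by (intro add_right_mono mult_left_mono b2_L2) auto
  finally show ?thesis by (simp add: mult.commute)
qed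

lemma drift_pairing_bound:
  assumes \<epsilon>: "0 < \<epsilon>"
  shows "\<bar>q * primal_int (\<lambda>x. \<phi> x * drift h \<gamma> b1 b2 v x)\<bar> \<le>
    2 * \<epsilon> * energy + (CARD('n) * (2 * c0\<^sup>2 + R\<^sup>2) / \<epsilon> + K\<^sup>2) * q\<^sup>2 + mass"
proof -
  have "\<bar>q * primal_int (\<lambda>x. \<phi> x * drift h \<gamma> b1 b2 v x)\<bar> \<le>
      (\<Sum>i\<in>UNIV. \<bar>q * primal_int (\<lambda>x. \<phi> x * Dh h i (\<lambda>y. \<gamma> i y * Dh h i v y) x)\<bar>)
      + (\<Sum>i\<in>UNIV. \<bar>q * primal_int (\<lambda>x. \<phi> x * (b1 i x * Ah h i (Dh h i v) x))\<bar>)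
      + \<bar>q * primal_int (\<lambda>x. \<phi> x * (b2 x * v x))\<bar>"
    unfolding primal_int_drift distrib_left sum_distrib_left
    by (intro order_trans[OF abs_triangle_ineq] add_mono sum_abs order_refl)
  also have "\<dots> \<le> (\<Sum>i\<in>(UNIV::'n set). \<epsilon> * edge_energy i + 2 * c0\<^sup>2 / \<epsilon> * q\<^sup>2)
      + (\<Sum>i\<in>(UNIV::'n set). \<epsilon> * edge_energy i + R\<^sup>2 / \<epsilon> * q\<^sup>2) + (K\<^sup>2 * q\<^sup>2 + mass)"
    by (intro add_mono sum_mono diffusion_pairing_bound advection_pairing_bound
        potential_pairing_bound \<epsilon>)
  also have "\<dots> = 2 * \<epsilon> * energy + (CARD('n) * (2 * c0\<^sup>2 + R\<^sup>2) / \<epsilon> + K\<^sup>2) * q\<^sup>2 + mass"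
    by (simp add: sum.distrib energy_def flip: sum_distrib_left)
      (simp add: algebra_simps add_divide_distrib)
  finally show ?thesis .
qed

lemma diffusion_energy_bound:
  assumes \<epsilon>: "0 < \<epsilon>"
  shows "primal_int (\<lambda>x. \<phi> x * v x * Dh h i (\<lambda>y. \<gamma> i y * Dh h i v y) x) \<le>
    (\<epsilon> - 1 / c0) * edge_energy i + c0\<^sup>2 / \<epsilon> * mass"
proof -
  have pointwise: "- (Dh h i (\<lambda>x. \<phi> x * v x) y * (\<gamma> i y * Dh h i v y)) \<le>
      (\<epsilon> - 1 / c0) * (Ah h i \<phi> y * (Dh h i v y)\<^sup>2) + c0\<^sup>2 / \<epsilon> * (Ah h i v y)\<^sup>2"
    if y: "y \<in> dual h i (primal_mesh h)" for y
  proof -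
    have "- (Dh h i (\<lambda>x. \<phi> x * v x) y * (\<gamma> i y * Dh h i v y)) =
        - (\<gamma> i y * (Ah h i \<phi> y * (Dh h i v y)\<^sup>2)) - Ah h i v y * (Dh h i \<phi> y * (\<gamma> i y * Dh h i v y))"
      unfolding Dh_mult by (simp add: algebra_simps power2_eq_square)
    moreover have "1 / c0 * (Ah h i \<phi> y * (Dh h i v y)\<^sup>2) \<le> \<gamma> i y * (Ah h i \<phi> y * (Dh h i v y)\<^sup>2)"
      using \<gamma>_bounds[OF y] by (intro mult_right_mono mult_nonneg_nonneg Ah_nonneg) auto
    moreover have "\<bar>Ah h i v y * (Dh h i \<phi> y * (\<gamma> i y * Dh h i v y))\<bar> \<le>
        \<epsilon> * (Ah h i \<phi> y * (Dh h i v y)\<^sup>2) + c0\<^sup>2 / \<epsilon> * (Ah h i v y)\<^sup>2"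
      using \<gamma>_bounds[OF y] \<gamma>_nonneg[OF y] \<epsilon>
      by (intro diffusion_cross_term_bound[OF abs_Dh_cutoff_le Ah_power2_le]) auto
    ultimately show ?thesis unfolding left_diff_distrib by linarith
  qed
  have "primal_int (\<lambda>x. \<phi> x * v x * Dh h i (\<lambda>y. \<gamma> i y * Dh h i v y) x) =
      - dual_int i (\<lambda>y. Dh h i (\<lambda>x. \<phi> x * v x) y * (\<gamma> i y * Dh h i v y))"
    by (rule summation_by_parts_boundary(1)) (simp add: \<zeta>_boundary)
  also have "\<dots> = dual_int i (\<lambda>y. - (Dh h i (\<lambda>x. \<phi> x * v x) y * (\<gamma> i y * Dh h i v y)))"
    by (simp add: mesh_integral_def sum_negf)
  also have "\<dots> \<le> dual_int i (\<lambda>y. (\<epsilon> - 1 / c0) * (Ah h i \<phi> y * (Dh h i v y)\<^sup>2)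
      + c0\<^sup>2 / \<epsilon> * (Ah h i v y)\<^sup>2)"
    by (intro mesh_integral_mono h_nonneg pointwise)
  also have "\<dots> = (\<epsilon> - 1 / c0) * edge_energy i + c0\<^sup>2 / \<epsilon> * dual_int i (\<lambda>y. (Ah h i v y)\<^sup>2)"
    unfolding mesh_integral_add mesh_integral_cmult edge_energy_def ..
  also have "\<dots> \<le> (\<epsilon> - 1 / c0) * edge_energy i + c0\<^sup>2 / \<epsilon> * mass"
    unfolding mass_def using \<epsilon> v_outside
    by (intro add_left_mono mult_left_mono dual_int_Ah_power2_le) auto
  finally show ?thesis .
qed

lemma advection_energy_bound:
  assumes \<epsilon>: "0 < \<epsilon>"
  shows "primal_int (\<lambda>x. \<phi> x * v x * (b1 i x * Ah h i (Dh h i v) x)) \<le>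
    \<epsilon> * edge_energy i + R\<^sup>2 / \<epsilon> * mass"
proof -
  have "primal_int (\<lambda>x. \<phi> x * v x * (b1 i x * Ah h i (Dh h i v) x)) \<le>
      primal_int (\<lambda>x. \<epsilon> * (\<phi> x * (Ah h i (Dh h i v) x)\<^sup>2) + R\<^sup>2 / \<epsilon> * (v x)\<^sup>2)"
  proof (intro mesh_integral_mono h_nonneg)
    fix x :: "real ^ 'n" assume "x \<in> primal_mesh h"
    from advection_term_bound[OF \<zeta>_range b1_bound[OF this] \<epsilon>, of "v x" x i "Ah h i (Dh h i v) x"]
    show "\<phi> x * v x * (b1 i x * Ah h i (Dh h i v) x) \<le>
        \<epsilon> * (\<phi> x * (Ah h i (Dh h i v) x)\<^sup>2) + R\<^sup>2 / \<epsilon> * (v x)\<^sup>2"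
      by (simp add: mult_ac)
  qed
  also have "\<dots> = \<epsilon> * primal_int (\<lambda>x. \<phi> x * (Ah h i (Dh h i v) x)\<^sup>2) + R\<^sup>2 / \<epsilon> * mass"
    unfolding mesh_integral_add mesh_integral_cmult mass_def ..
  also have "\<dots> \<le> \<epsilon> * edge_energy i + R\<^sup>2 / \<epsilon> * mass"
    using \<epsilon> by (intro add_right_mono mult_left_mono primal_int_Ah_Dh_power2_le) auto
  finally show ?thesis .
qed

lemma Dh_localized_power2_le:
  "(Dh h i (\<lambda>x. \<zeta> x * v x) y)\<^sup>2 \<le> 2 * (Ah h i \<phi> y * (Dh h i v y)\<^sup>2) + 2 * (Ah h i v y)\<^sup>2"
proof -
  have "(s + t)\<^sup>2 \<le> 2 * s\<^sup>2 + 2 * t\<^sup>2" for s t :: real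
    using sum_squares_bound[of s t] by (simp add: power2_sum)
  from this[of "Ah h i \<zeta> y * Dh h i v y" "Dh h i \<zeta> y * Ah h i v y"]
  have "(Dh h i (\<lambda>x. \<zeta> x * v x) y)\<^sup>2 \<le>
      2 * ((Ah h i \<zeta> y)\<^sup>2 * (Dh h i v y)\<^sup>2) + 2 * ((Dh h i \<zeta> y)\<^sup>2 * (Ah h i v y)\<^sup>2)"
    unfolding Dh_mult by (simp add: power_mult_distrib)
  also have "\<dots> \<le> 2 * (Ah h i \<phi> y * (Dh h i v y)\<^sup>2) + 2 * (1 * (Ah h i v y)\<^sup>2)"
    using \<zeta>_Lipschitz[of i y]
    by (intro add_mono mult_left_mono mult_right_mono Ah_power2_le) (auto simp: abs_square_le_1)
  finally show ?thesis by simp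
qed

lemma dual_int_Dh_localized_le:
  assumes \<delta>: "0 < \<delta>"
  defines "u \<equiv> \<lambda>x. \<zeta> x * v x"
  shows "dual_int i (\<lambda>y. \<bar>Dh h i (\<lambda>x. (u x)\<^sup>2) y\<bar>) \<le> 2 * \<delta> * energy + (2 * \<delta> + 1 / \<delta>) * mass"
proof -
  have u_outside: "u x = 0" if "x \<notin> primal_mesh h" for x
    using v_outside[OF that] by (simp add: u_def)
  have u_mass: "primal_int (\<lambda>x. (u x)\<^sup>2) \<le> mass"
    unfolding mass_def u_def using \<zeta>_range
    by (intro mesh_integral_mono h_nonneg)
      (auto simp: power_mult_distrib intro!: mult_left_le_one_le power_le_one)
  have pointwise: "\<bar>Dh h i (\<lambda>x. (u x)\<^sup>2) y\<bar> \<le> 2 * \<delta> * (Ah h i \<phi> y * (Dh h i v y)\<^sup>2)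
      + (2 * \<delta> * (Ah h i v y)\<^sup>2 + 1 / \<delta> * (Ah h i u y)\<^sup>2)" for y
  proof -
    have "\<bar>Dh h i (\<lambda>x. (u x)\<^sup>2) y\<bar> = 2 * \<bar>Dh h i u y\<bar> * \<bar>Ah h i u y\<bar>"
      by (simp add: Dh_power2 abs_mult)
    also have "\<dots> \<le> \<delta> * \<bar>Dh h i u y\<bar>\<^sup>2 + \<bar>Ah h i u y\<bar>\<^sup>2 / \<delta>" by (rule weighted_Young) fact
    also have "\<dots> = \<delta> * (Dh h i u y)\<^sup>2 + 1 / \<delta> * (Ah h i u y)\<^sup>2" by simp
    also have "(Dh h i u y)\<^sup>2 \<le> 2 * (Ah h i \<phi> y * (Dh h i v y)\<^sup>2) + 2 * (Ah h i v y)\<^sup>2"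
      unfolding u_def by (rule Dh_localized_power2_le)
    finally show ?thesis using \<delta> by (simp add: algebra_simps)
  qed
  have "dual_int i (\<lambda>y. \<bar>Dh h i (\<lambda>x. (u x)\<^sup>2) y\<bar>) \<le>
      dual_int i (\<lambda>y. 2 * \<delta> * (Ah h i \<phi> y * (Dh h i v y)\<^sup>2)
        + (2 * \<delta> * (Ah h i v y)\<^sup>2 + 1 / \<delta> * (Ah h i u y)\<^sup>2))"
    by (intro mesh_integral_mono h_nonneg pointwise)
  also have "\<dots> = 2 * \<delta> * edge_energy i
      + (2 * \<delta> * dual_int i (\<lambda>y. (Ah h i v y)\<^sup>2) + 1 / \<delta> * dual_int i (\<lambda>y. (Ah h i u y)\<^sup>2))"
    unfolding mesh_integral_add mesh_integral_cmult edge_energy_def ..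
  also have "\<dots> \<le> 2 * \<delta> * energy + (2 * \<delta> * mass + 1 / \<delta> * mass)"
  proof (intro add_mono mult_left_mono edge_energy_le_energy)
    show "dual_int i (\<lambda>y. (Ah h i v y)\<^sup>2) \<le> mass"
      unfolding mass_def by (rule dual_int_Ah_power2_le) (rule v_outside)
    show "dual_int i (\<lambda>y. (Ah h i u y)\<^sup>2) \<le> mass"
      using dual_int_Ah_power2_le[of u i, OF u_outside] u_mass by linarith
  qed (use \<delta> in auto)
  finally show ?thesis by (simp add: algebra_simps)
qed

lemma potential_energy_bound:
  assumes \<delta>: "0 < \<delta>"
  shows "primal_int (\<lambda>x. \<phi> x * v x * (b2 x * v x)) \<le>
    K * (2 * \<delta> * energy + (2 * \<delta> + 1 / \<delta>) * mass)" (is "_ \<le> K * ?X")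
proof -
  define u where "u = (\<lambda>x. \<zeta> x * v x)"
  have X_nonneg: "0 \<le> ?X" using \<delta> mass_nonneg energy_nonneg by simp
  have "\<phi> x * v x * (b2 x * v x) \<le> \<bar>b2 x\<bar> * (u x)\<^sup>2" for x
  proof -
    have "\<phi> x * v x * (b2 x * v x) = b2 x * (u x)\<^sup>2"
      by (simp add: u_def power2_eq_square mult_ac)
    also have "\<dots> \<le> \<bar>b2 x\<bar> * (u x)\<^sup>2" by (intro mult_right_mono) auto
    finally show ?thesis .
  qed
  then have "primal_int (\<lambda>x. \<phi> x * v x * (b2 x * v x)) \<le> primal_int (\<lambda>x. \<bar>b2 x\<bar> * (u x)\<^sup>2)"
    by (intro mesh_integral_mono h_nonneg)
  also have "\<dots> \<le> (primal_int (\<lambda>x. \<bar>b2 x\<bar> ^ CARD('n))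
      * (\<Prod>i\<in>UNIV. dual_int i (\<lambda>y. \<bar>Dh h i (\<lambda>x. (u x)\<^sup>2) y\<bar>))) powr (1 / CARD('n))"
    using v_outside by (intro mesh_Gagliardo dim_ge_2) (auto simp: u_def)
  also have "\<dots> \<le> (K ^ CARD('n) * (\<Prod>i\<in>(UNIV :: 'n set). ?X)) powr (1 / CARD('n))"
    using b2_Ln dual_int_Dh_localized_le[OF \<delta>] K_pos unfolding u_def
    by (intro powr_mono2 mult_mono prod_mono conjI mult_nonneg_nonneg prod_nonneg
        mesh_integral_nonneg h_nonneg) auto
  also have "\<dots> = ((K * ?X) ^ CARD('n)) powr (1 / CARD('n))"
    by (simp add: power_mult_distrib)
  also have "\<dots> = K * ?X"
    using X_nonneg K_pos by (intro power_powr_inverse) auto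
  finally show ?thesis .
qed

lemma drift_energy_bound:
  assumes \<epsilon>: "0 < \<epsilon>" and \<delta>: "0 < \<delta>"
  shows "primal_int (\<lambda>x. \<phi> x * v x * drift h \<gamma> b1 b2 v x) \<le>
    (2 * \<epsilon> + 2 * \<delta> * K - 1 / c0) * energy
    + (CARD('n) * (c0\<^sup>2 + R\<^sup>2) / \<epsilon> + K * (2 * \<delta> + 1 / \<delta>)) * mass"
proof -
  have "primal_int (\<lambda>x. \<phi> x * v x * drift h \<gamma> b1 b2 v x) \<le>
      (\<Sum>i\<in>(UNIV::'n set). (\<epsilon> - 1 / c0) * edge_energy i + c0\<^sup>2 / \<epsilon> * mass)
      + (\<Sum>i\<in>(UNIV::'n set). \<epsilon> * edge_energy i + R\<^sup>2 / \<epsilon> * mass)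
      + K * (2 * \<delta> * energy + (2 * \<delta> + 1 / \<delta>) * mass)"
    unfolding primal_int_drift
    by (intro add_mono sum_mono diffusion_energy_bound advection_energy_bound
        potential_energy_bound \<epsilon> \<delta>)
  also have "\<dots> = (2 * \<epsilon> + 2 * \<delta> * K - 1 / c0) * energy
      + (CARD('n) * (c0\<^sup>2 + R\<^sup>2) / \<epsilon> + K * (2 * \<delta> + 1 / \<delta>)) * mass"
    by (simp add: sum.distrib energy_def flip: sum_distrib_left)
      (simp add: algebra_simps add_divide_distrib)
  finally show ?thesis .
qed

end

text \<open>The bounds on the pairing with the drift for \<open>\<epsilon> = \<theta> / (4 c0)\<close> and on the energy for
  \<open>\<epsilon> = 1 / (8 c0)\<close> and \<open>\<delta> = 1 / (8 c0 K)\<close>: with these choices the gradient energy cancels.\<close>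

definition drift_constant :: "nat \<Rightarrow> real \<Rightarrow> real \<Rightarrow> real \<Rightarrow> real \<Rightarrow> real" where
  "drift_constant n c0 R K \<theta> =
     2 * (real n * (2 * c0\<^sup>2 + R\<^sup>2) / (\<theta> / (4 * c0)) + K\<^sup>2 + 1)
     + 2 * \<theta> * (real n * (c0\<^sup>2 + R\<^sup>2) / (1 / (8 * c0)) + (1 / (4 * c0) + 8 * c0 * K\<^sup>2))"

lemma drift_constant_nonneg: "0 < c0 \<Longrightarrow> 0 < \<theta> \<Longrightarrow> 0 \<le> drift_constant n c0 R K \<theta>"
  unfolding drift_constant_def
  by (intro add_nonneg_nonneg mult_nonneg_nonneg divide_nonneg_nonneg) auto

lemma (in localized_drift) localized_form_drift_le:
  assumes \<theta>: "0 < \<theta>"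
  shows "- 2 * localized_form \<phi> \<theta> v (drift h \<gamma> b1 b2 v) \<le> drift_constant CARD('n) c0 R K \<theta> * mass"
proof -
  define \<epsilon> where "\<epsilon> = \<theta> / (4 * c0)"
  define p where "p = primal_int (\<lambda>x. \<phi> x * v x)"
  define k where "k = CARD('n) * (2 * c0\<^sup>2 + R\<^sup>2) / \<epsilon> + K\<^sup>2"
  define k' where "k' = CARD('n) * (c0\<^sup>2 + R\<^sup>2) / (1 / (8 * c0)) + (1 / (4 * c0) + 8 * c0 * K\<^sup>2)"
  let ?pairing = "primal_int (\<lambda>x. \<phi> x * drift h \<gamma> b1 b2 v x)"
  let ?work = "primal_int (\<lambda>x. \<phi> x * v x * drift h \<gamma> b1 b2 v x)"
  have \<epsilon>: "0 < \<epsilon>" using \<theta> c0_pos by (simp add: \<epsilon>_def)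
  have "p\<^sup>2 \<le> mass"
    unfolding mass_def p_def using \<zeta>_range
    by (intro primal_int_bounded_mult_power2_le) (auto intro: power_le_one)
  then have "k * p\<^sup>2 \<le> k * mass" using \<epsilon> by (intro mult_left_mono) (auto simp: k_def)
  then have pairing: "- (p * ?pairing) \<le> 2 * \<epsilon> * energy + (k + 1) * mass"
    using abs_le_D2[OF drift_pairing_bound[OF \<epsilon>, of p]]
    unfolding k_def[symmetric] by (simp add: algebra_simps)
  have gradient_coeff: "2 * (1 / (8 * c0)) + 2 * (1 / (8 * c0 * K)) * K - 1 / c0 = - 1 / (2 * c0)"
    and potential_coeff:
      "K * (2 * (1 / (8 * c0 * K)) + 1 / (1 / (8 * c0 * K))) = 1 / (4 * c0) + 8 * c0 * K\<^sup>2"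
    using c0_pos K_pos by (simp_all add: field_simps power2_eq_square)
  have "?work \<le> - 1 / (2 * c0) * energy + k' * mass"
    using drift_energy_bound[of "1 / (8 * c0)" "1 / (8 * c0 * K)"] c0_pos K_pos
    unfolding gradient_coeff potential_coeff k'_def by simp
  then have "\<theta> * ?work \<le> \<theta> * (- 1 / (2 * c0) * energy + k' * mass)"
    using \<theta> by (intro mult_left_mono) auto
  also have "\<dots> = - 2 * \<epsilon> * energy + \<theta> * k' * mass" using c0_pos by (simp add: \<epsilon>_def field_simps)
  finally have "- 2 * localized_form \<phi> \<theta> v (drift h \<gamma> b1 b2 v) \<le> (2 * (k + 1) + 2 * \<theta> * k') * mass"
    using pairing unfolding localized_form_def p_def[symmetric] by (simp add: algebra_simps)
  then show ?thesis by (simp add: drift_constant_def k_def k'_def \<epsilon>_def)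
qed

section \<open>Harnack inequality\<close>

definition comparable :: "real \<Rightarrow> real \<Rightarrow> real \<Rightarrow> bool" where
  "comparable L a b \<longleftrightarrow> sgn a = sgn b \<and> \<bar>a\<bar> \<le> exp L * \<bar>b\<bar> \<and> \<bar>b\<bar> \<le> exp L * \<bar>a\<bar>"

lemma comparable_refl: "comparable 0 a a"
  by (simp add: comparable_def)

lemma comparable_sym: "comparable L a b \<Longrightarrow> comparable L b a"
  by (auto simp: comparable_def)

lemma comparable_trans:
  assumes "comparable L a b" "comparable L' b c"
  shows "comparable (L + L') a c"
proof -
  have trans: "s \<le> exp (p + q) * t" if "s \<le> exp p * r" "r \<le> exp q * t" for p q r s t :: real
    using order_trans[OF that(1) mult_left_mono[OF that(2), of "exp p"]]
    by (simp add: exp_add mult.assoc)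
  show ?thesis
    using assms trans[of "\<bar>a\<bar>" L "\<bar>b\<bar>" L' "\<bar>c\<bar>"] trans[of "\<bar>c\<bar>" L' "\<bar>b\<bar>" L "\<bar>a\<bar>"]
    by (simp add: comparable_def add.commute)
qed

lemma comparable_mono:
  assumes "comparable L a b" "L \<le> L'"
  shows "comparable L' a b"
proof -
  have "exp L * \<bar>s\<bar> \<le> exp L' * \<bar>s\<bar>" for s :: real
    using assms(2) by (intro mult_right_mono) auto
  then show ?thesis using assms(1) by (auto simp: comparable_def intro: order_trans)
qed

lemma comparable_lower_bound: "comparable L a b \<Longrightarrow> exp (- L) * \<bar>b\<bar> \<le> \<bar>a\<bar>"
  by (simp add: comparable_def exp_minus field_simps)

lemma comparable_of_relative_difference:
  assumes diff: "\<bar>a - b\<bar> \<le> q * \<bar>a + b\<bar>" and q: "0 \<le> q" "q \<le> 1 / 2"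
  shows "comparable (4 * q) a b"
proof -
  have ratio_le: "\<bar>a\<bar> \<le> exp (4 * q) * \<bar>b\<bar>" if "\<bar>a - b\<bar> \<le> q * \<bar>a + b\<bar>" for a b
  proof -
    have "\<bar>a\<bar> - \<bar>b\<bar> \<le> q * \<bar>a + b\<bar>" using that by linarith
    also have "\<dots> \<le> q * (\<bar>a\<bar> + \<bar>b\<bar>)" using q by (intro mult_left_mono) auto
    finally have "(1 - q) * \<bar>a\<bar> \<le> (1 + q) * \<bar>b\<bar>" by (simp add: algebra_simps)
    also have "\<dots> \<le> ((1 - q) * (1 + 4 * q)) * \<bar>b\<bar>"
    proof (intro mult_right_mono)
      have "0 \<le> 2 * q * (1 - 2 * q)" using q by (intro mult_nonneg_nonneg) auto
      then show "1 + q \<le> (1 - q) * (1 + 4 * q)" by (simp add: algebra_simps)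
    qed auto
    finally have "(1 - q) * \<bar>a\<bar> \<le> (1 - q) * ((1 + 4 * q) * \<bar>b\<bar>)" by (simp add: mult.assoc)
    then have "\<bar>a\<bar> \<le> (1 + 4 * q) * \<bar>b\<bar>" by (rule mult_left_le_imp_le) (use q in auto)
    also have "\<dots> \<le> exp (4 * q) * \<bar>b\<bar>" by (intro mult_right_mono) auto
    finally show ?thesis .
  qed
  have "q * \<bar>a + b\<bar> \<le> 1 / 2 * \<bar>a + b\<bar>" using q by (intro mult_right_mono) auto
  then have "\<bar>a - b\<bar> \<le> 1 / 2 * \<bar>a + b\<bar>" using diff by linarith
  then have "sgn a = sgn b" by (auto simp: sgn_real_def abs_if split: if_splits)
  then show ?thesis
    using ratio_le[OF diff] ratio_le[of b a] diff
    by (simp add: comparable_def abs_minus_commute[of b a] add.commute)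
qed

lemma lattice_step_towards:
  fixes z z' :: "'n::finite \<Rightarrow> int"
  assumes z: "\<forall>j. z j \<in> {a..b}" and z': "\<forall>j. z' j \<in> {a..b}" and ne: "z \<noteq> z'"
  obtains y i where "\<forall>j. y j \<in> {a..b}" "y = z(i := z i + 1) \<or> z = y(i := y i + 1)"
    "(\<Sum>j\<in>UNIV. \<bar>z j - z' j\<bar>) = (\<Sum>j\<in>UNIV. \<bar>y j - z' j\<bar>) + 1"
proof -
  obtain i where i: "z i \<noteq> z' i" using ne by blast
  define y where "y = z(i := if z i < z' i then z i + 1 else z i - 1)"
  show thesis
  proof (rule that)
    have "y i \<in> {a..b}" using z[rule_format, of i] z'[rule_format, of i] i by (auto simp: y_def)
    then show "\<forall>j. y j \<in> {a..b}" using z by (auto simp: y_def)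
    show "y = z(i := z i + 1) \<or> z = y(i := y i + 1)" by (auto simp: y_def)
    have "(\<Sum>j\<in>UNIV - {i}. \<bar>z j - z' j\<bar>) = (\<Sum>j\<in>UNIV - {i}. \<bar>y j - z' j\<bar>)"
      by (intro sum.cong) (auto simp: y_def)
    moreover have "\<bar>z i - z' i\<bar> = \<bar>y i - z' i\<bar> + 1" using i by (auto simp: y_def)
    ultimately show "(\<Sum>j\<in>UNIV. \<bar>z j - z' j\<bar>) = (\<Sum>j\<in>UNIV. \<bar>y j - z' j\<bar>) + 1"
      by (simp add: sum.remove[of UNIV i])
  qed
qed

lemma comparable_along_lattice:
  fixes G :: "('n::finite \<Rightarrow> int) \<Rightarrow> real"
  assumes step: "\<And>z i. \<forall>j. z j \<in> {a..b} \<Longrightarrow> comparable c (G z) (G (z(i := z i + 1)))"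
    and z': "\<forall>j. z' j \<in> {a..b}"
  shows "\<forall>j. z j \<in> {a..b} \<Longrightarrow> (\<Sum>j\<in>UNIV. \<bar>z j - z' j\<bar>) = int d \<Longrightarrow>
    comparable (c * real d) (G z) (G z')"
proof (induction d arbitrary: z)
  case 0
  then have "z = z'" by (auto simp: sum_nonneg_eq_0_iff fun_eq_iff)
  then show ?case by (simp add: comparable_refl)
next
  case (Suc d)
  then have "z \<noteq> z'" by auto
  then obtain y i where
    y: "\<forall>j. y j \<in> {a..b}" "y = z(i := z i + 1) \<or> z = y(i := y i + 1)"
    and dist: "(\<Sum>j\<in>UNIV. \<bar>z j - z' j\<bar>) = (\<Sum>j\<in>UNIV. \<bar>y j - z' j\<bar>) + 1"
    by (rule lattice_step_towards[OF Suc.prems(1) z'])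
  have "comparable c (G z) (G y)"
    using y step[OF Suc.prems(1), of i] step[OF y(1), of i] comparable_sym by auto
  moreover have "comparable (c * real d) (G y) (G z')"
    using Suc.IH[OF y(1)] dist Suc.prems(2) by simp
  ultimately have "comparable (c + c * real d) (G z) (G z')" by (rule comparable_trans)
  then show ?case by (simp add: algebra_simps)
qed

definition coercivity_constant :: "nat \<Rightarrow> real \<Rightarrow> real \<Rightarrow> real" where
  "coercivity_constant n C0 \<kappa> = \<kappa>\<^sup>2 * exp (- 4 * (2 * C0 * real n)) / 2"

context uniform_mesh
begin

definition log_gradient_bound :: "real \<Rightarrow> (real ^ 'n \<Rightarrow> real) \<Rightarrow> bool" where
  "log_gradient_bound C0 g \<longleftrightarrow>
     (\<forall>i. \<forall>y\<in>dual h i (primal_mesh h). \<bar>Dh h i g y\<bar> \<le> C0 * \<bar>Ah h i g y\<bar>)"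

lemma log_gradient_bound_neighbours:
  assumes C0: "0 < C0" "C0 * h \<le> 1" and g: "log_gradient_bound C0 g"
    and z: "grid h z \<in> primal_mesh h"
  shows "comparable (2 * C0 * h) (g (grid h z)) (g (grid h (z(i := z i + 1))))"
proof -
  define a b where "a = g (grid h (z(i := z i + 1)))" and "b = g (grid h z)"
  have "grid_edge h i z \<in> dual h i (primal_mesh h)" using z by (intro grid_edge_in_dual) auto
  then have "\<bar>Dh h i g (grid_edge h i z)\<bar> \<le> C0 * \<bar>Ah h i g (grid_edge h i z)\<bar>"
    using g by (simp add: log_gradient_bound_def)
  then have "\<bar>(a - b) / h\<bar> \<le> C0 * \<bar>(a + b) / 2\<bar>"
    unfolding Dh_grid_edge Ah_grid_edge a_def b_def .
  then have "\<bar>a - b\<bar> / h \<le> C0 * \<bar>a + b\<bar> / 2" using h_pos by simp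
  then have "\<bar>a - b\<bar> \<le> (C0 * h / 2) * \<bar>a + b\<bar>" using h_pos by (simp add: pos_divide_le_eq mult_ac)
  then have "comparable (4 * (C0 * h / 2)) a b"
    using C0 h_pos by (intro comparable_of_relative_difference) auto
  then have "comparable (2 * C0 * h) a b" by (simp add: mult.assoc)
  then show ?thesis unfolding a_def b_def by (rule comparable_sym)
qed

lemma mesh_Harnack:
  fixes g :: "real ^ 'n \<Rightarrow> real"
  assumes C0: "0 < C0" "C0 * h \<le> 1" and g: "log_gradient_bound C0 g"
    and x: "x \<in> primal_mesh h" "x' \<in> primal_mesh h"
  shows "comparable (2 * C0 * CARD('n)) (g x) (g x')"
proof -
  obtain z z' where z: "x = grid h z" "\<forall>j. z j \<in> {1..int N}"
    and z': "x' = grid h z'" "\<forall>j. z' j \<in> {1..int N}"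
    using x unfolding primal_mesh_eq_grid PiE_iff by blast
  define d where "d = nat (\<Sum>i\<in>UNIV. \<bar>z i - z' i\<bar>)"
  have d: "(\<Sum>i\<in>UNIV. \<bar>z i - z' i\<bar>) = int d" by (simp add: d_def sum_nonneg)
  have "(\<Sum>i\<in>UNIV. \<bar>z i - z' i\<bar>) \<le> (\<Sum>i\<in>(UNIV :: 'n set). int N)"
  proof (rule sum_mono)
    fix i show "\<bar>z i - z' i\<bar> \<le> int N" using z(2)[rule_format, of i] z'(2)[rule_format, of i] by auto
  qed
  then have "int d \<le> int (CARD('n) * N)" unfolding d by simp
  then have "real d \<le> real CARD('n) * real N" by (metis of_nat_le_iff of_nat_mult)
  then have "h * real d \<le> h * (real CARD('n) * real N)" using h_pos by (intro mult_left_mono) auto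
  also have "\<dots> \<le> real CARD('n)" unfolding h_eq by (simp add: field_simps)
  finally have length: "2 * C0 * h * real d \<le> 2 * C0 * CARD('n)"
    using C0 by (simp add: mult.assoc)
  have "comparable (2 * C0 * h * real d) (g (grid h z)) (g (grid h z'))"
    using log_gradient_bound_neighbours[OF C0 g] grid_in_primal_mesh_iff
    by (intro comparable_along_lattice[of 1 "int N" _ "\<lambda>z. g (grid h z)", OF _ z'(2) z(2) d]) blast
  then show ?thesis unfolding z(1) z'(1) using length by (rule comparable_mono)
qed

lemma primal_int_power2_le_comparable:
  fixes g :: "real ^ 'n \<Rightarrow> real"
  assumes "\<And>x. x \<in> primal_mesh h \<Longrightarrow> comparable L (g x) G"
  shows "primal_int (\<lambda>x. (g x)\<^sup>2) \<le> (exp L * \<bar>G\<bar>)\<^sup>2"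
proof -
  have "primal_int (\<lambda>x. (g x)\<^sup>2) \<le> primal_int (\<lambda>_ :: real ^ 'n. (exp L * \<bar>G\<bar>)\<^sup>2 * 1)"
  proof (intro mesh_integral_mono h_nonneg)
    fix x :: "real ^ 'n" assume "x \<in> primal_mesh h"
    then have "\<bar>g x\<bar>\<^sup>2 \<le> (exp L * \<bar>G\<bar>)\<^sup>2"
      using assms by (intro power_mono) (auto simp: comparable_def)
    then show "(g x)\<^sup>2 \<le> (exp L * \<bar>G\<bar>)\<^sup>2 * 1" by simp
  qed
  also have "\<dots> \<le> (exp L * \<bar>G\<bar>)\<^sup>2 * 1"
    unfolding mesh_integral_cmult by (intro mult_left_mono primal_int_one_le) auto
  finally show ?thesis by simp
qed

lemma weighted_primal_int_ge_comparable:
  fixes g \<phi> :: "real ^ 'n \<Rightarrow> real"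
  assumes g: "\<And>x. x \<in> primal_mesh h \<Longrightarrow> comparable L (g x) G"
    and \<phi>: "\<And>x. 0 \<le> \<phi> x" and \<kappa>: "0 \<le> \<kappa>" "\<kappa> \<le> primal_int \<phi>"
  shows "(\<kappa> * (exp (- L) * \<bar>G\<bar>))\<^sup>2 \<le> (primal_int (\<lambda>x. \<phi> x * g x))\<^sup>2"
proof -
  have "\<kappa> * (exp (- L) * \<bar>G\<bar>) \<le> primal_int \<phi> * (exp (- L) * \<bar>G\<bar>)"
    using \<kappa> by (intro mult_right_mono) auto
  also have "\<dots> = primal_int (\<lambda>x. (exp (- L) * \<bar>G\<bar>) * \<phi> x)"
    unfolding mesh_integral_cmult by (rule mult.commute)
  also have "\<dots> \<le> primal_int (\<lambda>x. sgn G * (\<phi> x * g x))"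
  proof (intro mesh_integral_mono h_nonneg)
    fix x :: "real ^ 'n" assume x: "x \<in> primal_mesh h"
    have "(exp (- L) * \<bar>G\<bar>) * \<phi> x \<le> \<bar>g x\<bar> * \<phi> x"
      by (intro mult_right_mono comparable_lower_bound g x \<phi>)
    also have "\<dots> = sgn (g x) * (\<phi> x * g x)" by (simp add: abs_sgn mult_ac)
    also have "sgn (g x) = sgn G" using g[OF x] by (simp add: comparable_def)
    finally show "(exp (- L) * \<bar>G\<bar>) * \<phi> x \<le> sgn G * (\<phi> x * g x)" .
  qed
  also have "\<dots> \<le> \<bar>primal_int (\<lambda>x. \<phi> x * g x)\<bar>"
    unfolding mesh_integral_cmult by (auto simp: sgn_real_def)
  finally have "(\<kappa> * (exp (- L) * \<bar>G\<bar>))\<^sup>2 \<le> \<bar>primal_int (\<lambda>x. \<phi> x * g x)\<bar>\<^sup>2"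
    using \<kappa> by (intro power_mono) auto
  then show ?thesis by simp
qed

lemma localized_form_coercive:
  fixes g \<phi> :: "real ^ 'n \<Rightarrow> real"
  assumes C0: "0 < C0" "C0 * h \<le> 1" and g: "log_gradient_bound C0 g"
    and \<phi>: "\<And>x. 0 \<le> \<phi> x" "\<And>x. \<phi> x \<le> 1" and \<kappa>: "0 \<le> \<kappa>" "\<kappa> \<le> primal_int \<phi>"
  defines "\<theta> \<equiv> coercivity_constant CARD('n) C0 \<kappa>"
  shows "\<theta> * primal_int (\<lambda>x. (g x)\<^sup>2) \<le> localized_form \<phi> \<theta> g g"
proof (cases "primal_mesh h = ({} :: (real ^ 'n) set)")
  case True
  then show ?thesis by (simp add: localized_form_def mesh_integral_def)
next
  case False
  then obtain x\<^sub>0 :: "real ^ 'n" where x\<^sub>0: "x\<^sub>0 \<in> primal_mesh h" by blast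
  define L where "L = 2 * C0 * CARD('n)"
  define G where "G = g x\<^sub>0"
  have comparable: "comparable L (g x) G" if "x \<in> primal_mesh h" for x
    unfolding L_def G_def by (rule mesh_Harnack[OF C0 g that x\<^sub>0])
  have \<theta>_nonneg: "0 \<le> \<theta>" by (simp add: \<theta>_def coercivity_constant_def)
  have "exp (- 4 * L) * (exp L)\<^sup>2 = (exp (- L))\<^sup>2"
    by (simp add: power2_eq_square flip: exp_add)
  then have "2 * (\<theta> * (exp L * \<bar>G\<bar>)\<^sup>2) = (\<kappa> * (exp (- L) * \<bar>G\<bar>))\<^sup>2"
    unfolding \<theta>_def coercivity_constant_def L_def[symmetric]
    by (simp add: power_mult_distrib mult_ac)
  moreover have "\<theta> * primal_int (\<lambda>x. (g x)\<^sup>2) \<le> \<theta> * (exp L * \<bar>G\<bar>)\<^sup>2"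
    using comparable \<theta>_nonneg by (intro mult_left_mono primal_int_power2_le_comparable)
  moreover have "\<theta> * primal_int (\<lambda>x. \<phi> x * g x * g x) \<le> \<theta> * primal_int (\<lambda>x. (g x)\<^sup>2)"
    using \<phi> \<theta>_nonneg
    by (intro mult_left_mono mesh_integral_mono h_nonneg)
      (auto simp: power2_eq_square mult.assoc mult_left_le_one_le)
  moreover have "(\<kappa> * (exp (- L) * \<bar>G\<bar>))\<^sup>2 \<le> (primal_int (\<lambda>x. \<phi> x * g x))\<^sup>2"
    using comparable \<phi>(1) \<kappa> by (rule weighted_primal_int_ge_comparable)
  ultimately show ?thesis
    unfolding localized_form_def power2_eq_square[symmetric] by linarith
qed

end

section \<open>The cutoff\<close>

definition bump :: "real \<Rightarrow> real ^ 'n \<Rightarrow> real ^ 'n \<Rightarrow> real" where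
  "bump r x\<^sub>0 x = max 0 (r - dist x x\<^sub>0)"

lemma bump_nonneg: "0 \<le> bump r x\<^sub>0 x"
  by (simp add: bump_def)

lemma bump_le: "0 \<le> r \<Longrightarrow> bump r x\<^sub>0 x \<le> r"
  by (simp add: bump_def)

lemma bump_nonzero_imp_dist_less: "bump r x\<^sub>0 x \<noteq> 0 \<Longrightarrow> dist x x\<^sub>0 < r"
  by (auto simp: bump_def max_def split: if_splits)

lemma abs_bump_diff_le: "\<bar>bump r x\<^sub>0 x - bump r x\<^sub>0 y\<bar> \<le> dist x y"
  using dist_triangle[of x x\<^sub>0 y] dist_triangle[of y x\<^sub>0 x]
  by (auto simp: bump_def max_def dist_commute)

lemma card_int_multiples_ge:
  fixes a h \<delta> :: real
  assumes h: "0 < h" "h \<le> \<delta>"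
  shows "\<delta> / h \<le> real (card {\<lceil>(a - \<delta>) / h\<rceil>..\<lfloor>(a + \<delta>) / h\<rfloor>})"
proof -
  have "2 * \<delta> / h = (a + \<delta>) / h - (a - \<delta>) / h" by (simp flip: diff_divide_distrib)
  also have "\<dots> \<le> (of_int \<lfloor>(a + \<delta>) / h\<rfloor> + 1) - (of_int \<lceil>(a - \<delta>) / h\<rceil> - 1)"
    by (intro diff_mono) linarith+
  also have "\<dots> \<le> real (card {\<lceil>(a - \<delta>) / h\<rceil>..\<lfloor>(a + \<delta>) / h\<rfloor>}) + 1" by simp
  finally have "2 * \<delta> / h \<le> real (card {\<lceil>(a - \<delta>) / h\<rceil>..\<lfloor>(a + \<delta>) / h\<rfloor>}) + 1" .
  moreover have "1 \<le> \<delta> / h" using h by simp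
  moreover have "2 * \<delta> / h = \<delta> / h + \<delta> / h" by (simp add: add_divide_distrib[symmetric])
  ultimately show ?thesis by linarith
qed

context uniform_mesh
begin

lemma card_primal_mesh_ball_ge:
  fixes x\<^sub>0 :: "real ^ 'n" and \<delta> :: real
  assumes sub: "cball x\<^sub>0 (CARD('n) * \<delta>) \<subseteq> unit_cube" and \<delta>: "h \<le> \<delta>"
  shows "(\<delta> / h) ^ CARD('n) \<le> real (card {x \<in> primal_mesh h. dist x x\<^sub>0 \<le> CARD('n) * \<delta>})"
proof -
  define A where "A = (\<lambda>i. {\<lceil>(x\<^sub>0 $ i - \<delta>) / h\<rceil>..\<lfloor>(x\<^sub>0 $ i + \<delta>) / h\<rfloor>})"
  have "dist (grid h z) x\<^sub>0 \<le> CARD('n) * \<delta>" if "z \<in> PiE UNIV A" for z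
  proof -
    have "\<bar>h * of_int (z i) - x\<^sub>0 $ i\<bar> \<le> \<delta>" for i
    proof -
      have "z i \<in> A i" using that by (simp add: PiE_iff)
      then have "(x\<^sub>0 $ i - \<delta>) / h \<le> of_int (z i)" "of_int (z i) \<le> (x\<^sub>0 $ i + \<delta>) / h"
        unfolding A_def by (simp_all add: ceiling_le_iff le_floor_iff)
      then show ?thesis using h_pos by (simp add: field_simps abs_le_iff)
    qed
    then have "(\<Sum>i\<in>UNIV. \<bar>(grid h z - x\<^sub>0) $ i\<bar>) \<le> (\<Sum>i\<in>(UNIV :: 'n set). \<delta>)"
      by (intro sum_mono) (simp add: grid_def)
    then show ?thesis
      using norm_le_l1_cart[of "grid h z - x\<^sub>0"] by (simp add: dist_norm)
  qed
  then have "grid h ` PiE UNIV A \<subseteq> {x \<in> primal_mesh h. dist x x\<^sub>0 \<le> CARD('n) * \<delta>}"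
    using sub by (auto simp: primal_mesh_def grid_def dist_commute subset_eq)
  then have "card (grid h ` PiE UNIV A) \<le> card {x \<in> primal_mesh h. dist x x\<^sub>0 \<le> CARD('n) * \<delta>}"
    by (intro card_mono finite_subset[OF _ finite_primal_mesh]) auto
  moreover have "card (grid h ` PiE UNIV A) = (\<Prod>i\<in>UNIV. card (A i))"
    using h_pos by (subst card_image) (auto intro: inj_on_subset[OF inj_grid] simp: card_PiE)
  moreover have "(\<Prod>i\<in>(UNIV :: 'n set). \<delta> / h) \<le> (\<Prod>i\<in>UNIV. real (card (A i)))"
    unfolding A_def using \<delta> h_pos by (intro prod_mono conjI card_int_multiples_ge) auto
  ultimately show ?thesis by (simp flip: of_nat_prod)
qed

lemma primal_int_bump_power2_ge:
  fixes x\<^sub>0 :: "real ^ 'n"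
  assumes r: "0 < r" and sub: "ball x\<^sub>0 r \<subseteq> unit_cube" and hr: "h \<le> r / (2 * CARD('n))"
  shows "(r / (2 * CARD('n))) ^ CARD('n) * (r / 2)\<^sup>2 \<le> primal_int (\<lambda>x. (bump r x\<^sub>0 x)\<^sup>2)"
proof -
  let ?n = "CARD('n)"
  let ?near = "{x \<in> primal_mesh h. dist x x\<^sub>0 \<le> r / 2}"
  define \<delta> where "\<delta> = r / (2 * ?n)"
  have n\<delta>: "?n * \<delta> = r / 2" by (simp add: \<delta>_def)
  have "cball x\<^sub>0 (?n * \<delta>) \<subseteq> unit_cube"
    using sub r unfolding n\<delta> by (auto simp: subset_eq)
  then have card: "(\<delta> / h) ^ ?n \<le> real (card ?near)"
    using card_primal_mesh_ball_ge[of x\<^sub>0 \<delta>] hr unfolding n\<delta> \<delta>_def by simp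
  have "\<delta> ^ ?n * (r / 2)\<^sup>2 = h ^ ?n * ((\<delta> / h) ^ ?n * (r / 2)\<^sup>2)"
    using h_pos by (simp add: power_divide)
  also have "\<dots> \<le> h ^ ?n * (real (card ?near) * (r / 2)\<^sup>2)"
    using card h_pos by (intro mult_left_mono mult_right_mono) auto
  also have "\<dots> = h ^ ?n * (\<Sum>x\<in>?near. (r / 2)\<^sup>2)" by simp
  also have "\<dots> \<le> h ^ ?n * (\<Sum>x\<in>?near. (bump r x\<^sub>0 x)\<^sup>2)"
    using h_pos r by (intro mult_left_mono sum_mono power_mono) (auto simp: bump_def)
  also have "\<dots> \<le> primal_int (\<lambda>x. (bump r x\<^sub>0 x)\<^sup>2)"
    unfolding mesh_integral_def using finite_primal_mesh h_pos
    by (intro mult_left_mono sum_mono2) auto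
  finally show ?thesis by (simp add: \<delta>_def)
qed

lemma abs_Dh_bump_le: "\<bar>Dh h i (bump r x\<^sub>0) y\<bar> \<le> 1"
proof -
  let ?a = "y + (h / 2) *\<^sub>R axis i 1" and ?b = "y - (h / 2) *\<^sub>R axis i 1"
  have "?a - ?b = h *\<^sub>R axis i 1" using half_step_twice(1)[of 0 h "axis i 1"] by simp
  then have "dist ?a ?b = h" using h_pos by (simp add: dist_norm norm_axis_1)
  then show ?thesis
    using abs_bump_diff_le[of r x\<^sub>0 ?a ?b] h_pos by (simp add: Dh_def)
qed

lemma mesh_boundary_outside_unit_cube:
  assumes "x \<in> mesh_boundary h"
  shows "x \<notin> unit_cube"
proof
  assume cube: "x \<in> unit_cube"
  obtain k where k: "x \<in> dual h k (dual h k (primal_mesh h))" "x \<notin> primal_mesh h"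
    using assms by (auto simp: mesh_boundary_def)
  then obtain y where y: "y \<in> primal_mesh h"
    and "x = y + h *\<^sub>R axis k 1 \<or> x = y \<or> x = y - h *\<^sub>R axis k 1"
    unfolding dual_def by (auto simp: half_step_twice)
  then obtain s :: int where s: "x = y + (h * of_int s) *\<^sub>R axis k 1"
  proof (elim disjE)
    assume "x = y + h *\<^sub>R axis k 1"
    then show thesis by (intro that[of 1]) simp
  next
    assume "x = y"
    then show thesis by (intro that[of 0]) simp
  next
    assume "x = y - h *\<^sub>R axis k 1"
    then show thesis by (intro that[of "-1"]) simp
  qed
  have "\<exists>l::int. x $ i = h * of_int l" for i
  proof -
    obtain l where "y $ i = h * of_int l" using y by (auto simp: primal_mesh_def)
    then have "x $ i = h * of_int (l + (if i = k then s else 0))"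
      unfolding s by (simp add: axis_def algebra_simps)
    then show ?thesis by blast
  qed
  then show False using k(2) cube by (simp add: primal_mesh_def)
qed

end

lemma drift_cong_local:
  assumes "f x = f' x"
    and "\<And>i. f (x + h *\<^sub>R axis i 1) = f' (x + h *\<^sub>R axis i 1)"
    and "\<And>i. f (x - h *\<^sub>R axis i 1) = f' (x - h *\<^sub>R axis i 1)"
  shows "drift h \<gamma> b1 b2 f x = drift h \<gamma> b1 b2 f' x"
  using assms by (simp add: drift_def Dh_def Ah_def half_step_twice)

text \<open>The drift only sees neighbouring mesh points, so under the cutoff \<open>u\<close> may be replaced by its
  restriction to \<open>G0\<close>.\<close>

lemma (in uniform_mesh) localized_form_drift_restrict:
  fixes u :: "real ^ 'n \<Rightarrow> real"
  assumes G0: "cball x\<^sub>0 (2 * r) \<subseteq> G0" and hr: "h \<le> r"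
  defines "\<phi> \<equiv> \<lambda>x. (bump r x\<^sub>0 x)\<^sup>2" and "v \<equiv> \<lambda>x. if x \<in> G0 then u x else 0"
  shows "localized_form \<phi> \<theta> u (drift h \<gamma> b1 b2 u) = localized_form \<phi> \<theta> v (drift h \<gamma> b1 b2 v)"
proof -
  have in_G0: "x \<in> G0" if "dist x x\<^sub>0 \<le> 2 * r" for x using G0 that by (auto simp: dist_commute)
  have "u x = v x \<and> drift h \<gamma> b1 b2 u x = drift h \<gamma> b1 b2 v x" if "\<phi> x \<noteq> 0" for x
  proof -
    have dist: "dist x x\<^sub>0 < r" using that by (auto simp: \<phi>_def intro: bump_nonzero_imp_dist_less)
    have neighbour: "dist (x + s *\<^sub>R axis i 1) x\<^sub>0 \<le> 2 * r" if "\<bar>s\<bar> \<le> h" for s i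
      using dist_triangle[of "x + s *\<^sub>R axis i 1" x\<^sub>0 x] that dist hr
      by (simp add: dist_norm norm_axis_1)
    have "drift h \<gamma> b1 b2 u x = drift h \<gamma> b1 b2 v x"
      using in_G0 dist neighbour[of h] neighbour[of "- h"] h_nonneg hr
      by (intro drift_cong_local) (auto simp: v_def)
    then show ?thesis using in_G0 dist hr h_pos by (auto simp: v_def)
  qed
  then have weighted: "\<phi> x * u x = \<phi> x * v x"
    "\<phi> x * drift h \<gamma> b1 b2 u x = \<phi> x * drift h \<gamma> b1 b2 v x"
    "\<phi> x * u x * drift h \<gamma> b1 b2 u x = \<phi> x * v x * drift h \<gamma> b1 b2 v x" for x
    by (cases "\<phi> x = 0"; simp)+
  show ?thesis unfolding localized_form_def weighted(3) unfolding weighted(1,2) ..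
qed

lemma (in uniform_mesh) localized_form_drift_le_observation:
  fixes u :: "real ^ 'n \<Rightarrow> real" and x\<^sub>0 :: "real ^ 'n"
  assumes n: "CARD('n) \<ge> 2" and c0: "0 < c0" and K: "0 < K" and \<theta>: "0 < \<theta>"
    and G0: "G0 \<subseteq> unit_cube" and r: "0 < r" "r \<le> 1" "cball x\<^sub>0 (2 * r) \<subseteq> G0" and hr: "h \<le> r"
    and u: "\<And>x. x \<notin> primal_mesh h \<Longrightarrow> u x = 0"
    and \<gamma>: "\<And>i y. y \<in> dual h i (primal_mesh h) \<Longrightarrow> 1 / c0 \<le> \<gamma> i y \<and> \<gamma> i y \<le> c0"
    and b1: "\<And>i x. x \<in> primal_mesh h \<Longrightarrow> \<bar>b1 i x\<bar> \<le> R"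
    and b2: "primal_int (\<lambda>x. \<bar>b2 x\<bar> ^ CARD('n)) \<le> K ^ CARD('n)" "primal_int (\<lambda>x. (b2 x)\<^sup>2) \<le> K\<^sup>2"
  shows "- 2 * localized_form (\<lambda>x. (bump r x\<^sub>0 x)\<^sup>2) \<theta> u (drift h \<gamma> b1 b2 u) \<le>
    drift_constant CARD('n) c0 R K \<theta> * mesh_integral h (G0 \<inter> primal_mesh h) (\<lambda>x. (u x)\<^sup>2)"
proof -
  define v where "v = (\<lambda>x. if x \<in> G0 then u x else 0)"
  interpret localized_drift N h c0 R K "bump r x\<^sub>0" v \<gamma> b1 b2
  proof
    show "bump r x\<^sub>0 x = 0" if x: "x \<in> mesh_boundary h" for x
    proof (rule ccontr)
      assume "bump r x\<^sub>0 x \<noteq> 0"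
      then have "dist x\<^sub>0 x \<le> 2 * r"
        using bump_nonzero_imp_dist_less[of r x\<^sub>0 x] r(1) by (simp add: dist_commute)
      then show False using mesh_boundary_outside_unit_cube[OF x] G0 r(3) by auto
    qed
    show "bump r x\<^sub>0 x \<le> 1" for x using bump_le[of r x\<^sub>0 x] r by simp
    show "v x = 0" if "x \<notin> primal_mesh h" for x using u[OF that] by (simp add: v_def)
  qed (use n c0 K \<gamma> b1 b2 bump_nonneg abs_Dh_bump_le in auto)
  have "- 2 * localized_form \<phi> \<theta> u (drift h \<gamma> b1 b2 u) =
      - 2 * localized_form \<phi> \<theta> v (drift h \<gamma> b1 b2 v)"
    unfolding v_def localized_form_drift_restrict[OF r(3) hr, where u = u] ..
  also have "\<dots> \<le> drift_constant CARD('n) c0 R K \<theta> * mass"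
    by (rule localized_form_drift_le[OF \<theta>])
  also have "mass = mesh_integral h (G0 \<inter> primal_mesh h) (\<lambda>x. (u x)\<^sup>2)"
  proof -
    have "(v x)\<^sup>2 = (if x \<in> G0 then (u x)\<^sup>2 else 0)" for x by (simp add: v_def)
    then show ?thesis
      unfolding mass_def mesh_integral_def
      by (simp add: sum.inter_restrict[OF finite_primal_mesh, symmetric] Int_commute)
  qed
  finally show ?thesis .
qed

section \<open>Pointwise bounds on the diffusion coefficients\<close>

lemma continuous_AE_le_imp_le:
  fixes f :: "'a::euclidean_space \<Rightarrow> real"
  assumes S: "open S" and f: "continuous_on S f" and AE_le: "AE x in lebesgue_on S. f x \<le> c"
    and x: "x \<in> S"
  shows "f x \<le> c"
proof -
  let ?A = "{x \<in> S. c < f x}"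
  have "openin (top_of_set S) (S \<inter> f -` {c<..})"
    by (rule continuous_openin_preimage_gen[OF f]) simp
  moreover have "S \<inter> f -` {c<..} = ?A" by auto
  ultimately have A: "open ?A" using S openin_open_trans by fastforce
  have "AE x in lebesgue. x \<in> S \<longrightarrow> f x \<le> c"
    using AE_le S by (subst (asm) AE_restrict_space_iff) (auto simp: lebesgue_openin)
  then have "AE x in lebesgue. x \<notin> ?A" by eventually_elim auto
  then have "negligible ?A"
    using AE_iff_null_sets[of ?A lebesgue] A by (simp add: negligible_iff_null_sets lebesgue_openin)
  then have "?A = {}" using A open_not_negligible by blast
  then show ?thesis using x by force
qed

lemma open_unit_cube: "open (unit_cube :: (real ^ 'n) set)"
proof -
  have "unit_cube = box 0 (1 :: real ^ 'n)" by (auto simp: unit_cube_def mem_box_cart)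
  then show ?thesis by (metis open_box)
qed

lemma diffusion_coeffs_bounds:
  fixes \<gamma> :: "'n::finite \<Rightarrow> real ^ 'n \<Rightarrow> real"
  assumes \<gamma>: "diffusion_coeffs \<gamma>" and reg: "reg \<gamma> < ereal c0" and x: "x \<in> unit_cube"
  shows "1 / c0 \<le> \<gamma> i x" "\<gamma> i x \<le> c0"
proof -
  have cont: "continuous_on unit_cube (\<gamma> i)" and pos: "\<And>x. x \<in> unit_cube \<Longrightarrow> 0 < \<gamma> i x"
    using \<gamma> by (auto simp: diffusion_coeffs_def)
  let ?F = "\<lambda>x. \<gamma> i x + 1 / \<gamma> i x + (\<Sum>j\<in>UNIV. \<bar>weak_partial unit_cube j (\<gamma> i) x\<bar>\<^sup>2)"
  have "esssup (lebesgue_on unit_cube) (\<lambda>x. ereal (?F x)) \<le> reg \<gamma>"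
    unfolding reg_def by (rule SUP_upper) simp
  then have "esssup (lebesgue_on unit_cube) (\<lambda>x. ereal (?F x)) < ereal c0" using reg by simp
  moreover have "AE x in lebesgue_on unit_cube.
      ereal (?F x) \<le> esssup (lebesgue_on unit_cube) (\<lambda>x. ereal (?F x))" by (rule esssup_AE)
  ultimately have "AE x in lebesgue_on unit_cube. \<gamma> i x + 1 / \<gamma> i x \<le> c0"
  proof (elim eventually_mono)
    fix x assume "ereal (?F x) \<le> esssup (lebesgue_on unit_cube) (\<lambda>x. ereal (?F x))"
    also assume "\<dots> < ereal c0"
    finally have "?F x < c0" by simp
    moreover have "0 \<le> (\<Sum>j\<in>UNIV. \<bar>weak_partial unit_cube j (\<gamma> i) x\<bar>\<^sup>2)" by (intro sum_nonneg) auto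
    ultimately show "\<gamma> i x + 1 / \<gamma> i x \<le> c0" by linarith
  qed
  moreover have "continuous_on unit_cube (\<lambda>x. \<gamma> i x + 1 / \<gamma> i x)"
    using pos by (intro continuous_intros cont) (auto simp: less_le)
  ultimately have sum_le: "\<gamma> i x + 1 / \<gamma> i x \<le> c0"
    using x by (intro continuous_AE_le_imp_le[OF open_unit_cube])
  have "0 < 1 / \<gamma> i x" using pos[OF x] by simp
  then show upper: "\<gamma> i x \<le> c0" using sum_le by linarith
  have "1 / \<gamma> i x \<le> c0" "0 < c0" using sum_le pos[OF x] upper by linarith+
  then show "1 / c0 \<le> \<gamma> i x" using pos[OF x] by (simp add: field_simps)
qed

section \<open>The semi-discrete equation\<close>

lemma drift_cong:
  assumes f: "\<And>y. y \<in> primal_mesh h \<union> mesh_boundary h \<Longrightarrow> f y = f' y" and x: "x \<in> primal_mesh h"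
  shows "drift h \<gamma> b1 b2 f x = drift h \<gamma> b1 b2 f' x"
proof (rule drift_cong_local)
  fix i
  have "x + (h / 2) *\<^sub>R axis i 1 + (h / 2) *\<^sub>R axis i 1 \<in> dual h i (dual h i (primal_mesh h))"
    "x - (h / 2) *\<^sub>R axis i 1 - (h / 2) *\<^sub>R axis i 1 \<in> dual h i (dual h i (primal_mesh h))"
    using x unfolding dual_def by blast+
  then have "x + h *\<^sub>R axis i 1 \<in> primal_mesh h \<union> mesh_boundary h"
    "x - h *\<^sub>R axis i 1 \<in> primal_mesh h \<union> mesh_boundary h"
    unfolding half_step_twice by (auto simp: mesh_boundary_def)
  then show "f (x + h *\<^sub>R axis i 1) = f' (x + h *\<^sub>R axis i 1)"
    "f (x - h *\<^sub>R axis i 1) = f' (x - h *\<^sub>R axis i 1)"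
    using f by blast+
qed (use f x in blast)

lemma drift_diff:
  "drift h \<gamma> b1 b2 (\<lambda>y. f y - f' y) x = drift h \<gamma> b1 b2 f x - drift h \<gamma> b1 b2 f' x"
  unfolding drift_def Dh_diff right_diff_distrib Ah_diff sum_subtractf by simp

lemma drift_measurable:
  assumes f: "\<And>y. (\<lambda>p. f p y) \<in> borel_measurable Q"
    and b: "\<And>i. (\<lambda>p. b1 p i x) \<in> borel_measurable Q" "(\<lambda>p. b2 p x) \<in> borel_measurable Q"
  shows "(\<lambda>p. drift h \<gamma> (b1 p) (b2 p) (f p) x) \<in> borel_measurable Q"
  unfolding drift_def Dh_def Ah_def
  by (intro borel_measurable_add borel_measurable_sum borel_measurable_times
      borel_measurable_divide borel_measurable_diff borel_measurable_const f b)

lemma drift_square_integrable: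
  assumes f: "\<And>y. square_integrable Q (\<lambda>p. f p y)"
    and b: "\<And>i. (\<lambda>p. b1 p i x) \<in> borel_measurable Q" "(\<lambda>p. b2 p x) \<in> borel_measurable Q"
    and bound: "\<And>i. AE p in Q. \<bar>b1 p i x\<bar> \<le> k" "AE p in Q. \<bar>b2 p x\<bar> \<le> l"
  shows "square_integrable Q (\<lambda>p. drift h \<gamma> (b1 p) (b2 p) (f p) x)"
proof -
  have Dh: "square_integrable Q (\<lambda>p. Dh h i (F p) y)"
    if "\<And>y. square_integrable Q (\<lambda>p. F p y)" for F i y
    using square_integrable_cmult[OF square_integrable_diff[OF that that], of "1 / h"]
    by (simp add: Dh_def)
  have Ah: "square_integrable Q (\<lambda>p. Ah h i (F p) y)"
    if "\<And>y. square_integrable Q (\<lambda>p. F p y)" for F i y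
    using square_integrable_cmult[OF square_integrable_add[OF that that], of "1 / 2"]
    by (simp add: Ah_def)
  show ?thesis unfolding drift_def
    by (intro square_integrable_add square_integrable_sum Dh Ah f square_integrable_cmult
        square_integrable_mult_bounded[of _ _ _ k] square_integrable_mult_bounded[of _ _ _ l]
        b bound)
qed

lemma component_power2_le_mesh_integral:
  fixes f :: "real ^ 'n \<Rightarrow> real"
  assumes "0 \<le> h" "finite W" "x \<in> W"
  shows "h ^ CARD('n) * (f x)\<^sup>2 \<le> mesh_integral h W (\<lambda>x. (f x)\<^sup>2)"
  unfolding mesh_integral_def using assms by (intro mult_left_mono member_le_sum) auto

lemma L2_norm_power2_le_H1_norm: "0 \<le> h \<Longrightarrow> (L2_norm h (primal_mesh h) f)\<^sup>2 \<le> (H1_norm h f)\<^sup>2"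
  unfolding H1_norm_def
  by (subst real_sqrt_pow2) (auto intro!: add_nonneg_nonneg sum_nonneg mesh_integral_nonneg)

lemma (in brownian) L2F_component_square_integrable:
  fixes u :: "real \<Rightarrow> 'w \<Rightarrow> real ^ 'n \<Rightarrow> real"
  assumes u: "u \<in> L2F M F T P nrm" and x: "x \<in> P" and c: "0 < c" "\<And>f. c * (f x)\<^sup>2 \<le> (nrm f)\<^sup>2"
  shows "square_integrable (PT T) (\<lambda>(t, \<omega>). u t \<omega> x)"
  unfolding square_integrable_iff_nn_integral
proof
  show measurable: "(\<lambda>(t, \<omega>). u t \<omega> x) \<in> borel_measurable (PT T)"
    using u x by (auto simp: L2F_def adapted_process_def)
  then have square_measurable:
    "(\<lambda>(t, \<omega>). ennreal c * ennreal ((u t \<omega> x)\<^sup>2)) \<in> borel_measurable (PT T)"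
    unfolding case_prod_unfold by measurable
  have "ennreal c * (\<integral>\<^sup>+p. ennreal ((case p of (t, \<omega>) \<Rightarrow> u t \<omega> x)\<^sup>2) \<partial>PT T) =
      (\<integral>\<^sup>+(t, \<omega>). ennreal c * ennreal ((u t \<omega> x)\<^sup>2) \<partial>PT T)"
    using measurable by (simp add: case_prod_unfold nn_integral_cmult)
  also have "\<dots> = (\<integral>\<^sup>+\<omega>. (\<integral>\<^sup>+t\<in>{0..T}. ennreal c * ennreal ((u t \<omega> x)\<^sup>2) \<partial>lborel) \<partial>M)"
    by (rule nn_integral_PT[OF square_measurable, symmetric])
  also have "\<dots> \<le> L2F_sq M T nrm u"
    unfolding L2F_sq_def using c
    by (intro nn_integral_mono mult_right_mono)
      (auto simp flip: ennreal_mult intro!: ennreal_leI)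
  also have "\<dots> < \<infinity>" using u by (simp add: L2F_def)
  finally show "(\<integral>\<^sup>+p. ennreal ((case p of (t, \<omega>) \<Rightarrow> u t \<omega> x)\<^sup>2) \<partial>PT T) < \<infinity>"
    using c by (auto simp: ennreal_mult_less_top)
qed

lemma (in uniform_mesh) primal_int_power_le_Lp_norm:
  fixes f :: "real ^ 'n \<Rightarrow> real"
  assumes p: "real k \<le> p" "0 < k" and f: "Lp_norm p h (primal_mesh h) f \<le> R"
  shows "primal_int (\<lambda>x. \<bar>f x\<bar> ^ k) \<le> 1 + (max R 1) powr p"
proof -
  have p_pos: "0 < p" using p by linarith
  have "0 \<le> primal_int (\<lambda>x. \<bar>f x\<bar> powr p)" by (intro mesh_integral_nonneg h_nonneg) auto
  then have "primal_int (\<lambda>x. \<bar>f x\<bar> powr p) = (Lp_norm p h (primal_mesh h) f) powr p"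
    using p_pos by (simp add: Lp_norm_def powr_powr)
  also have "\<dots> \<le> (max R 1) powr p"
    using f p_pos by (intro powr_mono2) (auto simp: Lp_norm_def)
  finally have int_powr: "primal_int (\<lambda>x. \<bar>f x\<bar> powr p) \<le> (max R 1) powr p" .
  have "\<bar>s\<bar> ^ k \<le> 1 + \<bar>s\<bar> powr p" for s :: real
  proof (cases "\<bar>s\<bar> \<le> 1")
    case True
    then have "\<bar>s\<bar> ^ k \<le> 1" by (intro power_le_one) auto
    moreover have "0 \<le> \<bar>s\<bar> powr p" by simp
    ultimately show ?thesis by linarith
  next
    case False
    then have "\<bar>s\<bar> ^ k = \<bar>s\<bar> powr real k" by (subst powr_realpow) auto
    also have "\<dots> \<le> \<bar>s\<bar> powr p" using False p by (intro powr_mono) auto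
    finally show ?thesis by simp
  qed
  then have "primal_int (\<lambda>x. \<bar>f x\<bar> ^ k) \<le> primal_int (\<lambda>x. 1 + \<bar>f x\<bar> powr p)"
    by (intro mesh_integral_mono h_nonneg)
  then show ?thesis
    using int_powr primal_int_one_le[where 'n = 'n] unfolding mesh_integral_add by linarith
qed

definition (in uniform_mesh) zero_ext :: "(real ^ 'n \<Rightarrow> real) \<Rightarrow> real ^ 'n \<Rightarrow> real" where
  "zero_ext f x = (if x \<in> primal_mesh h then f x else 0)"

lemma (in uniform_mesh) zero_ext_diff:
  "zero_ext (\<lambda>x. f x - g x) = (\<lambda>x. zero_ext f x - zero_ext g x)"
  by (auto simp: zero_ext_def)

definition potential_bound :: "real \<Rightarrow> real \<Rightarrow> real" where
  "potential_bound p R = 1 + (max R 1) powr p"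

lemma potential_bound_ge_1: "1 \<le> potential_bound p R"
  by (simp add: potential_bound_def)

locale semidiscrete_problem = brownian M B + uniform_mesh N h
  for M :: "'w measure" and B N h +
  fixes T c0 nstar R :: real and \<gamma> :: "'n::finite \<Rightarrow> real ^ 'n \<Rightarrow> real"
    and a1 :: "'n \<Rightarrow> real \<Rightarrow> 'w \<Rightarrow> real ^ 'n \<Rightarrow> real" and a2 :: "real \<Rightarrow> 'w \<Rightarrow> real ^ 'n \<Rightarrow> real"
  assumes T_pos: "0 < T" and N_pos: "0 < N"
    and nstar: "2 \<le> nstar" "real CARD('n) \<le> nstar"
    and \<gamma>: "diffusion_coeffs \<gamma>" "reg \<gamma> < ereal c0"
    and a1: "\<And>i. a1 i \<in> LinfF M Filt T (primal_mesh h) (Linf_norm (primal_mesh h))"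
      "\<And>i. LinfF_norm M T (Linf_norm (primal_mesh h)) (a1 i) \<le> ereal R"
    and a2: "a2 \<in> LinfF M Filt T (primal_mesh h) (Lp_norm nstar h (primal_mesh h))"
      "LinfF_norm M T (Lp_norm nstar h (primal_mesh h)) a2 \<le> ereal R"
begin

abbreviation drift_at :: "real \<Rightarrow> 'w \<Rightarrow> (real ^ 'n \<Rightarrow> real) \<Rightarrow> real ^ 'n \<Rightarrow> real" where
  "drift_at t \<omega> f \<equiv> drift h \<gamma> (\<lambda>i. a1 i t \<omega>) (a2 t \<omega>) f"

abbreviation K :: real where
  "K \<equiv> potential_bound nstar R"

lemma terminal_time: "T \<in> {0..T}"
  using T_pos by simp

lemma \<gamma>_dual_bounds: "y \<in> dual h i (primal_mesh h) \<Longrightarrow> 1 / c0 \<le> \<gamma> i y \<and> \<gamma> i y \<le> c0"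
  using diffusion_coeffs_bounds[OF \<gamma>] dual_subset_unit_cube by blast

lemma a1_bound: "AE p in PT T. \<forall>i. \<forall>x\<in>primal_mesh h. \<bar>a1 i (fst p) (snd p) x\<bar> \<le> R"
proof -
  have "AE p in PT T. \<forall>x\<in>primal_mesh h. \<bar>a1 i (fst p) (snd p) x\<bar> \<le> R" for i
  proof -
    have "AE p in PT T. (case p of (t, \<omega>) \<Rightarrow> ereal (Linf_norm (primal_mesh h) (a1 i t \<omega>)))
        \<le> LinfF_norm M T (Linf_norm (primal_mesh h)) (a1 i)"
      unfolding LinfF_norm_def by (rule esssup_AE)
    then show ?thesis
    proof eventually_elim
      case (elim p)
      from order_trans[OF this[unfolded case_prod_unfold] a1(2)[of i]]
      have "Max ((\<lambda>x. \<bar>a1 i (fst p) (snd p) x\<bar>) ` primal_mesh h) \<le> R" by (simp add: Linf_norm_def)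
      then show ?case
        using finite_primal_mesh primal_mesh_nonempty[OF N_pos] by (subst (asm) Max_le_iff) auto
    qed
  qed
  then show ?thesis by (simp add: AE_all_countable)
qed

lemma a2_bound:
  "AE p in PT T. primal_int (\<lambda>x. \<bar>a2 (fst p) (snd p) x\<bar> ^ CARD('n)) \<le> K ^ CARD('n) \<and>
     primal_int (\<lambda>x. (a2 (fst p) (snd p) x)\<^sup>2) \<le> K\<^sup>2"
proof -
  have "AE p in PT T. (case p of (t, \<omega>) \<Rightarrow> ereal (Lp_norm nstar h (primal_mesh h) (a2 t \<omega>)))
      \<le> LinfF_norm M T (Lp_norm nstar h (primal_mesh h)) a2"
    unfolding LinfF_norm_def by (rule esssup_AE)
  then show ?thesis
  proof eventually_elim
    case (elim p)
    from order_trans[OF this[unfolded case_prod_unfold] a2(2)]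
    have norm: "Lp_norm nstar h (primal_mesh h) (a2 (fst p) (snd p)) \<le> R" by simp
    have "primal_int (\<lambda>x. \<bar>a2 (fst p) (snd p) x\<bar> ^ k) \<le> K ^ k" if "0 < k" "real k \<le> nstar" for k
      using primal_int_power_le_Lp_norm[OF that(2,1) norm]
        self_le_power[OF potential_bound_ge_1 that(1), of nstar R]
      unfolding potential_bound_def by linarith
    from this[of "CARD('n)"] this[of 2] show ?case using nstar by simp
  qed
qed

lemma a2_component_bound:
  assumes x: "x \<in> primal_mesh h"
  shows "AE p in PT T. \<bar>a2 (fst p) (snd p) x\<bar> \<le> sqrt (K\<^sup>2 / h ^ CARD('n))"
  using a2_bound
proof eventually_elim
  case (elim p)
  then have "h ^ CARD('n) * (a2 (fst p) (snd p) x)\<^sup>2 \<le> K\<^sup>2"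
    using component_power2_le_mesh_integral[OF h_nonneg finite_primal_mesh x] order_trans by blast
  then have "(a2 (fst p) (snd p) x)\<^sup>2 \<le> K\<^sup>2 / h ^ CARD('n)"
    using h_pos by (simp add: pos_le_divide_eq mult.commute)
  then show ?case using real_sqrt_le_mono by fastforce
qed

lemma drift_at_L2_adapted:
  assumes f: "\<And>y. L2_adapted T (\<lambda>t \<omega>. f t \<omega> y)" and x: "x \<in> primal_mesh h"
  shows "L2_adapted T (\<lambda>t \<omega>. drift_at t \<omega> (f t \<omega>) x)"
proof -
  have "square_integrable (PT T) (\<lambda>p. drift h \<gamma> (\<lambda>i. a1 i (fst p) (snd p)) (a2 (fst p) (snd p))
      (f (fst p) (snd p)) x)"
  proof (rule drift_square_integrable)
    show "AE p in PT T. \<bar>a1 i (fst p) (snd p) x\<bar> \<le> R" for i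
      using a1_bound by eventually_elim (use x in blast)
    show "AE p in PT T. \<bar>a2 (fst p) (snd p) x\<bar> \<le> sqrt (K\<^sup>2 / h ^ CARD('n))"
      by (rule a2_component_bound[OF x])
  qed (use f a1(1) a2(1) x in
      \<open>auto simp: L2_adapted_def LinfF_def adapted_process_def case_prod_unfold\<close>)
  moreover have "(\<lambda>\<omega>. drift_at t \<omega> (f t \<omega>) x) \<in> borel_measurable (Filt t)" if "t \<in> {0..T}" for t
    by (rule drift_measurable)
      (use f a1(1) a2(1) x that in \<open>auto simp: L2_adapted_def LinfF_def adapted_process_def\<close>)
  ultimately show ?thesis by (simp add: L2_adapted_def case_prod_unfold)
qed

text \<open>The values of a solution on the boundary are zero only on the open time interval and need not
  be measurable, so the solution is replaced by its extension by zero from the mesh.\<close>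

lemma zero_ext_solution_L2_adapted:
  assumes "is_solution M B T h \<gamma> a1 a2 g w0 w"
  shows "L2_adapted T (\<lambda>t \<omega>. zero_ext (w t \<omega>) y)"
proof (cases "y \<in> primal_mesh h")
  case True
  have w: "w \<in> L2F M Filt T (primal_mesh h) (L2_norm h (primal_mesh h))"
    using assms by (simp add: is_solution_def)
  have "square_integrable (PT T) (\<lambda>(t, \<omega>). w t \<omega> y)"
    using L2F_component_square_integrable[OF w True, of "h ^ CARD('n)"] h_pos
      component_power2_le_mesh_integral[OF h_nonneg finite_primal_mesh True]
    by (simp add: L2_norm_square)
  then show ?thesis
    using w True by (auto simp: L2_adapted_def zero_ext_def L2F_def adapted_process_def)
next
  case False
  then show ?thesis
    using square_integrable_zero[of "PT T"]
    by (simp add: L2_adapted_def zero_ext_def case_prod_unfold)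
qed

lemma solution_drift_integral:
  assumes boundary: "\<forall>t\<in>{0<..<T}. \<forall>x\<in>mesh_boundary h. w t \<omega> x = 0"
    and t: "t \<in> {0..T}" and x: "x \<in> primal_mesh h"
  shows "(LINT s:{0..t}|lborel. drift_at s \<omega> (w s \<omega>) x) =
    time_integral T (\<lambda>s \<omega>. drift_at s \<omega> (zero_ext (w s \<omega>)) x) t \<omega>"
proof -
  have "(LINT s:{0..t}|lborel. drift_at s \<omega> (w s \<omega>) x) =
      (LINT s:{0..t}|lborel. drift_at s \<omega> (zero_ext (w s \<omega>)) x)"
    unfolding set_lebesgue_integral_def
  proof (rule integral_discrete_difference[of "{0, T}"])
    fix s assume s: "s \<notin> {0, T}"
    show "indicator {0..t} s *\<^sub>R drift_at s \<omega> (w s \<omega>) x =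
        indicator {0..t} s *\<^sub>R drift_at s \<omega> (zero_ext (w s \<omega>)) x"
    proof (cases "s \<in> {0..t}")
      case True
      then have "s \<in> {0<..<T}" using s t by auto
      then have "drift_at s \<omega> (w s \<omega>) x = drift_at s \<omega> (zero_ext (w s \<omega>)) x"
        using boundary x by (intro drift_cong) (auto simp: zero_ext_def)
      then show ?thesis by simp
    qed simp
  qed auto
  also have "\<dots> = time_integral T (\<lambda>s \<omega>. drift_at s \<omega> (zero_ext (w s \<omega>)) x) t \<omega>"
    using t by (intro set_integral_eq_time_integral) auto
  finally show ?thesis .
qed

lemma solution_ito_process:
  assumes sol: "is_solution M B T h \<gamma> a1 a2 g w0 w" and x: "x \<in> primal_mesh h"
    and g: "square_integrable (PT T) (\<lambda>(t, \<omega>). g t \<omega> x)"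
  obtains Y where "\<And>t. t \<in> {0..T} \<Longrightarrow> L2_ito_integral t (\<lambda>s \<omega>. g s \<omega> x) (Y t)"
    and "ito_process T (\<lambda>\<omega>. w0 \<omega> x) (\<lambda>t \<omega>. zero_ext (w t \<omega>) x)
      (\<lambda>t \<omega>. drift_at t \<omega> (zero_ext (w t \<omega>)) x) Y"
proof -
  have boundary: "AE \<omega> in M. \<forall>t\<in>{0<..<T}. \<forall>x\<in>mesh_boundary h. w t \<omega> x = 0"
    and init: "AE \<omega> in M. \<forall>x\<in>primal_mesh h. w 0 \<omega> x = w0 \<omega> x"
    and integral_eq: "\<forall>t\<in>{0..T}. \<exists>Y. has_ito_integral M Filt B t (\<lambda>s \<omega>. g s \<omega> x) Y \<and>
      (AE \<omega> in M. w t \<omega> x = w 0 \<omega> x + (LINT s:{0..t}|lborel. drift_at s \<omega> (w s \<omega>) x) + Y \<omega>)"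
    using sol x unfolding is_solution_def by auto
  from bchoice[OF integral_eq] obtain Y where
    Y: "\<forall>t\<in>{0..T}. has_ito_integral M Filt B t (\<lambda>s \<omega>. g s \<omega> x) (Y t) \<and>
      (AE \<omega> in M. w t \<omega> x = w 0 \<omega> x + (LINT s:{0..t}|lborel. drift_at s \<omega> (w s \<omega>) x) + Y t \<omega>)"
    by blast
  have L2_ito: "L2_ito_integral t (\<lambda>s \<omega>. g s \<omega> x) (Y t)" if "t \<in> {0..T}" for t
    using Y square_integrable_PT_mono(1)[OF g] that by (simp add: L2_ito_integral_def)
  note adapted = zero_ext_solution_L2_adapted[OF sol]
    and martingale = L2_ito_integral_weak_martingale[OF L2_ito]
  have "AE \<omega> in M. zero_ext (w t \<omega>) x = w0 \<omega> x
      + time_integral T (\<lambda>t \<omega>. drift_at t \<omega> (zero_ext (w t \<omega>)) x) t \<omega> + Y t \<omega>"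
    if t: "t \<in> {0..T}" for t
    using bspec[OF Y t, THEN conjunct2] boundary init
  proof eventually_elim
    case (elim \<omega>)
    then show ?case
      using solution_drift_integral[of w \<omega>, OF elim(2) t x] x by (simp add: zero_ext_def)
  qed
  then have "ito_process T (\<lambda>\<omega>. w0 \<omega> x) (\<lambda>t \<omega>. zero_ext (w t \<omega>) x)
      (\<lambda>t \<omega>. drift_at t \<omega> (zero_ext (w t \<omega>)) x) Y"
    unfolding ito_process_def
    by (intro conjI ballI adapted drift_at_L2_adapted x martingale)
  with L2_ito show thesis by (rule that)
qed

end

locale source_pair = semidiscrete_problem M B N h T c0 nstar R \<gamma> a1 a2
  for M :: "'w measure" and B N h T c0 nstar R and \<gamma> :: "'n::finite \<Rightarrow> real ^ 'n \<Rightarrow> real" and a1 a2 +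
  fixes g1 g2 w1 w2 :: "real \<Rightarrow> 'w \<Rightarrow> real ^ 'n \<Rightarrow> real" and w0 :: "'w \<Rightarrow> real ^ 'n \<Rightarrow> real"
  assumes sources: "g1 \<in> L2F M Filt T (primal_mesh h \<union> mesh_boundary h) (H1_norm h)"
      "g2 \<in> L2F M Filt T (primal_mesh h \<union> mesh_boundary h) (H1_norm h)"
    and solutions: "is_solution M B T h \<gamma> a1 a2 g1 w0 w1" "is_solution M B T h \<gamma> a1 a2 g2 w0 w2"
begin

definition source_diff :: "real \<Rightarrow> 'w \<Rightarrow> real ^ 'n \<Rightarrow> real" where
  "source_diff t \<omega> x = g1 t \<omega> x - g2 t \<omega> x"

definition solution_diff :: "real \<Rightarrow> 'w \<Rightarrow> real ^ 'n \<Rightarrow> real" where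
  "solution_diff t \<omega> = zero_ext (\<lambda>x. w1 t \<omega> x - w2 t \<omega> x)"

lemma source_square_integrable:
  assumes x: "x \<in> primal_mesh h"
  shows "square_integrable (PT T) (\<lambda>(t, \<omega>). g1 t \<omega> x)"
    "square_integrable (PT T) (\<lambda>(t, \<omega>). g2 t \<omega> x)"
    "square_integrable (PT T) (\<lambda>(t, \<omega>). source_diff t \<omega> x)"
proof -
  have component_le: "h ^ CARD('n) * (f x)\<^sup>2 \<le> (H1_norm h f)\<^sup>2" for f :: "real ^ 'n \<Rightarrow> real"
    using component_power2_le_mesh_integral[OF h_nonneg finite_primal_mesh x, of f]
      L2_norm_power2_le_H1_norm[OF h_nonneg, of f] h_nonneg by (simp add: L2_norm_square)
  show g1: "square_integrable (PT T) (\<lambda>(t, \<omega>). g1 t \<omega> x)"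
    and g2: "square_integrable (PT T) (\<lambda>(t, \<omega>). g2 t \<omega> x)"
    using sources[THEN L2F_component_square_integrable, of x "h ^ CARD('n)"] component_le h_pos x
    by auto
  show "square_integrable (PT T) (\<lambda>(t, \<omega>). source_diff t \<omega> x)"
    using square_integrable_diff_case_prod[OF g1 g2] by (simp add: source_diff_def)
qed

lemma solution_diff_eq: "solution_diff t \<omega> = (\<lambda>x. zero_ext (w1 t \<omega>) x - zero_ext (w2 t \<omega>) x)"
  by (simp add: solution_diff_def zero_ext_diff)

lemma solution_diff_L2_adapted: "L2_adapted T (\<lambda>t \<omega>. solution_diff t \<omega> y)"
  unfolding solution_diff_eq
  by (rule L2_adapted_diff[OF solutions[THEN zero_ext_solution_L2_adapted]])

lemma drift_solution_diff_L2_adapted: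
  "x \<in> primal_mesh h \<Longrightarrow> L2_adapted T (\<lambda>t \<omega>. drift_at t \<omega> (solution_diff t \<omega>) x)"
  by (intro drift_at_L2_adapted solution_diff_L2_adapted)

lemma solution_diff_ito_process:
  assumes x: "x \<in> primal_mesh h"
  obtains Y1 Y2 where "L2_ito_integral T (\<lambda>s \<omega>. g1 s \<omega> x) (Y1 T)"
    and "L2_ito_integral T (\<lambda>s \<omega>. g2 s \<omega> x) (Y2 T)"
    and "ito_process T (\<lambda>_. 0) (\<lambda>t \<omega>. solution_diff t \<omega> x)
      (\<lambda>t \<omega>. drift_at t \<omega> (solution_diff t \<omega>) x) (\<lambda>t \<omega>. Y1 t \<omega> - Y2 t \<omega>)"
proof -
  obtain Y1 where Y1: "\<And>t. t \<in> {0..T} \<Longrightarrow> L2_ito_integral t (\<lambda>s \<omega>. g1 s \<omega> x) (Y1 t)"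
    "ito_process T (\<lambda>\<omega>. w0 \<omega> x) (\<lambda>t \<omega>. zero_ext (w1 t \<omega>) x)
      (\<lambda>t \<omega>. drift_at t \<omega> (zero_ext (w1 t \<omega>)) x) Y1"
    using solution_ito_process[OF solutions(1) x source_square_integrable(1)[OF x]] by blast
  obtain Y2 where Y2: "\<And>t. t \<in> {0..T} \<Longrightarrow> L2_ito_integral t (\<lambda>s \<omega>. g2 s \<omega> x) (Y2 t)"
    "ito_process T (\<lambda>\<omega>. w0 \<omega> x) (\<lambda>t \<omega>. zero_ext (w2 t \<omega>) x)
      (\<lambda>t \<omega>. drift_at t \<omega> (zero_ext (w2 t \<omega>)) x) Y2"
    using solution_ito_process[OF solutions(2) x source_square_integrable(2)[OF x]] by blast
  have "ito_process T (\<lambda>_. 0) (\<lambda>t \<omega>. solution_diff t \<omega> x)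
      (\<lambda>t \<omega>. drift_at t \<omega> (solution_diff t \<omega>) x) (\<lambda>t \<omega>. Y1 t \<omega> - Y2 t \<omega>)"
    unfolding solution_diff_eq drift_diff by (rule ito_process_diff[OF Y1(2) Y2(2)])
  with Y1(1)[OF terminal_time] Y2(1)[OF terminal_time] show thesis by (rule that)
qed

lemma solution_diff_terminal_square_integrable:
  assumes x: "x \<in> primal_mesh h"
  shows "square_integrable M (\<lambda>\<omega>. solution_diff T \<omega> x)"
proof -
  obtain Y1 Y2 where "ito_process T (\<lambda>_. 0) (\<lambda>t \<omega>. solution_diff t \<omega> x)
      (\<lambda>t \<omega>. drift_at t \<omega> (solution_diff t \<omega>) x) (\<lambda>t \<omega>. Y1 t \<omega> - Y2 t \<omega>)"
    by (rule solution_diff_ito_process[OF x])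
  then show ?thesis by (rule ito_process_terminal_square_integrable[rotated]) (use T_pos in simp)
qed

lemma solution_diff_ito_identity:
  assumes x: "x \<in> primal_mesh h" and y: "y \<in> primal_mesh h"
  shows "(\<integral>\<omega>. solution_diff T \<omega> x * solution_diff T \<omega> y \<partial>M) =
    (\<integral>(t, \<omega>). source_diff t \<omega> x * source_diff t \<omega> y \<partial>PT T) +
    (\<integral>(t, \<omega>). solution_diff t \<omega> x * drift_at t \<omega> (solution_diff t \<omega>) y +
      solution_diff t \<omega> y * drift_at t \<omega> (solution_diff t \<omega>) x \<partial>PT T)"
proof -
  obtain Y1 Y2 where Y: "L2_ito_integral T (\<lambda>s \<omega>. g1 s \<omega> x) (Y1 T)"
      "L2_ito_integral T (\<lambda>s \<omega>. g2 s \<omega> x) (Y2 T)"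
    and Y_process: "ito_process T (\<lambda>_. 0) (\<lambda>t \<omega>. solution_diff t \<omega> x)
      (\<lambda>t \<omega>. drift_at t \<omega> (solution_diff t \<omega>) x) (\<lambda>t \<omega>. Y1 t \<omega> - Y2 t \<omega>)"
    by (rule solution_diff_ito_process[OF x])
  obtain Z1 Z2 where Z: "L2_ito_integral T (\<lambda>s \<omega>. g1 s \<omega> y) (Z1 T)"
      "L2_ito_integral T (\<lambda>s \<omega>. g2 s \<omega> y) (Z2 T)"
    and Z_process: "ito_process T (\<lambda>_. 0) (\<lambda>t \<omega>. solution_diff t \<omega> y)
      (\<lambda>t \<omega>. drift_at t \<omega> (solution_diff t \<omega>) y) (\<lambda>t \<omega>. Z1 t \<omega> - Z2 t \<omega>)"
    by (rule solution_diff_ito_process[OF y])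
  have "(\<integral>\<omega>. (Y1 T \<omega> - Y2 T \<omega>) * (Z1 T \<omega> - Z2 T \<omega>) \<partial>M) =
      (\<integral>(t, \<omega>). source_diff t \<omega> x * source_diff t \<omega> y \<partial>PT T)"
    unfolding source_diff_def by (rule ito_isometry_diff[OF Y Z])
  then show ?thesis
    using ito_product_rule[OF _ Y_process Z_process] T_pos by simp
qed

end

section \<open>The Ito identity for the localized form\<close>

context uniform_mesh
begin

lemma localized_form_commute: "localized_form \<phi> \<theta> f g = localized_form \<phi> \<theta> g f"
  by (simp add: localized_form_def mult_ac)

definition form_kernel :: "(real ^ 'n \<Rightarrow> real) \<Rightarrow> real \<Rightarrow> real ^ 'n \<Rightarrow> real ^ 'n \<Rightarrow> real" where
  "form_kernel \<phi> \<theta> x y =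
     (h ^ CARD('n))\<^sup>2 * \<phi> x * \<phi> y - (if x = y then \<theta> * h ^ CARD('n) * \<phi> x else 0)"

lemma localized_form_eq_double_sum:
  fixes f g \<phi> :: "real ^ 'n \<Rightarrow> real"
  shows "localized_form \<phi> \<theta> f g =
    (\<Sum>x\<in>primal_mesh h. \<Sum>y\<in>primal_mesh h. form_kernel \<phi> \<theta> x y * (f x * g y))"
proof -
  let ?W = "primal_mesh h :: (real ^ 'n) set" and ?m = "h ^ CARD('n)"
  have "(\<Sum>x\<in>?W. \<Sum>y\<in>?W. form_kernel \<phi> \<theta> x y * (f x * g y)) =
      (\<Sum>x\<in>?W. \<Sum>y\<in>?W. ?m\<^sup>2 * ((\<phi> x * f x) * (\<phi> y * g y)))
      - (\<Sum>x\<in>?W. \<Sum>y\<in>?W. if x = y then \<theta> * ?m * (\<phi> x * f x * g x) else 0)"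
    unfolding form_kernel_def sum_subtractf[symmetric]
    by (intro sum.cong refl) (auto simp: algebra_simps)
  also have "(\<Sum>x\<in>?W. \<Sum>y\<in>?W. ?m\<^sup>2 * ((\<phi> x * f x) * (\<phi> y * g y))) =
      ?m\<^sup>2 * ((\<Sum>x\<in>?W. \<phi> x * f x) * (\<Sum>x\<in>?W. \<phi> x * g x))"
    by (subst sum_product) (simp only: sum_distrib_left)
  also have "(\<Sum>x\<in>?W. \<Sum>y\<in>?W. if x = y then \<theta> * ?m * (\<phi> x * f x * g x) else 0) =
      \<theta> * (?m * (\<Sum>x\<in>?W. \<phi> x * f x * g x))"
    using finite_primal_mesh[where 'a = 'n] by (simp add: sum_distrib_left mult_ac)
  finally show ?thesis
    by (simp add: localized_form_def mesh_integral_def power2_eq_square mult_ac)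
qed

lemma integrable_localized_form:
  assumes "\<And>x y. x \<in> primal_mesh h \<Longrightarrow> y \<in> primal_mesh h \<Longrightarrow> integrable Q (\<lambda>p. f p x * g p y)"
  shows "integrable Q (\<lambda>p. localized_form \<phi> \<theta> (f p) (g p))"
  unfolding localized_form_eq_double_sum
  using assms by (intro Bochner_Integration.integrable_sum integrable_mult_right)

lemma integral_localized_form:
  assumes "\<And>x y. x \<in> primal_mesh h \<Longrightarrow> y \<in> primal_mesh h \<Longrightarrow> integrable Q (\<lambda>p. f p x * g p y)"
  shows "(\<integral>p. localized_form \<phi> \<theta> (f p) (g p) \<partial>Q) =
    (\<Sum>x\<in>primal_mesh h. \<Sum>y\<in>primal_mesh h. form_kernel \<phi> \<theta> x y * (\<integral>p. f p x * g p y \<partial>Q))"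
  unfolding localized_form_eq_double_sum
  using assms by (subst integral_double_sum) auto

lemma localized_form_le_primal_int:
  assumes \<phi>: "\<And>x. 0 \<le> \<phi> x" "\<And>x. \<phi> x \<le> 1" and \<theta>: "0 \<le> \<theta>"
  shows "localized_form \<phi> \<theta> f f \<le> primal_int (\<lambda>x. (f x)\<^sup>2)"
proof -
  have "\<bar>\<phi> x\<bar> \<le> 1" for x using \<phi>[of x] by simp
  then have "(primal_int (\<lambda>x. \<phi> x * f x))\<^sup>2 \<le> primal_int (\<lambda>x. (f x)\<^sup>2)"
    by (rule primal_int_bounded_mult_power2_le)
  moreover have "0 \<le> primal_int (\<lambda>x. \<phi> x * f x * f x)"
    using \<phi>(1) by (intro mesh_integral_nonneg h_nonneg) (simp add: mult.assoc)
  then have "0 \<le> \<theta> * primal_int (\<lambda>x. \<phi> x * f x * f x)" using \<theta> by simp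
  ultimately show ?thesis unfolding localized_form_def power2_eq_square by linarith
qed

end

lemma integrable_mesh_integral_power2:
  assumes "\<And>x. x \<in> W \<Longrightarrow> square_integrable Q (\<lambda>p. f p x)"
  shows "integrable Q (\<lambda>p. mesh_integral h W (\<lambda>x. (f p x)\<^sup>2))"
  unfolding mesh_integral_def using assms
  by (intro integrable_mult_right Bochner_Integration.integrable_sum)
    (simp add: square_integrable_def)

context source_pair
begin

lemma localized_form_ito_identity:
  "(\<integral>\<omega>. localized_form \<phi> \<theta> (solution_diff T \<omega>) (solution_diff T \<omega>) \<partial>M) =
    (\<integral>(t, \<omega>). localized_form \<phi> \<theta> (source_diff t \<omega>) (source_diff t \<omega>) \<partial>PT T) +
    2 * (\<integral>(t, \<omega>). localized_form \<phi> \<theta> (solution_diff t \<omega>) (drift_at t \<omega> (solution_diff t \<omega>)) \<partial>PT T)"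
proof -
  let ?W = "primal_mesh h :: (real ^ 'n) set"
  let ?u = "\<lambda>(t, \<omega>). solution_diff t \<omega>" and ?g = "\<lambda>(t, \<omega>). source_diff t \<omega>"
    and ?b = "\<lambda>(t, \<omega>). drift_at t \<omega> (solution_diff t \<omega>)"
  let ?k = "form_kernel \<phi> \<theta>"
  have u_sq: "square_integrable (PT T) (\<lambda>p. ?u p x)" for x
    using solution_diff_L2_adapted[of x] by (simp add: L2_adapted_def case_prod_unfold)
  have g_sq: "square_integrable (PT T) (\<lambda>p. ?g p x)"
    and b_sq: "square_integrable (PT T) (\<lambda>p. ?b p x)" if "x \<in> ?W" for x
    using source_square_integrable(3)[OF that] drift_solution_diff_L2_adapted[OF that]
    by (simp_all add: L2_adapted_def case_prod_unfold)
  note int = integrable_mult_square_integrable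
  have "(\<integral>\<omega>. localized_form \<phi> \<theta> (solution_diff T \<omega>) (solution_diff T \<omega>) \<partial>M) =
      (\<Sum>x\<in>?W. \<Sum>y\<in>?W. ?k x y * (\<integral>\<omega>. solution_diff T \<omega> x * solution_diff T \<omega> y \<partial>M))"
    by (intro integral_localized_form int solution_diff_terminal_square_integrable)
  also have "\<dots> = (\<Sum>x\<in>?W. \<Sum>y\<in>?W. ?k x y * (\<integral>p. ?g p x * ?g p y \<partial>PT T)
      + (?k x y * (\<integral>p. ?u p x * ?b p y \<partial>PT T) + ?k x y * (\<integral>p. ?b p x * ?u p y \<partial>PT T)))"
  proof (intro sum.cong refl)
    fix x y assume x: "x \<in> ?W" and y: "y \<in> ?W"
    have "(\<integral>p. ?u p x * ?b p y + ?b p x * ?u p y \<partial>PT T) =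
        (\<integral>p. ?u p x * ?b p y \<partial>PT T) + (\<integral>p. ?b p x * ?u p y \<partial>PT T)"
      by (intro Bochner_Integration.integral_add int u_sq b_sq x y)
    then show "?k x y * (\<integral>\<omega>. solution_diff T \<omega> x * solution_diff T \<omega> y \<partial>M) =
        ?k x y * (\<integral>p. ?g p x * ?g p y \<partial>PT T)
        + (?k x y * (\<integral>p. ?u p x * ?b p y \<partial>PT T) + ?k x y * (\<integral>p. ?b p x * ?u p y \<partial>PT T))"
      unfolding solution_diff_ito_identity[OF x y]
      by (simp add: case_prod_unfold distrib_left mult.commute)
  qed
  also have "\<dots> = (\<integral>p. localized_form \<phi> \<theta> (?g p) (?g p) \<partial>PT T)
      + ((\<integral>p. localized_form \<phi> \<theta> (?u p) (?b p) \<partial>PT T)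
        + (\<integral>p. localized_form \<phi> \<theta> (?b p) (?u p) \<partial>PT T))"
    by (simp add: integral_localized_form int u_sq g_sq b_sq sum.distrib)
  also have "(\<integral>p. localized_form \<phi> \<theta> (?b p) (?u p) \<partial>PT T) =
      (\<integral>p. localized_form \<phi> \<theta> (?u p) (?b p) \<partial>PT T)"
    by (intro Bochner_Integration.integral_cong refl localized_form_commute)
  finally show ?thesis by (simp add: case_prod_unfold)
qed

section \<open>The stability estimate\<close>

lemma coercive_source_le_form:
  assumes coercive: "AE \<omega> in M. AE t in Time T. \<theta> * primal_int (\<lambda>x. (source_diff t \<omega> x)\<^sup>2) \<le>
      localized_form \<phi> \<theta> (source_diff t \<omega>) (source_diff t \<omega>)"
  shows "\<theta> * (\<integral>(t, \<omega>). primal_int (\<lambda>x. (source_diff t \<omega> x)\<^sup>2) \<partial>PT T) \<le>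
    (\<integral>(t, \<omega>). localized_form \<phi> \<theta> (source_diff t \<omega>) (source_diff t \<omega>) \<partial>PT T)"
proof -
  interpret pair: pair_sigma_finite "Time T" M by (rule pair_sigma_finite_Time)
  have g_sq: "square_integrable (PT T) (\<lambda>p. source_diff (fst p) (snd p) x)"
    if "x \<in> primal_mesh h" for x
    using source_square_integrable(3)[OF that] by (simp add: case_prod_unfold)
  define F where "F = (\<lambda>t \<omega>. localized_form \<phi> \<theta> (source_diff t \<omega>) (source_diff t \<omega>)
    - \<theta> * primal_int (\<lambda>x. (source_diff t \<omega> x)\<^sup>2))"
  have form_int: "integrable (PT T) (\<lambda>p. localized_form \<phi> \<theta> (source_diff (fst p) (snd p))
      (source_diff (fst p) (snd p)))"
    by (intro integrable_localized_form integrable_mult_square_integrable g_sq)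
  have mass_int: "integrable (PT T) (\<lambda>p. primal_int (\<lambda>x. (source_diff (fst p) (snd p) x)\<^sup>2))"
    by (intro integrable_mesh_integral_power2 g_sq)
  have F_int: "integrable (PT T) (\<lambda>(t, \<omega>). F t \<omega>)"
    using form_int mass_int by (simp add: F_def case_prod_unfold)
  have "0 \<le> (\<integral>\<omega>. (\<integral>t. F t \<omega> \<partial>Time T) \<partial>M)"
  proof (rule integral_nonneg_AE)
    show "AE \<omega> in M. 0 \<le> (\<integral>t. F t \<omega> \<partial>Time T)"
      using coercive
    proof eventually_elim
      case (elim \<omega>)
      then show ?case by (intro integral_nonneg_AE) (auto simp: F_def)
    qed
  qed
  also have "\<dots> = (\<integral>(t, \<omega>). F t \<omega> \<partial>PT T)" by (rule pair.integral_snd[OF F_int])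
  also have "\<dots> = (\<integral>(t, \<omega>). localized_form \<phi> \<theta> (source_diff t \<omega>) (source_diff t \<omega>) \<partial>PT T)
      - \<theta> * (\<integral>(t, \<omega>). primal_int (\<lambda>x. (source_diff t \<omega> x)\<^sup>2) \<partial>PT T)"
    using form_int mass_int by (simp add: F_def case_prod_unfold)
  finally show ?thesis by simp
qed

lemma coercive_dissipative_stability:
  assumes \<phi>: "\<And>x. 0 \<le> \<phi> x" "\<And>x. \<phi> x \<le> 1" and \<theta>: "0 \<le> \<theta>"
    and coercive: "AE \<omega> in M. AE t in Time T. \<theta> * primal_int (\<lambda>x. (source_diff t \<omega> x)\<^sup>2) \<le>
      localized_form \<phi> \<theta> (source_diff t \<omega>) (source_diff t \<omega>)"
    and dissipative: "AE (t, \<omega>) in PT T.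
      - 2 * localized_form \<phi> \<theta> (solution_diff t \<omega>) (drift_at t \<omega> (solution_diff t \<omega>)) \<le>
      k * mesh_integral h (G0 \<inter> primal_mesh h) (\<lambda>x. (solution_diff t \<omega> x)\<^sup>2)"
  shows "\<theta> * (\<integral>(t, \<omega>). primal_int (\<lambda>x. (source_diff t \<omega> x)\<^sup>2) \<partial>PT T) \<le>
    (\<integral>\<omega>. primal_int (\<lambda>x. (solution_diff T \<omega> x)\<^sup>2) \<partial>M) +
    k * (\<integral>(t, \<omega>). mesh_integral h (G0 \<inter> primal_mesh h) (\<lambda>x. (solution_diff t \<omega> x)\<^sup>2) \<partial>PT T)"
proof -
  let ?u = "\<lambda>p. solution_diff (fst p) (snd p)"
  let ?b = "\<lambda>p. drift_at (fst p) (snd p) (?u p)"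
  have u_sq: "square_integrable (PT T) (\<lambda>p. ?u p x)" for x
    using solution_diff_L2_adapted[of x] by (simp add: L2_adapted_def case_prod_unfold)
  have b_sq: "square_integrable (PT T) (\<lambda>p. ?b p x)" if "x \<in> primal_mesh h" for x
    using drift_solution_diff_L2_adapted[OF that] by (simp add: L2_adapted_def case_prod_unfold)
  have "- 2 * (\<integral>p. localized_form \<phi> \<theta> (?u p) (?b p) \<partial>PT T) =
      (\<integral>p. - 2 * localized_form \<phi> \<theta> (?u p) (?b p) \<partial>PT T)"
    by simp
  also have "\<dots> \<le> (\<integral>p. k * mesh_integral h (G0 \<inter> primal_mesh h) (\<lambda>x. (?u p x)\<^sup>2) \<partial>PT T)"
  proof (rule integral_mono_AE)
    show "AE p in PT T. - 2 * localized_form \<phi> \<theta> (?u p) (?b p) \<le>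
        k * mesh_integral h (G0 \<inter> primal_mesh h) (\<lambda>x. (?u p x)\<^sup>2)"
      using dissipative by (simp add: case_prod_unfold)
    show "integrable (PT T) (\<lambda>p. - 2 * localized_form \<phi> \<theta> (?u p) (?b p))"
      by (intro integrable_mult_right integrable_localized_form integrable_mult_square_integrable
          u_sq b_sq)
    show "integrable (PT T) (\<lambda>p. k * mesh_integral h (G0 \<inter> primal_mesh h) (\<lambda>x. (?u p x)\<^sup>2))"
      by (intro integrable_mult_right integrable_mesh_integral_power2 u_sq)
  qed
  finally have drift: "- 2 * (\<integral>p. localized_form \<phi> \<theta> (?u p) (?b p) \<partial>PT T) \<le>
      k * (\<integral>p. mesh_integral h (G0 \<inter> primal_mesh h) (\<lambda>x. (?u p x)\<^sup>2) \<partial>PT T)"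
    by simp
  have terminal: "(\<integral>\<omega>. localized_form \<phi> \<theta> (solution_diff T \<omega>) (solution_diff T \<omega>) \<partial>M) \<le>
      (\<integral>\<omega>. primal_int (\<lambda>x. (solution_diff T \<omega> x)\<^sup>2) \<partial>M)"
    by (intro integral_mono integrable_localized_form integrable_mesh_integral_power2
        integrable_mult_square_integrable solution_diff_terminal_square_integrable
        localized_form_le_primal_int \<phi> \<theta>)
  show ?thesis
    using coercive_source_le_form[OF coercive] drift terminal
      localized_form_ito_identity[of \<phi> \<theta>]
    by (simp add: case_prod_unfold)
qed

end

context brownian
begin

lemma L2F_norm_eq:
  fixes f :: "real \<Rightarrow> 'w \<Rightarrow> real ^ 'n \<Rightarrow> real"
  assumes h: "0 \<le> h" and f: "\<And>x. x \<in> W \<Longrightarrow> square_integrable (PT T) (\<lambda>(t, \<omega>). f t \<omega> x)"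
  shows "L2F_norm M T (L2_norm h W) f =
    sqrt (\<integral>(t, \<omega>). mesh_integral h W (\<lambda>x. (f t \<omega> x)\<^sup>2) \<partial>PT T)"
proof -
  have int: "integrable (PT T) (\<lambda>(t, \<omega>). mesh_integral h W (\<lambda>x. (f t \<omega> x)\<^sup>2))"
    using integrable_mesh_integral_power2[of W "PT T" "\<lambda>(t, \<omega>). f t \<omega>"] f
    by (simp add: case_prod_unfold)
  have "L2F_sq M T (L2_norm h W) f =
      (\<integral>\<^sup>+(t, \<omega>). ennreal (mesh_integral h W (\<lambda>x. (f t \<omega> x)\<^sup>2)) \<partial>PT T)"
    unfolding L2F_sq_def L2_norm_square[OF h]
    by (rule nn_integral_PT)
      (use borel_measurable_integrable[OF int] in \<open>simp add: case_prod_unfold\<close>)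
  also have "\<dots> = ennreal (\<integral>(t, \<omega>). mesh_integral h W (\<lambda>x. (f t \<omega> x)\<^sup>2) \<partial>PT T)"
    using nn_integral_eq_integral[OF int] h by (simp add: case_prod_unfold mesh_integral_nonneg)
  finally show ?thesis unfolding L2F_norm_def
    using h by (simp add: case_prod_unfold mesh_integral_nonneg)
qed

lemma L2Omega_norm_eq:
  fixes f :: "'w \<Rightarrow> real ^ 'n \<Rightarrow> real"
  assumes h: "0 \<le> h" and f: "\<And>x. x \<in> W \<Longrightarrow> square_integrable M (\<lambda>\<omega>. f \<omega> x)"
  shows "L2Omega_norm M (L2_norm h W) f = sqrt (\<integral>\<omega>. mesh_integral h W (\<lambda>x. (f \<omega> x)\<^sup>2) \<partial>M)"
proof -
  have "(\<integral>\<^sup>+\<omega>. ennreal (mesh_integral h W (\<lambda>x. (f \<omega> x)\<^sup>2)) \<partial>M) =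
      ennreal (\<integral>\<omega>. mesh_integral h W (\<lambda>x. (f \<omega> x)\<^sup>2) \<partial>M)"
    using h by (intro nn_integral_eq_integral integrable_mesh_integral_power2 f)
      (auto intro!: AE_I2 mesh_integral_nonneg)
  then show ?thesis
    unfolding L2Omega_norm_def L2Omega_sq_def L2_norm_square[OF h]
    using h by (simp add: mesh_integral_nonneg)
qed

lemma L2F_norm_cong_open:
  assumes "\<And>t \<omega>. t \<in> {0<..<T} \<Longrightarrow> nrm (f t \<omega>) = nrm (f' t \<omega>)"
  shows "L2F_norm M T nrm f = L2F_norm M T nrm f'"
proof -
  have "(\<integral>\<^sup>+t\<in>{0..T}. ennreal ((nrm (f t \<omega>))\<^sup>2) \<partial>lborel) =
      (\<integral>\<^sup>+t\<in>{0..T}. ennreal ((nrm (f' t \<omega>))\<^sup>2) \<partial>lborel)" for \<omega>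
  proof (rule nn_integral_cong_AE)
    show "AE t in lborel. ennreal ((nrm (f t \<omega>))\<^sup>2) * indicator {0..T} t =
        ennreal ((nrm (f' t \<omega>))\<^sup>2) * indicator {0..T} t"
      using AE_lborel_singleton[of 0] AE_lborel_singleton[of T]
      by eventually_elim (use assms in \<open>auto simp: indicator_def\<close>)
  qed
  then show ?thesis by (simp add: L2F_norm_def L2F_sq_def)
qed

end

definition cutoff_mass :: "nat \<Rightarrow> real \<Rightarrow> real" where
  "cutoff_mass n r = (r / (2 * real n)) ^ n * (r / 2)\<^sup>2"

definition form_weight :: "nat \<Rightarrow> real \<Rightarrow> real \<Rightarrow> real" where
  "form_weight n C0 r = coercivity_constant n C0 (cutoff_mass n r)"

definition stability_constant :: "nat \<Rightarrow> real \<Rightarrow> real \<Rightarrow> real \<Rightarrow> real \<Rightarrow> real \<Rightarrow> real" where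
  "stability_constant n c0 p R C0 r =
     sqrt ((1 + drift_constant n c0 R (potential_bound p R) (form_weight n C0 r))
       / form_weight n C0 r)"

lemma form_weight_pos: "0 < n \<Longrightarrow> 0 < r \<Longrightarrow> 0 < form_weight n C0 r"
  by (simp add: form_weight_def coercivity_constant_def cutoff_mass_def)

lemma stability_constant_pos:
  "0 < n \<Longrightarrow> 0 < r \<Longrightarrow> 0 < c0 \<Longrightarrow> 0 < stability_constant n c0 p R C0 r"
  unfolding stability_constant_def
  by (simp add: form_weight_pos drift_constant_nonneg add_pos_nonneg)

context source_pair
begin

lemma source_norm_eq:
  "L2F_norm M T (L2_norm h (primal_mesh h)) (\<lambda>t \<omega> x. g1 t \<omega> x - g2 t \<omega> x) =
    sqrt (\<integral>(t, \<omega>). primal_int (\<lambda>x. (source_diff t \<omega> x)\<^sup>2) \<partial>PT T)"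
  using L2F_norm_eq[OF h_nonneg source_square_integrable(3)] by (simp add: source_diff_def)

lemma observation_norm_eq:
  "X1_norm M T h G0 (Lambda1 T h G0 w1 - Lambda1 T h G0 w2) =
    sqrt (\<integral>(t, \<omega>). mesh_integral h (G0 \<inter> primal_mesh h) (\<lambda>x. (solution_diff t \<omega> x)\<^sup>2) \<partial>PT T) +
    sqrt (\<integral>\<omega>. primal_int (\<lambda>x. (solution_diff T \<omega> x)\<^sup>2) \<partial>M)"
proof -
  let ?obs = "Lambda1 T h G0 w1 - Lambda1 T h G0 w2"
  have "L2F_norm M T (L2_norm h (G0 \<inter> primal_mesh h)) (fst ?obs) =
      L2F_norm M T (L2_norm h (G0 \<inter> primal_mesh h)) solution_diff"
  proof (rule L2F_norm_cong_open)
    fix t \<omega> assume "t \<in> {0<..<T}"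
    then show "L2_norm h (G0 \<inter> primal_mesh h) (fst ?obs t \<omega>) =
        L2_norm h (G0 \<inter> primal_mesh h) (solution_diff t \<omega>)"
      unfolding L2_norm_def
      by (intro arg_cong[of _ _ sqrt] mesh_integral_cong)
        (auto simp: Lambda1_def solution_diff_def zero_ext_def)
  qed
  also have "\<dots> = sqrt (\<integral>(t, \<omega>). mesh_integral h (G0 \<inter> primal_mesh h)
      (\<lambda>x. (solution_diff t \<omega> x)\<^sup>2) \<partial>PT T)"
    using solution_diff_L2_adapted by (intro L2F_norm_eq h_nonneg) (simp add: L2_adapted_def)
  finally have interior: "L2F_norm M T (L2_norm h (G0 \<inter> primal_mesh h)) (fst ?obs) = \<dots>" .
  have "L2_norm h (primal_mesh h) (snd ?obs \<omega>) =
      L2_norm h (primal_mesh h) (solution_diff T \<omega>)" for \<omega>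
    unfolding L2_norm_def
    by (intro arg_cong[of _ _ sqrt] mesh_integral_cong)
      (auto simp: Lambda1_def solution_diff_def zero_ext_def)
  then have "L2Omega_norm M (L2_norm h (primal_mesh h)) (snd ?obs) =
      L2Omega_norm M (L2_norm h (primal_mesh h)) (solution_diff T)"
    by (simp add: L2Omega_norm_def L2Omega_sq_def)
  also have "\<dots> = sqrt (\<integral>\<omega>. primal_int (\<lambda>x. (solution_diff T \<omega> x)\<^sup>2) \<partial>M)"
    by (intro L2Omega_norm_eq h_nonneg solution_diff_terminal_square_integrable)
  finally show ?thesis using interior by (simp add: X1_norm_def)
qed

lemma AE_log_gradient_bound:
  assumes "\<And>i. AE \<omega> in M. AE t in lborel. t \<in> {0<..<T} \<longrightarrow> (\<forall>x\<in>dual h i (primal_mesh h).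
    \<bar>Dh h i (\<lambda>y. g1 t \<omega> y - g2 t \<omega> y) x\<bar> \<le> C0 * \<bar>Ah h i (\<lambda>y. g1 t \<omega> y - g2 t \<omega> y) x\<bar>)"
  shows "AE \<omega> in M. AE t in lborel. t \<in> {0<..<T} \<longrightarrow> log_gradient_bound C0 (source_diff t \<omega>)"
  using assms
  by (simp add: log_gradient_bound_def source_diff_def[abs_def] AE_all_countable flip: all_simps)

lemma source_form_coercive:
  fixes \<phi> :: "real ^ 'n \<Rightarrow> real"
  assumes C0: "0 < C0" "C0 * h \<le> 1"
    and log_gradient: "AE \<omega> in M. AE t in lborel. t \<in> {0<..<T} \<longrightarrow>
      log_gradient_bound C0 (source_diff t \<omega>)"
    and \<phi>: "\<And>x. 0 \<le> \<phi> x" "\<And>x. \<phi> x \<le> 1" and \<kappa>: "0 \<le> \<kappa>" "\<kappa> \<le> primal_int \<phi>"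
  defines "\<theta> \<equiv> coercivity_constant CARD('n) C0 \<kappa>"
  shows "AE \<omega> in M. AE t in Time T. \<theta> * primal_int (\<lambda>x. (source_diff t \<omega> x)\<^sup>2) \<le>
    localized_form \<phi> \<theta> (source_diff t \<omega>) (source_diff t \<omega>)"
  using log_gradient
proof eventually_elim
  case (elim \<omega>)
  then have "AE t in lborel. t \<in> {0..T} \<longrightarrow> log_gradient_bound C0 (source_diff t \<omega>)"
    using AE_lborel_singleton[of 0] AE_lborel_singleton[of T] by eventually_elim auto
  then have "AE t in Time T. log_gradient_bound C0 (source_diff t \<omega>)"
    by (subst AE_restrict_space_iff) auto
  then show ?case
    unfolding \<theta>_def by eventually_elim (intro localized_form_coercive C0 \<phi> \<kappa>)
qed

lemma solution_form_dissipative: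
  assumes n: "CARD('n) \<ge> 2" and c0: "0 < c0" and \<theta>: "0 < \<theta>" and G0: "G0 \<subseteq> unit_cube"
    and r: "0 < r" "r \<le> 1" "cball x\<^sub>0 (2 * r) \<subseteq> G0" and hr: "h \<le> r"
  shows "AE (t, \<omega>) in PT T.
    - 2 * localized_form (\<lambda>x. (bump r x\<^sub>0 x)\<^sup>2) \<theta> (solution_diff t \<omega>)
      (drift_at t \<omega> (solution_diff t \<omega>))
    \<le> drift_constant CARD('n) c0 R K \<theta>
      * mesh_integral h (G0 \<inter> primal_mesh h) (\<lambda>x. (solution_diff t \<omega> x)\<^sup>2)"
  using a1_bound a2_bound
proof eventually_elim
  case (elim p)
  have K_pos: "0 < K" using potential_bound_ge_1[of nstar R] by linarith
  show ?case
    unfolding case_prod_unfold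
  proof (rule localized_form_drift_le_observation[OF n c0 K_pos \<theta> G0 r hr])
    show "solution_diff (fst p) (snd p) x = 0" if "x \<notin> primal_mesh h" for x
      using that by (simp add: solution_diff_def zero_ext_def)
  qed (use elim \<gamma>_dual_bounds in auto)
qed

lemma source_stability:
  assumes n: "CARD('n) \<ge> 2" and c0: "0 < c0" and C0: "0 < C0" "C0 * h \<le> 1"
    and G0: "G0 \<subseteq> unit_cube" and r: "0 < r" "r \<le> 1" "cball x\<^sub>0 (2 * r) \<subseteq> G0"
    and hr: "h \<le> r / (2 * CARD('n))"
    and log_gradient: "AE \<omega> in M. AE t in lborel. t \<in> {0<..<T} \<longrightarrow>
      log_gradient_bound C0 (source_diff t \<omega>)"
  shows "L2F_norm M T (L2_norm h (primal_mesh h)) (\<lambda>t \<omega> x. g1 t \<omega> x - g2 t \<omega> x) \<le>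
    stability_constant CARD('n) c0 nstar R C0 r
      * X1_norm M T h G0 (Lambda1 T h G0 w1 - Lambda1 T h G0 w2)"
proof -
  define \<phi> where "\<phi> = (\<lambda>x. (bump r x\<^sub>0 x)\<^sup>2)"
  define \<theta> where "\<theta> = form_weight CARD('n) C0 r"
  define k where "k = drift_constant CARD('n) c0 R K \<theta>"
  have \<theta>: "0 < \<theta>" using r(1) by (simp add: \<theta>_def form_weight_pos)
  have k: "0 \<le> k" unfolding k_def by (rule drift_constant_nonneg[OF c0 \<theta>])
  have \<phi>: "0 \<le> \<phi> x" "\<phi> x \<le> 1" for x
    using bump_nonneg[of r x\<^sub>0 x] bump_le[of r x\<^sub>0 x] r by (auto simp: \<phi>_def intro: power_le_one)
  have \<kappa>: "0 \<le> cutoff_mass CARD('n) r" "cutoff_mass CARD('n) r \<le> primal_int \<phi>"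
  proof -
    have "ball x\<^sub>0 r \<subseteq> unit_cube" using r G0 by (auto simp: subset_eq)
    then show "cutoff_mass CARD('n) r \<le> primal_int \<phi>"
      using primal_int_bump_power2_ge[OF r(1) _ hr] by (simp add: \<phi>_def cutoff_mass_def)
  qed (use r in \<open>simp add: cutoff_mass_def\<close>)
  have "r / (2 * CARD('n)) \<le> r" using n r(1) by (simp add: divide_le_eq)
  then have "h \<le> r" using hr by linarith
  let ?G = "\<integral>(t, \<omega>). primal_int (\<lambda>x. (source_diff t \<omega> x)\<^sup>2) \<partial>PT T"
  let ?S = "\<integral>(t, \<omega>). mesh_integral h (G0 \<inter> primal_mesh h) (\<lambda>x. (solution_diff t \<omega> x)\<^sup>2) \<partial>PT T"
  let ?E = "\<integral>\<omega>. primal_int (\<lambda>x. (solution_diff T \<omega> x)\<^sup>2) \<partial>M"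
  have nonneg: "0 \<le> ?S" "0 \<le> ?E"
    using h_nonneg by (auto intro!: Bochner_Integration.integral_nonneg mesh_integral_nonneg)
  have "\<theta> * ?G \<le> ?E + k * ?S"
  proof (rule coercive_dissipative_stability[OF \<phi>])
    show "AE \<omega> in M. AE t in Time T. \<theta> * primal_int (\<lambda>x. (source_diff t \<omega> x)\<^sup>2) \<le>
        localized_form \<phi> \<theta> (source_diff t \<omega>) (source_diff t \<omega>)"
      unfolding \<theta>_def form_weight_def by (rule source_form_coercive[OF C0 log_gradient \<phi> \<kappa>])
  qed (use \<theta> solution_form_dissipative[OF n c0 \<theta> G0 r \<open>h \<le> r\<close>] in \<open>simp_all add: \<phi>_def k_def\<close>)
  also have "\<dots> \<le> (1 + k) * (sqrt ?S + sqrt ?E)\<^sup>2"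
    using nonneg k by (simp add: power2_sum algebra_simps)
  finally have "?G \<le> (1 + k) / \<theta> * (sqrt ?S + sqrt ?E)\<^sup>2"
    using \<theta> by (simp add: pos_le_divide_eq mult.commute)
  then have "sqrt ?G \<le> sqrt ((1 + k) / \<theta> * (sqrt ?S + sqrt ?E)\<^sup>2)" by simp
  also have "\<dots> = sqrt ((1 + k) / \<theta>) * (sqrt ?S + sqrt ?E)"
    unfolding real_sqrt_mult using nonneg by simp
  finally show ?thesis
    unfolding source_norm_eq observation_norm_eq stability_constant_def k_def \<theta>_def .
qed

end

section \<open>Lipschitz stability of the source\<close>

lemma open_contains_small_cball:
  fixes S :: "'a::real_normed_vector set"
  assumes "open S" "S \<noteq> {}"
  obtains x r where "0 < r" "r \<le> 1" "cball x (2 * r) \<subseteq> S"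
proof -
  obtain x e where e: "0 < e" "cball x e \<subseteq> S"
    using assms open_contains_cball by blast
  have "cball x (2 * min (e / 2) 1) \<subseteq> cball x e" by (rule subset_cball) simp
  then show thesis using e by (intro that[of "min (e / 2) 1" x]) auto
qed

lemma eventually_mesh_size_le:
  assumes "0 < \<delta>"
  obtains N0 :: nat where "\<And>N. N0 \<le> N \<Longrightarrow> 0 < N \<and> 1 / (real N + 1) \<le> \<delta>"
proof -
  obtain N0 :: nat where N0: "1 / \<delta> < real N0" using reals_Archimedean2 by blast
  show thesis
  proof (rule that)
    fix N assume "N0 \<le> N"
    then have N: "1 / \<delta> < real N" using N0 by linarith
    moreover have "0 < 1 / \<delta>" using assms by simp
    ultimately have "0 < real N" by linarith
    then show "0 < N \<and> 1 / (real N + 1) \<le> \<delta>" using N assms by (simp add: field_simps)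
  qed
qed

theorem theorem1p1:
  fixes G0 :: "(real ^ 'n) set" and T c0 nstar R C0 :: real
  assumes "CARD('n) \<ge> 2" and "T > 0"
    and "open G0" and "G0 \<noteq> {}" and "G0 \<subseteq> unit_cube"
    and "c0 > 0"
    and "CARD('n) = 2 \<longrightarrow> nstar > 2" and "CARD('n) \<ge> 3 \<longrightarrow> nstar \<ge> real CARD('n)"
    and "C0 > 0"
  shows "\<exists>C>0. \<exists>N0::nat.
    \<forall>(M :: 'w measure) B (\<gamma> :: 'n \<Rightarrow> real ^ 'n \<Rightarrow> real).
      brownian_basis M B \<and> diffusion_coeffs \<gamma> \<and> reg \<gamma> < ereal c0 \<longrightarrow>
      (\<forall>N\<ge>N0. \<forall>h. h = 1 / (real N + 1) \<longrightarrow>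
        (\<forall>a1 a2 g1 g2 w0 w1 w2.
          (\<forall>i. a1 i \<in> LinfF M (aug_filtration M B) T (primal_mesh h) (Linf_norm (primal_mesh h)) \<and>
               LinfF_norm M T (Linf_norm (primal_mesh h)) (a1 i) \<le> ereal R) \<and>
          a2 \<in> LinfF M (aug_filtration M B) T (primal_mesh h) (Lp_norm nstar h (primal_mesh h)) \<and>
          LinfF_norm M T (Lp_norm nstar h (primal_mesh h)) a2 \<le> ereal R \<and>
          g1 \<in> L2F M (aug_filtration M B) T (primal_mesh h \<union> mesh_boundary h) (H1_norm h) \<and>
          g2 \<in> L2F M (aug_filtration M B) T (primal_mesh h \<union> mesh_boundary h) (H1_norm h) \<and>
          (\<forall>i. AE \<omega> in M. AE t in lborel. t \<in> {0<..<T} \<longrightarrow>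
             (\<forall>x\<in>dual h i (primal_mesh h).
                \<bar>Dh h i (\<lambda>y. g1 t \<omega> y - g2 t \<omega> y) x\<bar>
                  \<le> C0 * \<bar>Ah h i (\<lambda>y. g1 t \<omega> y - g2 t \<omega> y) x\<bar>)) \<and>
          w0 \<in> L2Omega M (aug_filtration M B 0) (primal_mesh h) (L2_norm h (primal_mesh h)) \<and>
          is_solution M B T h \<gamma> a1 a2 g1 w0 w1 \<and>
          is_solution M B T h \<gamma> a1 a2 g2 w0 w2
          \<longrightarrow>
          L2F_norm M T (L2_norm h (primal_mesh h)) (\<lambda>t \<omega> x. g1 t \<omega> x - g2 t \<omega> x)
            \<le> C * X1_norm M T h G0 (Lambda1 T h G0 w1 - Lambda1 T h G0 w2)))"
proof -
  note n = assms(1) and c0 = assms(6) and C0 = assms(9)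
  have nstar: "2 \<le> nstar" "real CARD('n) \<le> nstar"
    using assms(1,7,8) by (cases "CARD('n) = 2"; simp)+
  obtain x\<^sub>0 r where r: "0 < r" "r \<le> 1" "cball x\<^sub>0 (2 * r) \<subseteq> G0"
    using open_contains_small_cball[OF assms(3,4)] by metis
  have "0 < min (1 / C0) (r / (2 * CARD('n)))" using C0 r(1) by simp
  then obtain N0 where N0:
      "\<And>N. N0 \<le> N \<Longrightarrow> 0 < N \<and> 1 / (real N + 1) \<le> min (1 / C0) (r / (2 * CARD('n)))"
    by (rule eventually_mesh_size_le) blast
  show ?thesis
  proof (intro exI[of _ "stability_constant CARD('n) c0 nstar R C0 r"] exI[of _ N0]
      conjI allI impI, goal_cases constant_pos estimate)
    case constant_pos
    show ?case using r(1) c0 by (intro stability_constant_pos) auto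
  next
    case (estimate M B \<gamma> N h a1 a2 g1 g2 w0 w1 w2)
    then have "0 < N" "h \<le> 1 / C0" "h \<le> r / (2 * CARD('n))" using N0[of N] by auto
    interpret prob_space M using estimate(1) by (simp add: brownian_basis_def)
    interpret source_pair M B N h T c0 nstar R \<gamma> a1 a2 g1 g2 w1 w2 w0
      using estimate(1,3,4) assms(2) nstar \<open>0 < N\<close>
      by unfold_locales (unfold brownian_basis_def, blast+)
    have "C0 * h \<le> 1" using C0 \<open>h \<le> 1 / C0\<close> by (simp add: field_simps)
    then show ?case
      by (rule source_stability[OF n c0 C0 _ assms(5) r \<open>h \<le> r / (2 * CARD('n))\<close>
            AE_log_gradient_bound]) (use estimate(4) in blast)
  qed
qed

end
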